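(* Let $(\mathcal{A},\Delta)$ be a Hopf algebra over $\mathbb{C}$, let $\mathcal{E}$ be a finite bicovariant $\mathcal{A}$-bimodule, let $\gamma$ be a $2$-cocycle on $\mathcal{A}$, and let $\mathcal{A}_\gamma$, $\mathcal{E}_\gamma$ be the corresponding cocycle deformations. Let $g:\mathcal{E}\otimes_{\mathcal{A}}\mathcal{E}\to\mathcal{A}$ be a bi-invariant pseudo-Riemannian metric on $\mathcal{E}$. Then: (1) $g$ deforms to a right $\mathcal{A}_\gamma$-linear map $g_\gamma:\mathcal{E}_\gamma\otimes_{\mathcal{A}_\gamma}\mathcal{E}_\gamma\to\mathcal{A}_\gamma$, namely $g_\gamma=g\circ\xi$ as $\mathbb{C}$-linear maps, where $\xi:\mathcal{E}_\gamma\otimes_{\mathcal{A}_\gamma}\mathcal{E}_\gamma\to(\mathcal{E}\otimes_{\mathcal{A}}\mathcal{E})_\gamma$ is the canonical isomorphism. (2) $g_\gamma$ is a bi-invariant pseudo-Riemannian metric on the bicovariant $\mathcal{A}_\gamma$-bimodule $\mathcal{E}_\gamma$. (3) Every bi-invariant pseudo-Riemannian metric on $\mathcal{E}_\gamma$ is of the form $g_\gamma$ for some bi-invariant pseudo-Riemannian metric $g$ on $\mathcal{E}$.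
   Context: All vector spaces are over $\mathbb{C}$; $\epsilon$ is the counit. Sweedler notation: $\Delta(a)=a_{(1)}\otimes a_{(2)}$; left coactions $\Delta_M(m)=m_{(-1)}\otimes m_{(0)}\in\mathcal{A}\otimes_{\mathbb{C}}M$; right coactions ${}_M\Delta(m)=m_{(0)}\otimes m_{(1)}\in M\otimes_{\mathbb{C}}\mathcal{A}$; $(\mathrm{id}\otimes{}_M\Delta)\Delta_M(m)=m_{(-1)}\otimes m_{(0)}\otimes m_{(1)}$. Bicovariant bimodule $(M,\Delta_M,{}_M\Delta)$: an $\mathcal{A}$-bimodule that is a left and a right $\mathcal{A}$-comodule with $(\mathrm{id}\otimes{}_M\Delta)\Delta_M=(\Delta_M\otimes\mathrm{id}){}_M\Delta$ and $\Delta_M(am)=\Delta(a)\Delta_M(m)$, $\Delta_M(ma)=\Delta_M(m)\Delta(a)$, ${}_M\Delta(am)=\Delta(a){}_M\Delta(m)$, ${}_M\Delta(ma)={}_M\Delta(m)\Delta(a)$. Invariant elements: ${}_0M=\{m:\Delta_M(m)=1\otimes m\}$, $M_0=\{m:{}_M\Delta(m)=m\otimes1\}$. $M$ is finite if $\dim_{\mathbb{C}}{}_0M<\infty$. The multiplication maps ${}_0M\otimes\mathcal{A}\to M$, $\mathcal{A}\otimes{}_0M\to M$, $M_0\otimes\mathcal{A}\to M$, $\mathcal{A}\otimes M_0\to M$ are taken as known to be isomorphisms. $M\otimes_{\mathcal{A}}N$ is bicovariant with $\Delta_{M\otimes_{\mathcal{A}}N}(m\otimes n)=m_{(-1)}n_{(-1)}\otimes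 m_{(0)}\otimes_{\mathcal{A}}n_{(0)}$ and ${}_{M\otimes_{\mathcal{A}}N}\Delta(m\otimes n)=m_{(0)}\otimes_{\mathcal{A}}n_{(0)}\otimes m_{(1)}n_{(1)}$. Braiding (Woronowicz, known): there is a unique $\mathcal{A}$-bimodule map $\sigma:\mathcal{E}\otimes_{\mathcal{A}}\mathcal{E}\to\mathcal{E}\otimes_{\mathcal{A}}\mathcal{E}$ with $\sigma(\omega\otimes_{\mathcal{A}}\eta)=\eta\otimes_{\mathcal{A}}\omega$ for $\omega\in{}_0\mathcal{E}$, $\eta\in\mathcal{E}_0$; it is invertible and bicovariant. A pseudo-Riemannian metric on $\mathcal{E}$ is a right $\mathcal{A}$-linear map $g:\mathcal{E}\otimes_{\mathcal{A}}\mathcal{E}\to\mathcal{A}$ with (i) $g\circ\sigma=g$; (ii) if $g(\rho\otimes_{\mathcal{A}}\nu)=0$ for all $\nu\in\mathcal{E}$ then $\rho=0$. It is left-invariant if $(\mathrm{id}\otimes\epsilon g)\Delta_{\mathcal{E}\otimes_{\mathcal{A}}\mathcal{E}}(\rho\otimes_{\mathcal{A}}\nu)=g(\rho\otimes_{\mathcal{A}}\nu)$ for all $\rho,\nu$; right-invariant if $(\epsilon g\otimes\mathrm{id})\,{}_{\mathcal{E}\otimes_{\mathcal{A}}\mathcal{E}}\Delta(\rho\otimes_{\mathcal{A}}\nu)=g(\rho\otimes_{\mathcal{A}}\nu)$ for all $\rho,\nu$; bi-invariant if both. (For $\mathcal{E}_\gamma$, use the same definitions over $\mathcal{A}_\gamma$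 with the Woronowicz braiding of $\mathcal{E}_\gamma$.) A $2$-cocycle on $\mathcal{A}$ is a convolution-invertible linear map $\gamma:\mathcal{A}\otimes_{\mathbb{C}}\mathcal{A}\to\mathbb{C}$ with $\gamma(a\otimes1)=\epsilon(a)=\gamma(1\otimes a)$ and $\gamma(a_{(1)}\otimes b_{(1)})\gamma(a_{(2)}b_{(2)}\otimes c)=\gamma(b_{(1)}\otimes c_{(1)})\gamma(a\otimes b_{(2)}c_{(2)})$; $\overline{\gamma}$ denotes its convolution inverse. $\mathcal{A}_\gamma$ is the Hopf algebra with the vector space and coproduct of $\mathcal{A}$ and product $a*_\gamma b=\gamma(a_{(1)}\otimes b_{(1)})a_{(2)}b_{(2)}\overline{\gamma}(a_{(3)}\otimes b_{(3)})$. For a bicovariant $\mathcal{A}$-bimodule $M$, $M_\gamma$ is the bicovariant $\mathcal{A}_\gamma$-bimodule with the vector space and coactions of $M$ and actions $a*_\gamma m=\gamma(a_{(1)}\otimes m_{(-1)})a_{(2)}m_{(0)}\overline{\gamma}(a_{(3)}\otimes m_{(1)})$, $m*_\gamma a=\gamma(m_{(-1)}\otimes a_{(1)})m_{(0)}a_{(2)}\overline{\gamma}(m_{(1)}\otimes a_{(3)})$. There is an isomorphism of bicovariant $\mathcal{A}_\gamma$-bimodules $\xi:M_\gamma\otimes_{\mathcal{A}_\gamma}N_\gamma\to(M\otimes_{\mathcal{A}}N)_\gamma$, $\xi(m\otimes_{\mathcal{A}_\gamma}n)=\gamma(m_{(-1)}\otimes n_{(-1)})\,m_{(0)}\otimes_{\mathcal{A}}n_{(0)}\,\overline{\gamma}(m_{(1)}\otimes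 n_{(1)})$. *)

theory Defs
  imports Complex_Main "HOL-Library.Poly_Mapping" "HOL-Library.FuncSet"
begin

section \<open>Complex vector spaces\<close>

class scaleC =
  fixes scaleC :: "complex \<Rightarrow> 'a \<Rightarrow> 'a" (infixr "*\<^sub>C" 75)

class complex_vector = ab_group_add + scaleC +
  assumes scaleC_add_right: "c *\<^sub>C (x + y) = c *\<^sub>C x + c *\<^sub>C y"
    and scaleC_add_left: "(c + d) *\<^sub>C x = c *\<^sub>C x + d *\<^sub>C x"
    and scaleC_scaleC: "c *\<^sub>C d *\<^sub>C x = (c * d) *\<^sub>C x"
    and scaleC_one: "1 *\<^sub>C x = x"

global_interpretation complex_vector:
  vector_space "scaleC :: complex \<Rightarrow> 'a \<Rightarrow> 'a::complex_vector"
  by unfold_locales (simp_all add: scaleC_add_right scaleC_add_left scaleC_scaleC scaleC_one)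

abbreviation clinear :: "('a::complex_vector \<Rightarrow> 'b::complex_vector) \<Rightarrow> bool"
  where "clinear \<equiv> Vector_Spaces.linear scaleC scaleC"

definition cbilinear ::
    "('a::complex_vector \<Rightarrow> 'b::complex_vector \<Rightarrow> 'c::complex_vector) \<Rightarrow> bool"
  where "cbilinear f \<longleftrightarrow> (\<forall>x. clinear (f x)) \<and> (\<forall>y. clinear (\<lambda>x. f x y))"

instantiation complex :: complex_vector
begin
definition scaleC_complex :: "complex \<Rightarrow> complex \<Rightarrow> complex"
  where "scaleC_complex = (*)"
instance
  by standard (simp_all add: scaleC_complex_def algebra_simps)
end

instantiation poly_mapping :: (type, complex_vector) complex_vector
begin
lift_definition scaleC_poly_mapping :: "complex \<Rightarrow> ('a \<Rightarrow>\<^sub>0 'b) \<Rightarrow> ('a \<Rightarrow>\<^sub>0 'b)"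
  is "\<lambda>c f x. c *\<^sub>C f x"
  by (erule finite_subset[rotated]) auto
instance
  by standard
    (transfer, simp add: scaleC_add_right scaleC_add_left scaleC_scaleC scaleC_one)+
end


section \<open>Tensor products over the complex numbers\<close>

text \<open>The free vector space on \<open>'a \<times> 'b\<close> modulo the bilinearity relations.\<close>

definition tensor_relators :: "('a::complex_vector \<times> 'b::complex_vector \<Rightarrow>\<^sub>0 complex) set"
  where "tensor_relators =
      {Poly_Mapping.single (a + a', b) 1 - Poly_Mapping.single (a, b) 1
        - Poly_Mapping.single (a', b) 1 | a a' b. True}
    \<union> {Poly_Mapping.single (a, b + b') 1 - Poly_Mapping.single (a, b) 1
        - Poly_Mapping.single (a, b') 1 | a b b'. True}
    \<union> {Poly_Mapping.single (c *\<^sub>C a, b) 1 - c *\<^sub>C Poly_Mapping.single (a, b) 1 | c a b. True}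
    \<union> {Poly_Mapping.single (a, c *\<^sub>C b) 1 - c *\<^sub>C Poly_Mapping.single (a, b) 1 | c a b. True}"

definition tensor_rel ::
    "('a::complex_vector \<times> 'b::complex_vector \<Rightarrow>\<^sub>0 complex) \<Rightarrow> ('a \<times> 'b \<Rightarrow>\<^sub>0 complex) \<Rightarrow> bool"
  where "tensor_rel s t \<longleftrightarrow> s - t \<in> complex_vector.span tensor_relators"

lemma equivp_tensor_rel: "equivp tensor_rel"
proof (rule equivpI)
  show "reflp tensor_rel"
    by (simp add: reflp_def tensor_rel_def complex_vector.span_zero)
  show "symp tensor_rel"
    unfolding symp_def tensor_rel_def by (metis complex_vector.span_neg minus_diff_eq)
  show "transp tensor_rel"
    unfolding transp_def tensor_rel_def using complex_vector.span_add by fastforce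
qed

quotient_type (overloaded) ('a, 'b) tensor (infixr "\<otimes>" 76) =
    "'a::complex_vector \<times> 'b::complex_vector \<Rightarrow>\<^sub>0 complex" / tensor_rel
  by (rule equivp_tensor_rel)

instantiation tensor :: (complex_vector, complex_vector) complex_vector
begin

lift_definition zero_tensor :: "'a \<otimes> 'b" is 0 .

lift_definition plus_tensor :: "'a \<otimes> 'b \<Rightarrow> 'a \<otimes> 'b \<Rightarrow> 'a \<otimes> 'b" is "(+)"
  unfolding tensor_rel_def add_diff_add by (rule complex_vector.span_add)

lift_definition minus_tensor :: "'a \<otimes> 'b \<Rightarrow> 'a \<otimes> 'b \<Rightarrow> 'a \<otimes> 'b" is "(-)"
proof -
  fix s s' t t' :: "'a \<times> 'b \<Rightarrow>\<^sub>0 complex"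
  assume "tensor_rel s s'" "tensor_rel t t'"
  then have "(s - s') - (t - t') \<in> complex_vector.span tensor_relators"
    unfolding tensor_rel_def by (rule complex_vector.span_diff)
  then show "tensor_rel (s - t) (s' - t')"
    unfolding tensor_rel_def by (simp add: algebra_simps)
qed

lift_definition uminus_tensor :: "'a \<otimes> 'b \<Rightarrow> 'a \<otimes> 'b" is "uminus"
  unfolding tensor_rel_def minus_diff_minus by (rule complex_vector.span_neg)

lift_definition scaleC_tensor :: "complex \<Rightarrow> 'a \<otimes> 'b \<Rightarrow> 'a \<otimes> 'b" is scaleC
  unfolding tensor_rel_def complex_vector.scale_right_diff_distrib[symmetric]
  by (rule complex_vector.span_scale)

instance
  by standard
    (transfer, simp add: tensor_rel_def complex_vector.span_zero algebra_simps
      scaleC_add_right scaleC_add_left scaleC_scaleC scaleC_one)+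

end

lift_definition tensor_pure :: "'a::complex_vector \<Rightarrow> 'b::complex_vector \<Rightarrow> 'a \<otimes> 'b"
    (infixr "\<otimes>" 76)
  is "\<lambda>a b. Poly_Mapping.single (a, b) 1" .

text \<open>
  \<open>tensor_lift f\<close> is the linear map with \<open>a \<otimes> b \<mapsto> f a b\<close>. It is computed on an arbitrary
  representative, hence is meaningful for bilinear \<open>f\<close> only (see the two lemmas below). Sweedler
  notation is rendered with it: for bilinear \<open>f\<close>, the expression \<open>f a\<^sub>(\<^sub>1\<^sub>) a\<^sub>(\<^sub>2\<^sub>)\<close> is
  \<open>tensor_lift f (\<Delta> a)\<close>.
\<close>

definition free_lift :: "('a \<Rightarrow> 'b \<Rightarrow> 'c::complex_vector) \<Rightarrow> ('a \<times> 'b \<Rightarrow>\<^sub>0 complex) \<Rightarrow> 'c"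
  where "free_lift f r =
    (\<Sum>p\<in>Poly_Mapping.keys r. Poly_Mapping.lookup r p *\<^sub>C f (fst p) (snd p))"

definition tensor_lift ::
    "('a::complex_vector \<Rightarrow> 'b::complex_vector \<Rightarrow> 'c::complex_vector) \<Rightarrow> 'a \<otimes> 'b \<Rightarrow> 'c"
  where "tensor_lift f t = free_lift f (rep_tensor t)"

lemma free_lift_superset:
  assumes "finite S" "Poly_Mapping.keys r \<subseteq> S"
  shows "free_lift f r = (\<Sum>p\<in>S. Poly_Mapping.lookup r p *\<^sub>C f (fst p) (snd p))"
  unfolding free_lift_def
  by (rule sum.mono_neutral_left) (use assms in \<open>auto simp: in_keys_iff\<close>)

lemma clinear_free_lift: "clinear (free_lift f)"
proof
  fix r s :: "'a \<times> 'b \<Rightarrow>\<^sub>0 complex" and c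
  let ?S = "Poly_Mapping.keys r \<union> Poly_Mapping.keys s"
  have "free_lift f (r + s) =
      (\<Sum>p\<in>?S. Poly_Mapping.lookup (r + s) p *\<^sub>C f (fst p) (snd p))"
    by (rule free_lift_superset) (auto simp: in_keys_iff lookup_add)
  also have "\<dots> = free_lift f r + free_lift f s"
    by (simp add: free_lift_superset[of ?S] lookup_add scaleC_add_left sum.distrib)
  finally show "free_lift f (r + s) = free_lift f r + free_lift f s" .
  have "free_lift f (c *\<^sub>C r) =
      (\<Sum>p\<in>Poly_Mapping.keys r. Poly_Mapping.lookup (c *\<^sub>C r) p *\<^sub>C f (fst p) (snd p))"
    by (rule free_lift_superset)
      (auto simp: in_keys_iff scaleC_poly_mapping.rep_eq scaleC_complex_def)
  then show "free_lift f (c *\<^sub>C r) = c *\<^sub>C free_lift f r"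
    by (simp add: free_lift_def scaleC_poly_mapping.rep_eq scaleC_complex_def
        complex_vector.scale_sum_right scaleC_scaleC)
qed

lemma free_lift_single [simp]: "free_lift f (Poly_Mapping.single (a, b) 1) = f a b"
  by (simp add: free_lift_def scaleC_one)

lemma free_lift_cong:
  assumes f: "cbilinear f" and rel: "tensor_rel r s"
  shows "free_lift f r = free_lift f s"
proof -
  interpret L: Vector_Spaces.linear scaleC scaleC "free_lift f" by (rule clinear_free_lift)
  interpret f1: Vector_Spaces.linear scaleC scaleC "f x" for x
    using f by (simp add: cbilinear_def)
  interpret f2: Vector_Spaces.linear scaleC scaleC "\<lambda>x. f x y" for y
    using f by (simp add: cbilinear_def)
  have gen: "free_lift f d = 0" if "d \<in> tensor_relators" for d
    using that unfolding tensor_relators_def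
    by (elim UnE CollectE exE conjE)
      (simp_all only: L.diff L.scale free_lift_single f1.add f1.scale f2.add f2.scale, simp_all)
  have "free_lift f d = 0" if "d \<in> complex_vector.span tensor_relators" for d
    using that
    by (rule complex_vector.span_induct)
      (auto simp: complex_vector.subspace_def L.zero L.add L.scale gen)
  then show ?thesis
    using rel by (metis L.diff eq_iff_diff_eq_0 tensor_rel_def)
qed

lemma tensor_lift_abs:
  assumes "cbilinear f"
  shows "tensor_lift f (abs_tensor r) = free_lift f r"
proof -
  have "tensor_rel r r"
    by (simp add: tensor_rel_def complex_vector.span_zero)
  then have "tensor_rel (rep_tensor (abs_tensor r)) r"
    by (rule Quotient3_rep_abs[OF Quotient3_tensor])
  with assms show ?thesis
    unfolding tensor_lift_def by (rule free_lift_cong)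
qed

lemma tensor_lift_pure: "cbilinear f \<Longrightarrow> tensor_lift f (a \<otimes> b) = f a b"
  by (simp add: tensor_pure.abs_eq tensor_lift_abs)

lemma clinear_tensor_lift:
  assumes "cbilinear f"
  shows "clinear (tensor_lift f)"
proof
  interpret L: Vector_Spaces.linear scaleC scaleC "free_lift f" by (rule clinear_free_lift)
  fix s t :: "'a \<otimes> 'b" and c
  obtain r where r: "s = abs_tensor r"
    by (rule that[OF Quotient3_abs_rep[OF Quotient3_tensor, symmetric]])
  obtain r' where r': "t = abs_tensor r'"
    by (rule that[OF Quotient3_abs_rep[OF Quotient3_tensor, symmetric]])
  from r r' show "tensor_lift f (s + t) = tensor_lift f s + tensor_lift f t"
    and "tensor_lift f (c *\<^sub>C s) = c *\<^sub>C tensor_lift f s"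
    by (simp_all add: plus_tensor.abs_eq scaleC_tensor.abs_eq tensor_lift_abs assms L.add L.scale)
qed

definition tensor_map ::
    "('a::complex_vector \<Rightarrow> 'c::complex_vector) \<Rightarrow> ('b::complex_vector \<Rightarrow> 'd::complex_vector)
      \<Rightarrow> 'a \<otimes> 'b \<Rightarrow> 'c \<otimes> 'd"
  where "tensor_map f g = tensor_lift (\<lambda>a b. f a \<otimes> g b)"

text \<open>\<open>(a \<otimes> b, c \<otimes> d) \<mapsto> p a c \<otimes> q b d\<close>, e.g. the product of \<open>A \<otimes> A\<close> or its action on \<open>A \<otimes> M\<close>.\<close>

definition tensor_map2 ::
    "('a::complex_vector \<Rightarrow> 'c::complex_vector \<Rightarrow> 'x::complex_vector)
      \<Rightarrow> ('b::complex_vector \<Rightarrow> 'd::complex_vector \<Rightarrow> 'y::complex_vector)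
      \<Rightarrow> 'a \<otimes> 'b \<Rightarrow> 'c \<otimes> 'd \<Rightarrow> 'x \<otimes> 'y"
  where "tensor_map2 p q s t =
    tensor_lift (\<lambda>a b. tensor_lift (\<lambda>c d. p a c \<otimes> q b d) t) s"

definition tensor_assoc ::
    "('a::complex_vector \<otimes> 'b::complex_vector) \<otimes> 'c::complex_vector \<Rightarrow> 'a \<otimes> ('b \<otimes> 'c)"
  where "tensor_assoc = tensor_lift (\<lambda>ab c. tensor_lift (\<lambda>a b. a \<otimes> (b \<otimes> c)) ab)"


section \<open>Hopf algebras and bicovariant bimodules\<close>

record (overloaded) ('a::complex_vector) hopf_data =
  hmult :: "'a \<Rightarrow> 'a \<Rightarrow> 'a"
  hone :: 'a
  comult :: "'a \<Rightarrow> 'a \<otimes> 'a"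
  counit :: "'a \<Rightarrow> complex"

locale hopf_algebra =
  fixes A :: "'a::complex_vector hopf_data"
  assumes mult_bilinear: "cbilinear (hmult A)"
    and mult_assoc: "hmult A (hmult A a b) c = hmult A a (hmult A b c)"
    and mult_one_left: "hmult A (hone A) a = a"
    and mult_one_right: "hmult A a (hone A) = a"
    and comult_linear: "clinear (comult A)"
    and counit_linear: "clinear (counit A)"
    and coassoc: "tensor_assoc (tensor_map (comult A) id (comult A a))
                    = tensor_map id (comult A) (comult A a)"
    and counit_left: "tensor_lift (\<lambda>a1 a2. counit A a1 *\<^sub>C a2) (comult A a) = a"
    and counit_right: "tensor_lift (\<lambda>a1 a2. counit A a2 *\<^sub>C a1) (comult A a) = a"
    and comult_mult: "comult A (hmult A a b)
                    = tensor_map2 (hmult A) (hmult A) (comult A a) (comult A b)"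
    and comult_one: "comult A (hone A) = hone A \<otimes> hone A"
    and counit_mult: "counit A (hmult A a b) = counit A a * counit A b"
    and counit_one: "counit A (hone A) = 1"
    and antipode_exists: "\<exists>S. clinear S \<and>
          (\<forall>a. tensor_lift (\<lambda>a1 a2. hmult A (S a1) a2) (comult A a) = counit A a *\<^sub>C hone A) \<and>
          (\<forall>a. tensor_lift (\<lambda>a1 a2. hmult A a1 (S a2)) (comult A a) = counit A a *\<^sub>C hone A)"

record (overloaded) ('a::complex_vector, 'm::complex_vector) bimod_data =
  lact :: "'a \<Rightarrow> 'm \<Rightarrow> 'm"
  ract :: "'m \<Rightarrow> 'a \<Rightarrow> 'm"
  lcoact :: "'m \<Rightarrow> 'a \<otimes> 'm"
  rcoact :: "'m \<Rightarrow> 'm \<otimes> 'a"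

locale bicovariant_bimodule = hopf_algebra A
  for A :: "'a::complex_vector hopf_data" +
  fixes M :: "('a, 'm::complex_vector) bimod_data"
  assumes lact_bilinear: "cbilinear (lact M)"
    and ract_bilinear: "cbilinear (ract M)"
    and lact_mult: "lact M (hmult A a b) m = lact M a (lact M b m)"
    and lact_one: "lact M (hone A) m = m"
    and ract_mult: "ract M m (hmult A a b) = ract M (ract M m a) b"
    and ract_one: "ract M m (hone A) = m"
    and lact_ract: "ract M (lact M a m) b = lact M a (ract M m b)"
    and lcoact_linear: "clinear (lcoact M)"
    and rcoact_linear: "clinear (rcoact M)"
    and lcoact_coassoc: "tensor_assoc (tensor_map (comult A) id (lcoact M m))
                           = tensor_map id (lcoact M) (lcoact M m)"
    and lcoact_counit: "tensor_lift (\<lambda>a x. counit A a *\<^sub>C x) (lcoact M m) = m"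
    and rcoact_coassoc: "tensor_assoc (tensor_map (rcoact M) id (rcoact M m))
                           = tensor_map id (comult A) (rcoact M m)"
    and rcoact_counit: "tensor_lift (\<lambda>x a. counit A a *\<^sub>C x) (rcoact M m) = m"
    and coact_commute: "tensor_map id (rcoact M) (lcoact M m)
                          = tensor_assoc (tensor_map (lcoact M) id (rcoact M m))"
    and lcoact_lact: "lcoact M (lact M a m)
                        = tensor_map2 (hmult A) (lact M) (comult A a) (lcoact M m)"
    and lcoact_ract: "lcoact M (ract M m a)
                        = tensor_map2 (hmult A) (ract M) (lcoact M m) (comult A a)"
    and rcoact_lact: "rcoact M (lact M a m)
                        = tensor_map2 (lact M) (hmult A) (comult A a) (rcoact M m)"
    and rcoact_ract: "rcoact M (ract M m a)
                        = tensor_map2 (ract M) (hmult A) (rcoact M m) (comult A a)"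

definition left_inv ::
    "'a::complex_vector hopf_data \<Rightarrow> ('a, 'm::complex_vector) bimod_data \<Rightarrow> 'm set"
  where "left_inv A M = {m. lcoact M m = hone A \<otimes> m}"

definition right_inv ::
    "'a::complex_vector hopf_data \<Rightarrow> ('a, 'm::complex_vector) bimod_data \<Rightarrow> 'm set"
  where "right_inv A M = {m. rcoact M m = m \<otimes> hone A}"

definition finite_bimodule ::
    "'a::complex_vector hopf_data \<Rightarrow> ('a, 'm::complex_vector) bimod_data \<Rightarrow> bool"
  where "finite_bimodule A M \<longleftrightarrow>
    (\<exists>B. finite B \<and> complex_vector.span B = left_inv A M)"


section \<open>Tensor products over the algebra\<close>

text \<open>
  The balanced tensor product of \<open>M\<close> and \<open>N\<close> over the algebra depends on the actions, so it is a
  set (\<open>atensor M N\<close>) rather than a type: its elements are the cosets in \<open>'m \<otimes> 'n\<close> of the subspace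
  spanned by all \<open>m a \<otimes> n - m \<otimes> a n\<close>. Its vector space operations and actions are computed on
  arbitrarily chosen representatives \<open>arep\<close>; only values on \<open>atensor M N\<close> matter.
\<close>

definition balanced ::
    "('a::complex_vector, 'm::complex_vector) bimod_data \<Rightarrow> ('a, 'n::complex_vector) bimod_data
      \<Rightarrow> ('m \<otimes> 'n) set"
  where "balanced M N =
    complex_vector.span {ract M m a \<otimes> n - m \<otimes> lact N a n | m a n. True}"

definition aclass ::
    "('a::complex_vector, 'm::complex_vector) bimod_data \<Rightarrow> ('a, 'n::complex_vector) bimod_data
      \<Rightarrow> 'm \<otimes> 'n \<Rightarrow> ('m \<otimes> 'n) set"
  where "aclass M N t = {s. s - t \<in> balanced M N}"

definition atensor ::
    "('a::complex_vector, 'm::complex_vector) bimod_data \<Rightarrow> ('a, 'n::complex_vector) bimod_data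
      \<Rightarrow> ('m \<otimes> 'n) set set"
  where "atensor M N = range (aclass M N)"

definition arep :: "('m::complex_vector \<otimes> 'n::complex_vector) set \<Rightarrow> 'm \<otimes> 'n"
  where "arep X = (SOME t. t \<in> X)"

definition aadd ::
    "('a::complex_vector, 'm::complex_vector) bimod_data \<Rightarrow> ('a, 'n::complex_vector) bimod_data
      \<Rightarrow> ('m \<otimes> 'n) set \<Rightarrow> ('m \<otimes> 'n) set \<Rightarrow> ('m \<otimes> 'n) set"
  where "aadd M N X Y = aclass M N (arep X + arep Y)"

definition ascale ::
    "('a::complex_vector, 'm::complex_vector) bimod_data \<Rightarrow> ('a, 'n::complex_vector) bimod_data
      \<Rightarrow> complex \<Rightarrow> ('m \<otimes> 'n) set \<Rightarrow> ('m \<otimes> 'n) set"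
  where "ascale M N c X = aclass M N (c *\<^sub>C arep X)"

definition alact ::
    "('a::complex_vector, 'm::complex_vector) bimod_data \<Rightarrow> ('a, 'n::complex_vector) bimod_data
      \<Rightarrow> 'a \<Rightarrow> ('m \<otimes> 'n) set \<Rightarrow> ('m \<otimes> 'n) set"
  where "alact M N a X = aclass M N (tensor_map (lact M a) id (arep X))"

definition aract ::
    "('a::complex_vector, 'm::complex_vector) bimod_data \<Rightarrow> ('a, 'n::complex_vector) bimod_data
      \<Rightarrow> ('m \<otimes> 'n) set \<Rightarrow> 'a \<Rightarrow> ('m \<otimes> 'n) set"
  where "aract M N X a = aclass M N (tensor_map id (\<lambda>n. ract N n a) (arep X))"

text \<open>
  The coactions \<open>m \<otimes> n \<mapsto> m\<^sub>(\<^sub>-\<^sub>1\<^sub>) n\<^sub>(\<^sub>-\<^sub>1\<^sub>) \<otimes> (m\<^sub>(\<^sub>0\<^sub>) \<otimes> n\<^sub>(\<^sub>0\<^sub>))\<close> and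
  \<open>m \<otimes> n \<mapsto> (m\<^sub>(\<^sub>0\<^sub>) \<otimes> n\<^sub>(\<^sub>0\<^sub>)) \<otimes> m\<^sub>(\<^sub>1\<^sub>) n\<^sub>(\<^sub>1\<^sub>)\<close> on representatives. The coactions of the
  balanced tensor product are obtained by passing to the class in the factor \<open>'m \<otimes> 'n\<close>.
\<close>

definition lcoact_tensor ::
    "'a::complex_vector hopf_data \<Rightarrow> ('a, 'm::complex_vector) bimod_data
      \<Rightarrow> ('a, 'n::complex_vector) bimod_data \<Rightarrow> 'm \<otimes> 'n \<Rightarrow> 'a \<otimes> ('m \<otimes> 'n)"
  where "lcoact_tensor A M N =
    tensor_lift (\<lambda>m n. tensor_map2 (hmult A) (\<otimes>) (lcoact M m) (lcoact N n))"

definition rcoact_tensor ::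
    "'a::complex_vector hopf_data \<Rightarrow> ('a, 'm::complex_vector) bimod_data
      \<Rightarrow> ('a, 'n::complex_vector) bimod_data \<Rightarrow> 'm \<otimes> 'n \<Rightarrow> ('m \<otimes> 'n) \<otimes> 'a"
  where "rcoact_tensor A M N =
    tensor_lift (\<lambda>m n. tensor_map2 (\<otimes>) (hmult A) (rcoact M m) (rcoact N n))"

definition bimodule_endo ::
    "('a::complex_vector, 'm::complex_vector) bimod_data \<Rightarrow> ('a, 'n::complex_vector) bimod_data
      \<Rightarrow> (('m \<otimes> 'n) set \<Rightarrow> ('m \<otimes> 'n) set) \<Rightarrow> bool"
  where "bimodule_endo M N f \<longleftrightarrow>
      f \<in> atensor M N \<rightarrow> atensor M N \<and>
      (\<forall>X\<in>atensor M N. \<forall>Y\<in>atensor M N. f (aadd M N X Y) = aadd M N (f X) (f Y)) \<and>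
      (\<forall>c. \<forall>X\<in>atensor M N. f (ascale M N c X) = ascale M N c (f X)) \<and>
      (\<forall>a. \<forall>X\<in>atensor M N. f (alact M N a X) = alact M N a (f X)) \<and>
      (\<forall>a. \<forall>X\<in>atensor M N. f (aract M N X a) = aract M N (f X) a)"

definition right_linear ::
    "'a::complex_vector hopf_data \<Rightarrow> ('a, 'm::complex_vector) bimod_data
      \<Rightarrow> ('a, 'n::complex_vector) bimod_data \<Rightarrow> (('m \<otimes> 'n) set \<Rightarrow> 'a) \<Rightarrow> bool"
  where "right_linear A M N g \<longleftrightarrow>
      (\<forall>X\<in>atensor M N. \<forall>Y\<in>atensor M N. g (aadd M N X Y) = g X + g Y) \<and>
      (\<forall>c. \<forall>X\<in>atensor M N. g (ascale M N c X) = c *\<^sub>C g X) \<and>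
      (\<forall>a. \<forall>X\<in>atensor M N. g (aract M N X a) = hmult A (g X) a)"


section \<open>The braiding and pseudo-Riemannian metrics\<close>

text \<open>\<open>extensional\<close> only pins down the irrelevant values outside the balanced tensor product.\<close>

definition braiding ::
    "'a::complex_vector hopf_data \<Rightarrow> ('a, 'e::complex_vector) bimod_data
      \<Rightarrow> ('e \<otimes> 'e) set \<Rightarrow> ('e \<otimes> 'e) set"
  where "braiding A E = (THE \<sigma>. \<sigma> \<in> extensional (atensor E E) \<and> bimodule_endo E E \<sigma> \<and>
    (\<forall>\<omega>\<in>left_inv A E. \<forall>\<eta>\<in>right_inv A E. \<sigma> (aclass E E (\<omega> \<otimes> \<eta>)) = aclass E E (\<eta> \<otimes> \<omega>)))"

definition pseudo_riemannian_metric ::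
    "'a::complex_vector hopf_data \<Rightarrow> ('a, 'e::complex_vector) bimod_data
      \<Rightarrow> (('e \<otimes> 'e) set \<Rightarrow> 'a) \<Rightarrow> bool"
  where "pseudo_riemannian_metric A E g \<longleftrightarrow>
      right_linear A E E g \<and>
      (\<forall>X\<in>atensor E E. g (braiding A E X) = g X) \<and>
      (\<forall>\<rho>. (\<forall>\<nu>. g (aclass E E (\<rho> \<otimes> \<nu>)) = 0) \<longrightarrow> \<rho> = 0)"

definition left_invariant ::
    "'a::complex_vector hopf_data \<Rightarrow> ('a, 'e::complex_vector) bimod_data
      \<Rightarrow> (('e \<otimes> 'e) set \<Rightarrow> 'a) \<Rightarrow> bool"
  where "left_invariant A E g \<longleftrightarrow>
    (\<forall>\<rho> \<nu>. tensor_lift (\<lambda>a t. counit A (g (aclass E E t)) *\<^sub>C a) (lcoact_tensor A E E (\<rho> \<otimes> \<nu>))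
      = g (aclass E E (\<rho> \<otimes> \<nu>)))"

definition right_invariant ::
    "'a::complex_vector hopf_data \<Rightarrow> ('a, 'e::complex_vector) bimod_data
      \<Rightarrow> (('e \<otimes> 'e) set \<Rightarrow> 'a) \<Rightarrow> bool"
  where "right_invariant A E g \<longleftrightarrow>
    (\<forall>\<rho> \<nu>. tensor_lift (\<lambda>t a. counit A (g (aclass E E t)) *\<^sub>C a) (rcoact_tensor A E E (\<rho> \<otimes> \<nu>))
      = g (aclass E E (\<rho> \<otimes> \<nu>)))"

definition bi_invariant_metric ::
    "'a::complex_vector hopf_data \<Rightarrow> ('a, 'e::complex_vector) bimod_data
      \<Rightarrow> (('e \<otimes> 'e) set \<Rightarrow> 'a) \<Rightarrow> bool"
  where "bi_invariant_metric A E g \<longleftrightarrow>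
    pseudo_riemannian_metric A E g \<and> left_invariant A E g \<and> right_invariant A E g"


section \<open>Cocycle deformation\<close>

definition convolution ::
    "'a::complex_vector hopf_data \<Rightarrow> ('a \<otimes> 'a \<Rightarrow> complex) \<Rightarrow> ('a \<otimes> 'a \<Rightarrow> complex)
      \<Rightarrow> 'a \<Rightarrow> 'a \<Rightarrow> complex"
  where "convolution A \<phi> \<psi> a b =
    tensor_lift (\<lambda>a1 a2. tensor_lift (\<lambda>b1 b2. \<phi> (a1 \<otimes> b1) * \<psi> (a2 \<otimes> b2)) (comult A b)) (comult A a)"

definition is_conv_inverse ::
    "'a::complex_vector hopf_data \<Rightarrow> ('a \<otimes> 'a \<Rightarrow> complex) \<Rightarrow> ('a \<otimes> 'a \<Rightarrow> complex) \<Rightarrow> bool"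
  where "is_conv_inverse A \<gamma> \<delta> \<longleftrightarrow> clinear \<delta> \<and>
    (\<forall>a b. convolution A \<gamma> \<delta> a b = counit A a * counit A b) \<and>
    (\<forall>a b. convolution A \<delta> \<gamma> a b = counit A a * counit A b)"

definition conv_inverse ::
    "'a::complex_vector hopf_data \<Rightarrow> ('a \<otimes> 'a \<Rightarrow> complex) \<Rightarrow> 'a \<otimes> 'a \<Rightarrow> complex"
  where "conv_inverse A \<gamma> = (THE \<delta>. is_conv_inverse A \<gamma> \<delta>)"

definition two_cocycle ::
    "'a::complex_vector hopf_data \<Rightarrow> ('a \<otimes> 'a \<Rightarrow> complex) \<Rightarrow> bool"
  where "two_cocycle A \<gamma> \<longleftrightarrow>
    clinear \<gamma> \<and> (\<exists>\<delta>. is_conv_inverse A \<gamma> \<delta>) \<and>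
    (\<forall>a. \<gamma> (a \<otimes> hone A) = counit A a \<and> \<gamma> (hone A \<otimes> a) = counit A a) \<and>
    (\<forall>a b c.
      tensor_lift (\<lambda>a1 a2. tensor_lift (\<lambda>b1 b2. \<gamma> (a1 \<otimes> b1) * \<gamma> (hmult A a2 b2 \<otimes> c))
        (comult A b)) (comult A a)
      = tensor_lift (\<lambda>b1 b2. tensor_lift (\<lambda>c1 c2. \<gamma> (b1 \<otimes> c1) * \<gamma> (a \<otimes> hmult A b2 c2))
        (comult A c)) (comult A b))"

text \<open>\<open>f a\<^sub>(\<^sub>1\<^sub>) a\<^sub>(\<^sub>2\<^sub>) a\<^sub>(\<^sub>3\<^sub>)\<close> and \<open>f m\<^sub>(\<^sub>-\<^sub>1\<^sub>) m\<^sub>(\<^sub>0\<^sub>) m\<^sub>(\<^sub>1\<^sub>)\<close> for trilinear \<open>f\<close>.\<close>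

definition sweedler3 ::
    "'a::complex_vector hopf_data \<Rightarrow> ('a \<Rightarrow> 'a \<Rightarrow> 'a \<Rightarrow> 'c::complex_vector) \<Rightarrow> 'a \<Rightarrow> 'c"
  where "sweedler3 A f a =
    tensor_lift (\<lambda>a1 x. tensor_lift (\<lambda>a2 a3. f a1 a2 a3) (comult A x)) (comult A a)"

definition sweedler_bi ::
    "('a::complex_vector, 'm::complex_vector) bimod_data
      \<Rightarrow> ('a \<Rightarrow> 'm \<Rightarrow> 'a \<Rightarrow> 'c::complex_vector) \<Rightarrow> 'm \<Rightarrow> 'c"
  where "sweedler_bi M f m =
    tensor_lift (\<lambda>ml x. tensor_lift (\<lambda>m0 mr. f ml m0 mr) (rcoact M x)) (lcoact M m)"

definition deform_hopf ::
    "'a::complex_vector hopf_data \<Rightarrow> ('a \<otimes> 'a \<Rightarrow> complex) \<Rightarrow> 'a hopf_data"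
  where "deform_hopf A \<gamma> = A\<lparr>hmult := (\<lambda>a b.
    sweedler3 A (\<lambda>a1 a2 a3. sweedler3 A (\<lambda>b1 b2 b3.
      (\<gamma> (a1 \<otimes> b1) * conv_inverse A \<gamma> (a3 \<otimes> b3)) *\<^sub>C hmult A a2 b2) b) a)\<rparr>"

definition deform_bimod ::
    "'a::complex_vector hopf_data \<Rightarrow> ('a \<otimes> 'a \<Rightarrow> complex)
      \<Rightarrow> ('a, 'm::complex_vector) bimod_data \<Rightarrow> ('a, 'm) bimod_data"
  where "deform_bimod A \<gamma> M = M\<lparr>
    lact := (\<lambda>a m. sweedler3 A (\<lambda>a1 a2 a3. sweedler_bi M (\<lambda>ml m0 mr.
      (\<gamma> (a1 \<otimes> ml) * conv_inverse A \<gamma> (a3 \<otimes> mr)) *\<^sub>C lact M a2 m0) m) a),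
    ract := (\<lambda>m a. sweedler_bi M (\<lambda>ml m0 mr. sweedler3 A (\<lambda>a1 a2 a3.
      (\<gamma> (ml \<otimes> a1) * conv_inverse A \<gamma> (mr \<otimes> a3)) *\<^sub>C ract M m0 a2) a) m)\<rparr>"

text \<open>
  The canonical isomorphism \<open>\<xi>\<close>: its source consists of classes with respect to the deformed
  actions, its target of classes with respect to the original ones. \<open>xi_rep\<close> is
  \<open>m \<otimes> n \<mapsto> \<gamma>(m\<^sub>(\<^sub>-\<^sub>1\<^sub>) \<otimes> n\<^sub>(\<^sub>-\<^sub>1\<^sub>)) m\<^sub>(\<^sub>0\<^sub>) \<otimes> n\<^sub>(\<^sub>0\<^sub>) \<gamma>\<inverse>(m\<^sub>(\<^sub>1\<^sub>) \<otimes> n\<^sub>(\<^sub>1\<^sub>))\<close>.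
\<close>

definition xi_rep ::
    "'a::complex_vector hopf_data \<Rightarrow> ('a \<otimes> 'a \<Rightarrow> complex)
      \<Rightarrow> ('a, 'm::complex_vector) bimod_data \<Rightarrow> ('a, 'n::complex_vector) bimod_data
      \<Rightarrow> 'm \<otimes> 'n \<Rightarrow> 'm \<otimes> 'n"
  where "xi_rep A \<gamma> M N = tensor_lift (\<lambda>m n.
    sweedler_bi M (\<lambda>ml m0 mr. sweedler_bi N (\<lambda>nl n0 nr.
      (\<gamma> (ml \<otimes> nl) * conv_inverse A \<gamma> (mr \<otimes> nr)) *\<^sub>C (m0 \<otimes> n0)) n) m)"

definition xi ::
    "'a::complex_vector hopf_data \<Rightarrow> ('a \<otimes> 'a \<Rightarrow> complex)
      \<Rightarrow> ('a, 'm::complex_vector) bimod_data \<Rightarrow> ('a, 'n::complex_vector) bimod_data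
      \<Rightarrow> ('m \<otimes> 'n) set \<Rightarrow> ('m \<otimes> 'n) set"
  where "xi A \<gamma> M N X = aclass M N (xi_rep A \<gamma> M N (arep X))"

text \<open>\<open>g \<circ> \<xi>\<close>, as a function on the balanced square of the deformed bimodule.\<close>

definition deform_metric ::
    "'a::complex_vector hopf_data \<Rightarrow> ('a \<otimes> 'a \<Rightarrow> complex)
      \<Rightarrow> ('a, 'e::complex_vector) bimod_data \<Rightarrow> (('e \<otimes> 'e) set \<Rightarrow> 'a) \<Rightarrow> ('e \<otimes> 'e) set \<Rightarrow> 'a"
  where "deform_metric A \<gamma> E g = g \<circ> xi A \<gamma> E E"

end

theory Submission
  imports Defs
begin

text \<open>
  Linear functionals on a coalgebra act on its comodules from both sides, and linear functionals
  separate the points of \<open>A \<otimes> M\<close>, so every identity between coactions becomes an identity between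
  these commuting operators. The deformed product, the deformed actions and \<open>g \<circ> \<xi>\<close> are all
  obtained from a bilinear map \<open>\<mu>\<close> by precomposing with the operator of \<open>\<gamma>\<close> on the left and of
  \<open>\<gamma>\<inverse>\<close> on the right. By the cocycle identity this operation preserves associativity relations
  and colinearity, and twisting by \<open>\<gamma>\<inverse>\<close> over \<open>A\<^sub>\<gamma>\<close> undoes it. Hence the axioms of \<open>A\<^sub>\<gamma>\<close>
  (except for the antipode) and of \<open>\<E>\<^sub>\<gamma>\<close>, and the invariance and right linearity of \<open>g\<^sub>\<gamma>\<close>, are
  instances of a single computation, and the surjectivity of \<open>g \<mapsto> g\<^sub>\<gamma>\<close> follows by deforming
  back. The antipode of \<open>A\<^sub>\<gamma>\<close> is \<open>a \<mapsto> U(a\<^sub>(\<^sub>1\<^sub>)) S(a\<^sub>(\<^sub>2\<^sub>)) V(a\<^sub>(\<^sub>3\<^sub>))\<close> with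
  \<open>U(a) = \<gamma>(a\<^sub>(\<^sub>1\<^sub>) \<otimes> S(a\<^sub>(\<^sub>2\<^sub>)))\<close> and \<open>V(a) = \<gamma>\<inverse>(S(a\<^sub>(\<^sub>1\<^sub>)) \<otimes> a\<^sub>(\<^sub>2\<^sub>))\<close>, where
  \<open>U * V = \<epsilon>\<close>.

  Since tensors of a left-invariant \<open>\<omega>\<close> and a right-invariant \<open>\<eta>\<close> generate the bimodule, \<open>g\<close> is
  invariant under the braiding iff \<open>g(a \<omega> \<otimes> \<eta>) = g(a \<eta> \<otimes> \<omega>)\<close>, and \<open>\<xi>\<close> fixes both
  \<open>\<omega> \<otimes> \<eta>\<close> and \<open>\<eta> \<otimes> \<omega>\<close>. Right invariance reduces nondegeneracy to right-invariant elements,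
  where left invariance gives \<open>\<epsilon> g\<^sub>\<gamma>(\<eta> \<otimes> \<eta>') = \<epsilon> g(U(\<eta>\<^sub>(\<^sub>-\<^sub>1\<^sub>)) \<eta>\<^sub>(\<^sub>0\<^sub>) \<otimes> \<eta>')\<close>, and \<open>V\<close> recovers \<open>\<eta>\<close>.
\<close>

\<comment> \<open>A cocycle is a functional on A \<otimes> A that need not factor through the
  product, so tensor products are kept as comodules over A \<otimes> A (\<open>tens\<close>), and
  the product enters afterwards as a coalgebra map along which functionals are pulled back. The
  cocycle identity becomes an equation between two functionals on a threefold tensor product,
  independent of the modules on which they act.

  Since a metric is linear on the right only, braiding symmetry cannot be reduced to pairs of
  invariant elements alone: a left coefficient has to be carried along. Deforming this condition is
  itself an associativity problem, in which the tensor product is one of the bilinear maps.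

  The obstacle to nondegeneracy is that the twist acts on both arguments at once, so a vector in the
  kernel of the deformed form need not visibly produce one in the kernel of the original form. It
  works on right-invariant pairs because there the form takes scalar values, and a scalar passes
  through the antipode that moves the cocycle onto the first argument.\<close>
section \<open>Multilinear maps and Sweedler sums\<close>

text \<open>\<open>\<ointegral>x y\<leftarrow>\<Delta> a. f x y\<close> is the Sweedler sum \<open>f a\<^sub>(\<^sub>1\<^sub>) a\<^sub>(\<^sub>2\<^sub>)\<close>. The rules \<open>lin\<close> prove that terms are
  linear in a variable, and the rules \<open>pull\<close> move Sweedler sums outwards.\<close>

syntax "_sweedler" :: "idt \<Rightarrow> idt \<Rightarrow> 'a \<Rightarrow> 'b \<Rightarrow> 'b"
  ("(3\<ointegral>_ _\<leftarrow>_./ _)" [0, 0, 51, 10] 10)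
translations "\<ointegral>x y\<leftarrow>t. e" \<rightleftharpoons> "CONST tensor_lift (\<lambda>x y. e) t"

named_theorems lin and pull

lemma clinearI:
  assumes "\<And>x y. f (x + y) = f x + f y" "\<And>c x. f (c *\<^sub>C x) = c *\<^sub>C f x"
  shows "clinear f"
  by unfold_locales (simp_all add: assms)

lemma clinear_add: "clinear f \<Longrightarrow> f (x + y) = f x + f y"
  and clinear_scale: "clinear f \<Longrightarrow> f (c *\<^sub>C x) = c *\<^sub>C f x"
  and clinear_zero: "clinear f \<Longrightarrow> f 0 = 0"
  and clinear_diff: "clinear f \<Longrightarrow> f (x - y) = f x - f y"
proof -
  assume "clinear f"
  then interpret Vector_Spaces.linear scaleC scaleC f .
  show "f (x + y) = f x + f y" "f (c *\<^sub>C x) = c *\<^sub>C f x" "f 0 = 0" "f (x - y) = f x - f y"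
    by (rule add scale zero diff)+
qed

lemma clinear_sum: "clinear f \<Longrightarrow> f (\<Sum>i\<in>I. g i) = (\<Sum>i\<in>I. f (g i))"
  by (induction I rule: infinite_finite_induct) (simp_all add: clinear_zero clinear_add)

lemma cbilinearI:
  assumes "\<And>x. clinear (f x)" "\<And>y. clinear (\<lambda>x. f x y)"
  shows "cbilinear f"
  using assms by (simp add: cbilinear_def)

lemma cbilinearD1: "cbilinear f \<Longrightarrow> clinear (f x)"
  and cbilinearD2: "cbilinear f \<Longrightarrow> clinear (\<lambda>x. f x y)"
  by (simp_all add: cbilinear_def)

lemma clinear_compose: "clinear h \<Longrightarrow> clinear f \<Longrightarrow> clinear (\<lambda>x. h (f x))"
  by (intro clinearI) (simp_all add: clinear_add clinear_scale)

lemma clinear_ident [lin]: "clinear (\<lambda>x. x)"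
  by (intro clinearI) simp_all

lemma clinear_id [lin]: "clinear id"
  by (intro clinearI) simp_all

lemma clinear_scaleC_right [lin]: "clinear f \<Longrightarrow> clinear (\<lambda>x. c *\<^sub>C f x)"
  by (intro clinearI)
    (simp_all add: clinear_add clinear_scale scaleC_add_right scaleC_scaleC mult.commute)

lemma clinear_scaleC_left [lin]: "clinear f \<Longrightarrow> clinear (\<lambda>x. f x *\<^sub>C v)"
  by (intro clinearI)
    (simp_all add: clinear_add clinear_scale scaleC_add_left scaleC_scaleC scaleC_complex_def)

lemma clinear_mult_left [lin]: "clinear f \<Longrightarrow> clinear (\<lambda>x. f x * (c::complex))"
  and clinear_mult_right [lin]: "clinear f \<Longrightarrow> clinear (\<lambda>x. (c::complex) * f x)"
  by (intro clinearI; simp add: clinear_add clinear_scale scaleC_complex_def algebra_simps)+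

lemma clinear_diff_fun [lin]: "clinear f \<Longrightarrow> clinear g \<Longrightarrow> clinear (\<lambda>x. f x - g x)"
  by (intro clinearI; simp add: clinear_add clinear_scale algebra_simps
      complex_vector.scale_right_diff_distrib)

lemma tensor_lift_diff: "(\<ointegral>a b\<leftarrow>t. f a b - g a b) = tensor_lift f t - tensor_lift g t"
  by (simp add: tensor_lift_def free_lift_def complex_vector.scale_right_diff_distrib sum_subtractf)

lemma tensor_lift_zero [simp]: "(\<ointegral>a b\<leftarrow>t. 0) = 0"
  by (simp add: tensor_lift_def free_lift_def)

text \<open>A \<open>tensor_lift\<close> is a finite linear combination over the chosen
  representative of \<open>t\<close>, so linear maps pass through it for arbitrary \<open>f\<close>;
  bilinearity of \<open>f\<close> only governs how the value depends on \<open>t\<close>.\<close>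

lemma clinear_tensor_lift_pull:
  "clinear h \<Longrightarrow> h (tensor_lift f t) = (\<ointegral>a b\<leftarrow>t. h (f a b))"
  unfolding tensor_lift_def free_lift_def by (simp only: clinear_sum clinear_scale)

lemma tensor_lift_swap:
  "(\<ointegral>a b\<leftarrow>s. \<ointegral>c d\<leftarrow>t. f a b c d) = (\<ointegral>c d\<leftarrow>t. \<ointegral>a b\<leftarrow>s. f a b c d)"
  unfolding tensor_lift_def free_lift_def complex_vector.scale_sum_right
  by (subst sum.swap) (simp add: complex_vector.scale_left_commute mult.commute)

lemma tensor_lift_mem_subspace:
  assumes "complex_vector.subspace W" "\<And>a b. f a b \<in> W"
  shows "tensor_lift f t \<in> W"
  unfolding tensor_lift_def free_lift_def
  by (intro complex_vector.subspace_sum complex_vector.subspace_scale assms)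

lemma clinear_tensor_lift_fun [lin]:
  assumes "\<And>a b. clinear (\<lambda>x. F x a b)"
  shows "clinear (\<lambda>x. tensor_lift (F x) t)"
proof (rule clinearI)
  fix x y c
  have F: "F (x + y) a b = F x a b + F y a b" "F (c *\<^sub>C x) a b = c *\<^sub>C F x a b" for a b
    using clinear_add[OF assms] clinear_scale[OF assms] by blast+
  show "tensor_lift (F (x + y)) t = tensor_lift (F x) t + tensor_lift (F y) t"
    by (simp add: tensor_lift_def free_lift_def F scaleC_add_right sum.distrib)
  show "tensor_lift (F (c *\<^sub>C x)) t = c *\<^sub>C tensor_lift (F x) t"
    by (simp add: tensor_lift_def free_lift_def F complex_vector.scale_sum_right mult.commute
        complex_vector.scale_left_commute)
qed

lemma clinear_tensor_lift_arg [lin]: "cbilinear f \<Longrightarrow> clinear D \<Longrightarrow> clinear (\<lambda>x. tensor_lift f (D x))"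
  by (rule clinear_compose[OF clinear_tensor_lift])

lemma cbilinear_tensor_pure: "cbilinear (\<otimes>)"
proof (intro cbilinearI clinearI)
  fix x x' :: 'a and y y' :: 'b and c
  have rel: "r \<in> tensor_relators \<Longrightarrow> r \<in> complex_vector.span tensor_relators"
    for r :: "'a \<times> 'b \<Rightarrow>\<^sub>0 complex"
    by (rule complex_vector.span_base)
  show "x \<otimes> (y + y') = x \<otimes> y + x \<otimes> y'"
    by transfer (unfold tensor_rel_def diff_diff_eq[symmetric], rule rel,
      unfold tensor_relators_def, blast)
  show "(x + x') \<otimes> y = x \<otimes> y + x' \<otimes> y"
    by transfer (unfold tensor_rel_def diff_diff_eq[symmetric], rule rel,
      unfold tensor_relators_def, blast)
  show "x \<otimes> (c *\<^sub>C y) = c *\<^sub>C (x \<otimes> y)"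
    by transfer (unfold tensor_rel_def, rule rel, unfold tensor_relators_def, blast)
  show "(c *\<^sub>C x) \<otimes> y = c *\<^sub>C (x \<otimes> y)"
    by transfer (unfold tensor_rel_def, rule rel, unfold tensor_relators_def, blast)
qed

lemma clinear_pure_left [lin]: "clinear f \<Longrightarrow> clinear (\<lambda>x. f x \<otimes> y)"
  by (rule clinear_compose[OF cbilinearD2[OF cbilinear_tensor_pure]])

lemma clinear_pure_right [lin]: "clinear f \<Longrightarrow> clinear (\<lambda>x. y \<otimes> f x)"
  by (rule clinear_compose[OF cbilinearD1[OF cbilinear_tensor_pure]])

lemmas scale_pure =
  clinear_scale[OF cbilinearD1[OF cbilinear_tensor_pure]]
  clinear_scale[OF cbilinearD2[OF cbilinear_tensor_pure]]

lemma bilinear_lin: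
  assumes "cbilinear f"
  shows "clinear g \<Longrightarrow> clinear (\<lambda>x. f (g x) y)" "clinear h \<Longrightarrow> clinear (\<lambda>x. f z (h x))"
    "clinear (f z)"
  using clinear_compose[OF cbilinearD1[OF assms]] clinear_compose[OF cbilinearD2[OF assms]]
    cbilinearD1[OF assms] by blast+

lemma tensor_eqI:
  assumes f: "clinear f" and g: "clinear g" and pure: "\<And>a b. f (a \<otimes> b) = g (a \<otimes> b)"
  shows "f t = g t"
proof -
  obtain r where r: "t = abs_tensor r"
    by (rule that[OF Quotient3_abs_rep[OF Quotient3_tensor, symmetric]])
  have lin: "clinear (abs_tensor :: ('a \<times> 'b \<Rightarrow>\<^sub>0 complex) \<Rightarrow> 'a \<otimes> 'b)"
    by (intro clinearI) (simp_all add: plus_tensor.abs_eq scaleC_tensor.abs_eq)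
  have r': "r = (\<Sum>p\<in>Poly_Mapping.keys r. Poly_Mapping.lookup r p *\<^sub>C Poly_Mapping.single p 1)"
    (is "_ = ?s")
  proof (rule poly_mapping_eqI)
    fix p
    have "Poly_Mapping.lookup ?s p
        = (\<Sum>q\<in>Poly_Mapping.keys r. if q = p then Poly_Mapping.lookup r q else 0)"
      unfolding lookup_sum
      by (intro sum.cong)
        (simp_all add: scaleC_poly_mapping.rep_eq scaleC_complex_def lookup_single when_def)
    then show "Poly_Mapping.lookup r p = Poly_Mapping.lookup ?s p"
      by (simp add: sum.delta in_keys_iff)
  qed
  have "t = (\<Sum>p\<in>Poly_Mapping.keys r. Poly_Mapping.lookup r p *\<^sub>C (fst p \<otimes> snd p))"
    unfolding r by (subst r') (simp add: clinear_sum[OF lin] clinear_scale[OF lin] tensor_pure.abs_eq)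
  then show ?thesis
    by (simp add: clinear_sum f g clinear_scale pure)
qed

lemma tensor_lift_pure_self: "(\<ointegral>a b\<leftarrow>t. a \<otimes> b) = t"
  by (rule tensor_eqI) (simp_all add: clinear_tensor_lift cbilinear_tensor_pure clinear_ident
      tensor_lift_pure)

lemma tensor_lift_bind [pull]:
  "cbilinear f \<Longrightarrow> tensor_lift f (tensor_lift g t) = (\<ointegral>a b\<leftarrow>t. tensor_lift f (g a b))"
  by (rule clinear_tensor_lift_pull[OF clinear_tensor_lift])

lemma tensor_lift_pure_left: "tensor_lift f t \<otimes> y = (\<ointegral>a b\<leftarrow>t. f a b \<otimes> y)"
  and tensor_lift_pure_right [pull]: "y \<otimes> tensor_lift f t = (\<ointegral>a b\<leftarrow>t. y \<otimes> f a b)"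
  by (rule clinear_tensor_lift_pull, simp add: lin)+

lemma tensor_lift_scaleC [pull]: "c *\<^sub>C tensor_lift f t = (\<ointegral>a b\<leftarrow>t. c *\<^sub>C f a b)"
  and scaleC_tensor_lift: "tensor_lift g t *\<^sub>C y = (\<ointegral>a b\<leftarrow>t. g a b *\<^sub>C y)"
  and tensor_lift_mult_right [pull]: "z * tensor_lift g t = (\<ointegral>a b\<leftarrow>t. z * g a b)"
  and tensor_lift_mult_left [pull]: "tensor_lift g t * z = (\<ointegral>a b\<leftarrow>t. g a b * z)"
  by (rule clinear_tensor_lift_pull, simp add: lin)+

lemma tensor_lift_fun_pull [pull]:
  "(\<otimes>) (tensor_lift f t) = (\<lambda>y. \<ointegral>a b\<leftarrow>t. f a b \<otimes> y)"
  "(*\<^sub>C) (tensor_lift g t) = (\<lambda>y. \<ointegral>a b\<leftarrow>t. g a b *\<^sub>C y)"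
  by (simp_all add: fun_eq_iff tensor_lift_pure_left scaleC_tensor_lift)

lemma bilinear_tensor_lift:
  assumes "cbilinear p"
  shows "p (tensor_lift f t) y = (\<ointegral>a b\<leftarrow>t. p (f a b) y)"
    "p z (tensor_lift g s) = (\<ointegral>a b\<leftarrow>s. p z (g a b))"
  using clinear_tensor_lift_pull[OF cbilinearD2[OF assms]]
    clinear_tensor_lift_pull[OF cbilinearD1[OF assms]] by blast+

lemma bilinear_scale:
  assumes "cbilinear p"
  shows "p (c *\<^sub>C x) y = c *\<^sub>C p x y" "p x (c *\<^sub>C y) = c *\<^sub>C p x y"
  using clinear_scale[OF cbilinearD2[OF assms]] clinear_scale[OF cbilinearD1[OF assms]] by blast+

lemma tensor_lift_scale_inner:
  "(\<ointegral>a b\<leftarrow>t. c *\<^sub>C f a b) = c *\<^sub>C tensor_lift f t"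
  by (simp add: tensor_lift_scaleC)

lemma tensor_lift_tensor_map:
  assumes "cbilinear f" "clinear p" "clinear q"
  shows "tensor_lift f (tensor_map p q t) = (\<ointegral>a b\<leftarrow>t. f (p a) (q b))"
  unfolding tensor_map_def using assms
  by (simp add: tensor_lift_bind tensor_lift_pure)

lemma cbilinear_pure_maps: "clinear p \<Longrightarrow> clinear q \<Longrightarrow> cbilinear (\<lambda>a b. p a \<otimes> q b)"
  by (intro cbilinearI clinear_pure_left clinear_pure_right)

lemma tensor_map_pure: "clinear p \<Longrightarrow> clinear q \<Longrightarrow> tensor_map p q (a \<otimes> b) = p a \<otimes> q b"
  unfolding tensor_map_def by (simp add: tensor_lift_pure cbilinear_pure_maps)

lemma clinear_tensor_map [lin]: "clinear p \<Longrightarrow> clinear q \<Longrightarrow> clinear (tensor_map p q)"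
  unfolding tensor_map_def by (intro clinear_tensor_lift cbilinear_pure_maps)

lemma tensor_lift_tensor_map2:
  assumes "cbilinear f"
  shows "tensor_lift f (tensor_map2 p q s t) = (\<ointegral>a b\<leftarrow>s. \<ointegral>c d\<leftarrow>t. f (p a c) (q b d))"
  unfolding tensor_map2_def using assms by (simp add: tensor_lift_bind tensor_lift_pure)

text \<open>Expansion along a Hamel basis of the first factor. Only finitely many basis vectors
  occur in a representative, and their coordinate functionals recover the second components; this is
  why slices by linear functionals determine a tensor.\<close>

lemma tensor_expand:
  obtains B :: "'a::complex_vector set" and coord :: "'a \<Rightarrow> 'a \<Rightarrow> complex"
  where "finite B" "\<And>b. clinear (coord b)"
    "(t :: 'a \<otimes> 'b::complex_vector) = (\<Sum>b\<in>B. b \<otimes> (\<ointegral>a x\<leftarrow>t. coord b a *\<^sub>C x))"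
proof -
  define Z :: "'a set" where "Z = complex_vector.extend_basis {}"
  have indep: "complex_vector.independent Z" and span: "complex_vector.span Z = UNIV"
    unfolding Z_def by (simp_all add: complex_vector.independent_extend_basis
        complex_vector.span_extend_basis complex_vector.independent_empty)
  define coord where "coord b a = complex_vector.representation Z a b" for b a :: 'a
  have lin: "clinear (coord b)" for b
    by (intro clinearI) (simp_all add: coord_def complex_vector.representation_add
        complex_vector.representation_scale indep span scaleC_complex_def)
  define K where "K = Poly_Mapping.keys (rep_tensor t)"
  define B where "B = (\<Union>p\<in>K. {b. coord b (fst p) \<noteq> 0})"
  have fin: "finite B" "finite K"
    unfolding B_def coord_def K_def
    by (simp_all add: complex_vector.finite_representation)
  have exp: "fst p = (\<Sum>b\<in>B. coord b (fst p) *\<^sub>C b)" if "p \<in> K" for p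
  proof -
    have "fst p = (\<Sum>b | coord b (fst p) \<noteq> 0. coord b (fst p) *\<^sub>C b)"
      unfolding coord_def
      by (rule complex_vector.sum_nonzero_representation_eq[OF indep, symmetric]) (simp add: span)
    also have "\<dots> = (\<Sum>b\<in>B. coord b (fst p) *\<^sub>C b)"
      by (rule sum.mono_neutral_left) (use fin that in \<open>auto simp: B_def\<close>)
    finally show ?thesis .
  qed
  have "t = (\<ointegral>a x\<leftarrow>t. a \<otimes> x)" by (simp add: tensor_lift_pure_self)
  also have "\<dots> = (\<Sum>p\<in>K. Poly_Mapping.lookup (rep_tensor t) p *\<^sub>C (fst p \<otimes> snd p))"
    by (simp add: tensor_lift_def free_lift_def K_def)
  also have "\<dots> = (\<Sum>p\<in>K. \<Sum>b\<in>B. b \<otimes> (Poly_Mapping.lookup (rep_tensor t) p *\<^sub>C coord b (fst p) *\<^sub>C snd p))"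
  proof (rule sum.cong[OF refl])
    fix p assume "p \<in> K"
    have "fst p \<otimes> snd p = (\<Sum>b\<in>B. b \<otimes> (coord b (fst p) *\<^sub>C snd p))"
      by (subst exp[OF \<open>p \<in> K\<close>])
        (simp add: clinear_sum[OF cbilinearD2[OF cbilinear_tensor_pure]] scale_pure)
    then show "Poly_Mapping.lookup (rep_tensor t) p *\<^sub>C (fst p \<otimes> snd p) =
        (\<Sum>b\<in>B. b \<otimes> (Poly_Mapping.lookup (rep_tensor t) p *\<^sub>C coord b (fst p) *\<^sub>C snd p))"
      by (simp add: complex_vector.scale_sum_right scale_pure)
  qed
  also have "\<dots> = (\<Sum>b\<in>B. b \<otimes> (\<ointegral>a x\<leftarrow>t. coord b a *\<^sub>C x))"
    by (subst sum.swap) (simp only: tensor_lift_def free_lift_def K_def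
        clinear_sum[OF cbilinearD1[OF cbilinear_tensor_pure]])
  finally show ?thesis by (rule that[OF fin(1) lin])
qed

lemma tensor_separate:
  assumes "\<And>\<phi>. clinear \<phi> \<Longrightarrow> (\<ointegral>a x\<leftarrow>s. \<phi> a *\<^sub>C x) = (\<ointegral>a x\<leftarrow>t. \<phi> a *\<^sub>C x)"
  shows "s = t"
proof -
  obtain B :: "'a set" and coord where B: "finite B" "\<And>b. clinear (coord b)"
    "s - t = (\<Sum>b\<in>B. b \<otimes> (\<ointegral>a x\<leftarrow>s - t. coord b a *\<^sub>C x))"
    by (rule tensor_expand[of "s - t"]) blast
  have "(\<ointegral>a x\<leftarrow>s - t. coord b a *\<^sub>C x) = 0" for b
  proof -
    have "clinear (\<lambda>u. \<ointegral>a x\<leftarrow>u. coord b a *\<^sub>C x)"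
      by (intro lin cbilinearI B(2))
    from clinear_diff[OF this, of s t] assms[OF B(2)] show ?thesis by simp
  qed
  moreover have "b \<otimes> (0::'b) = 0" for b :: 'a
    by (rule clinear_zero[OF cbilinearD1[OF cbilinear_tensor_pure]])
  ultimately have "s - t = 0" by (subst B(3)) simp
  then show ?thesis by simp
qed

text \<open>By \<open>tensor_expand\<close>, a tensor all of whose slices lie in \<open>W\<close> is
  a sum of pure tensors with second component in \<open>W\<close>. This plays the role of regarding
  \<open>t\<close> as an element of A \<otimes> W.\<close>

lemma tensor_lift_vanish:
  assumes "cbilinear f" "\<And>\<phi>. clinear \<phi> \<Longrightarrow> (\<ointegral>a x\<leftarrow>t. \<phi> a *\<^sub>C x) \<in> W" "\<And>a x. x \<in> W \<Longrightarrow> f a x = 0"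
  shows "tensor_lift f t = 0"
proof -
  obtain B :: "'a set" and coord where B: "finite B" "\<And>b. clinear (coord b)"
    "t = (\<Sum>b\<in>B. b \<otimes> (\<ointegral>a x\<leftarrow>t. coord b a *\<^sub>C x))"
    by (rule tensor_expand[of t]) blast
  have "tensor_lift f t = (\<Sum>b\<in>B. f b (\<ointegral>a x\<leftarrow>t. coord b a *\<^sub>C x))"
    by (subst B(3)) (simp add: clinear_sum[OF clinear_tensor_lift] tensor_lift_pure assms(1))
  then show ?thesis using assms B by simp
qed

text \<open>Tensoring with the ground field turns points into tensors, to which
  \<open>tensor_separate\<close> applies.\<close>

lemma functional_separate:
  assumes "\<And>\<phi>. clinear \<phi> \<Longrightarrow> \<phi> x = (\<phi> y :: complex)"
  shows "x = y"
proof -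
  have "x \<otimes> (1::complex) = y \<otimes> 1"
    by (rule tensor_separate) (subst (1 2) tensor_lift_pure;
        auto intro!: cbilinearI lin clinear_scaleC_left simp: assms)
  moreover have "(\<ointegral>a c\<leftarrow>z \<otimes> (1::complex). c *\<^sub>C a) = z" for z :: 'a
    by (subst tensor_lift_pure) (auto intro!: cbilinearI lin simp: scaleC_one)
  ultimately show ?thesis by metis
qed

section \<open>Comodules and the operators of linear functionals\<close>

definition ctrilinear ::
    "('a::complex_vector \<Rightarrow> 'b::complex_vector \<Rightarrow> 'c::complex_vector \<Rightarrow> 'd::complex_vector) \<Rightarrow> bool"
  where "ctrilinear f \<longleftrightarrow>
    (\<forall>b c. clinear (\<lambda>a. f a b c)) \<and> (\<forall>a c. clinear (\<lambda>b. f a b c)) \<and> (\<forall>a b. clinear (\<lambda>c. f a b c))"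

lemma ctrilinearI:
  assumes "\<And>b c. clinear (\<lambda>a. f a b c)" "\<And>a c. clinear (\<lambda>b. f a b c)" "\<And>a b. clinear (\<lambda>c. f a b c)"
  shows "ctrilinear f"
  using assms by (simp add: ctrilinear_def)

definition flip :: "'a::complex_vector \<otimes> 'b::complex_vector \<Rightarrow> 'b \<otimes> 'a"
  where "flip t = (\<ointegral>a b\<leftarrow>t. b \<otimes> a)"

lemma clinear_flip: "clinear flip"
  unfolding flip_def by (intro lin cbilinearI)

lemmas flip_lin [lin] = clinear_compose[OF clinear_flip]

lemma flip_pure [simp]: "flip (a \<otimes> b) = b \<otimes> a"
  unfolding flip_def by (rule tensor_lift_pure) (intro lin cbilinearI)

lemma flip_flip [simp]: "flip (flip t) = t"
  by (rule tensor_eqI[where f = "\<lambda>t. flip (flip t)"]) (simp_all add: lin)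

lemma flip_comp_flip [simp]: "flip \<circ> (flip \<circ> d) = d"
  by (simp add: fun_eq_iff)

lemma cbilinear_swap: "cbilinear f \<Longrightarrow> cbilinear (\<lambda>x y. f y x)"
  by (simp add: cbilinear_def)

lemma tensor_lift_flip:
  assumes "cbilinear f"
  shows "tensor_lift f (flip t) = (\<ointegral>a b\<leftarrow>t. f b a)"
  by (rule tensor_eqI[where g = "tensor_lift (\<lambda>a b. f b a)"])
    (simp_all add: assms lin cbilinear_swap clinear_tensor_lift tensor_lift_pure clinear_flip)

lemma flip_tensor_map2: "flip (tensor_map2 p q s t) = tensor_map2 q p (flip s) (flip t)"
  if "cbilinear p" "cbilinear q"
proof -
  note [lin] = bilinear_lin[OF that(1)] bilinear_lin[OF that(2)]
  have "flip (tensor_map2 p q s t) = (\<ointegral>a b\<leftarrow>s. \<ointegral>c d\<leftarrow>t. q b d \<otimes> p a c)"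
    unfolding flip_def by (rule tensor_lift_tensor_map2) (intro lin cbilinearI)
  moreover have "(\<ointegral>b a\<leftarrow>flip s. \<ointegral>d c\<leftarrow>flip t. q b d \<otimes> p a c)
      = (\<ointegral>a b\<leftarrow>s. \<ointegral>d c\<leftarrow>flip t. q b d \<otimes> p a c)"
    by (rule tensor_lift_flip) (intro lin cbilinearI)
  moreover have "(\<ointegral>d c\<leftarrow>flip t. q b d \<otimes> p a c) = (\<ointegral>c d\<leftarrow>t. q b d \<otimes> p a c)" for a b
    by (rule tensor_lift_flip) (intro lin cbilinearI)
  ultimately show ?thesis by (simp add: tensor_map2_def)
qed

definition lop ::
    "('m::complex_vector \<Rightarrow> 'c::complex_vector \<otimes> 'n::complex_vector) \<Rightarrow> ('c \<Rightarrow> complex) \<Rightarrow> 'm \<Rightarrow> 'n"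
  where "lop \<delta> \<phi> m = (\<ointegral>c x\<leftarrow>\<delta> m. \<phi> c *\<^sub>C x)"

definition conv ::
    "('c::complex_vector \<Rightarrow> 'c \<otimes> 'c) \<Rightarrow> ('c \<Rightarrow> complex) \<Rightarrow> ('c \<Rightarrow> complex) \<Rightarrow> 'c \<Rightarrow> complex"
  where "conv \<Delta> \<phi> \<psi> c = (\<ointegral>x y\<leftarrow>\<Delta> c. \<phi> x * \<psi> y)"

text \<open>The coefficients stay in the tensor product of the two coalgebras instead of being
  multiplied, so that a functional on pairs, such as a cocycle, can act directly.\<close>

definition tens ::
    "('m::complex_vector \<Rightarrow> 'c::complex_vector \<otimes> 'm) \<Rightarrow> ('n::complex_vector \<Rightarrow> 'd::complex_vector \<otimes> 'n)
      \<Rightarrow> 'm \<otimes> 'n \<Rightarrow> ('c \<otimes> 'd) \<otimes> ('m \<otimes> 'n)"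
  where "tens \<delta> \<eta> t = (\<ointegral>m n\<leftarrow>t. tensor_map2 (\<otimes>) (\<otimes>) (\<delta> m) (\<eta> n))"

text \<open>No coalgebra is bundled: coassociativity and the left counit law of
  \<open>\<Delta>\<close> are the case \<open>comod \<Delta> \<epsilon> \<Delta>\<close>, and the
  right counit law is the same predicate for \<open>flip \<circ> \<Delta>\<close>.\<close>

definition comod ::
    "('c::complex_vector \<Rightarrow> 'c \<otimes> 'c) \<Rightarrow> ('c \<Rightarrow> complex) \<Rightarrow> ('m::complex_vector \<Rightarrow> 'c \<otimes> 'm) \<Rightarrow> bool"
  where "comod \<Delta> \<epsilon> \<delta> \<longleftrightarrow> clinear \<Delta> \<and> clinear \<epsilon> \<and> clinear \<delta> \<and>
    (\<forall>m. (\<ointegral>c x\<leftarrow>\<delta> m. \<ointegral>d y\<leftarrow>\<delta> x. c \<otimes> (d \<otimes> y)) = (\<ointegral>c x\<leftarrow>\<delta> m. \<ointegral>d e\<leftarrow>\<Delta> c. d \<otimes> (e \<otimes> x))) \<and>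
    (\<forall>m. lop \<delta> \<epsilon> m = m)"

definition cocommute ::
    "('m::complex_vector \<Rightarrow> 'c::complex_vector \<otimes> 'm) \<Rightarrow> ('m \<Rightarrow> 'd::complex_vector \<otimes> 'm) \<Rightarrow> bool"
  where "cocommute \<delta> \<delta>' \<longleftrightarrow>
    (\<forall>m. (\<ointegral>c x\<leftarrow>\<delta> m. \<ointegral>d y\<leftarrow>\<delta>' x. c \<otimes> (d \<otimes> y)) = (\<ointegral>d y\<leftarrow>\<delta>' m. \<ointegral>c x\<leftarrow>\<delta> y. c \<otimes> (d \<otimes> x)))"

text \<open>Right coactions are encoded as left coactions of the co-opposite coalgebra.\<close>

definition bicomod ::
    "('c::complex_vector \<Rightarrow> 'c \<otimes> 'c) \<Rightarrow> ('c \<Rightarrow> complex) \<Rightarrow> ('m::complex_vector \<Rightarrow> 'c \<otimes> 'm)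
      \<Rightarrow> ('m \<Rightarrow> 'c \<otimes> 'm) \<Rightarrow> bool"
  where "bicomod \<Delta> \<epsilon> \<delta> \<delta>' \<longleftrightarrow>
    comod \<Delta> \<epsilon> \<delta> \<and> comod (flip \<circ> \<Delta>) \<epsilon> \<delta>' \<and> clinear \<Delta> \<and> cocommute \<delta> \<delta>'"

lemma comodD:
  assumes "comod \<Delta> \<epsilon> \<delta>"
  shows "clinear \<Delta>" "clinear \<epsilon>" "clinear \<delta>" "lop \<delta> \<epsilon> m = m"
  using assms by (simp_all add: comod_def)

lemma trilinear_fold:
  assumes "ctrilinear F"
  shows "cbilinear (F a)" "cbilinear (\<lambda>a bc. tensor_lift (F a) bc)"
    "(\<ointegral>b c\<leftarrow>b \<otimes> c. F a b c) = F a b c"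
    "(\<ointegral>a bc\<leftarrow>(a \<otimes> bc). tensor_lift (F a) bc) = tensor_lift (F a) bc"
proof -
  show F: "cbilinear (F a)" for a
    using assms unfolding ctrilinear_def by (intro cbilinearI) auto
  show B: "cbilinear (\<lambda>a bc. tensor_lift (F a) bc)"
    using assms unfolding ctrilinear_def
    by (intro cbilinearI clinear_tensor_lift F clinear_tensor_lift_fun) auto
  show "(\<ointegral>b c\<leftarrow>b \<otimes> c. F a b c) = F a b c"
    by (rule tensor_lift_pure[OF F])
  show "(\<ointegral>a bc\<leftarrow>(a \<otimes> bc). tensor_lift (F a) bc) = tensor_lift (F a) bc"
    by (rule tensor_lift_pure[OF B])
qed

text \<open>The definition states coassociativity for the universal trilinear expression
  \<open>c \<otimes> (d \<otimes> y)\<close>; the linear map induced by \<open>F\<close> carries it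
  over to \<open>F\<close>.\<close>

lemma comod_coassoc:
  assumes "comod \<Delta> \<epsilon> \<delta>" "ctrilinear F"
  shows "(\<ointegral>c x\<leftarrow>\<delta> m. \<ointegral>d y\<leftarrow>\<delta> x. F c d y) = (\<ointegral>c x\<leftarrow>\<delta> m. \<ointegral>d e\<leftarrow>\<Delta> c. F d e x)"
proof -
  have "tensor_lift (\<lambda>a bc. tensor_lift (F a) bc) (\<ointegral>c x\<leftarrow>\<delta> m. \<ointegral>d y\<leftarrow>\<delta> x. c \<otimes> (d \<otimes> y))
    = tensor_lift (\<lambda>a bc. tensor_lift (F a) bc) (\<ointegral>c x\<leftarrow>\<delta> m. \<ointegral>d e\<leftarrow>\<Delta> c. d \<otimes> (e \<otimes> x))"
    using assms(1) by (simp add: comod_def)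
  then show ?thesis
    using trilinear_fold[OF assms(2)] by (simp add: tensor_lift_bind)
qed

lemma cocommute_lift:
  assumes "cocommute \<delta> \<delta>'" "ctrilinear F"
  shows "(\<ointegral>c x\<leftarrow>\<delta> m. \<ointegral>d y\<leftarrow>\<delta>' x. F c d y) = (\<ointegral>d y\<leftarrow>\<delta>' m. \<ointegral>c x\<leftarrow>\<delta> y. F c d x)"
proof -
  have "tensor_lift (\<lambda>a bc. tensor_lift (F a) bc) (\<ointegral>c x\<leftarrow>\<delta> m. \<ointegral>d y\<leftarrow>\<delta>' x. c \<otimes> (d \<otimes> y))
    = tensor_lift (\<lambda>a bc. tensor_lift (F a) bc) (\<ointegral>d y\<leftarrow>\<delta>' m. \<ointegral>c x\<leftarrow>\<delta> y. c \<otimes> (d \<otimes> x))"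
    using assms(1) by (simp add: cocommute_def)
  then show ?thesis
    using trilinear_fold[OF assms(2)] by (simp add: tensor_lift_bind)
qed

lemma clinear_lop: "clinear \<delta> \<Longrightarrow> clinear \<phi> \<Longrightarrow> clinear (lop \<delta> \<phi>)"
  unfolding lop_def by (intro lin cbilinearI)

lemma clinear_conv: "clinear \<Delta> \<Longrightarrow> clinear \<phi> \<Longrightarrow> clinear \<psi> \<Longrightarrow> clinear (conv \<Delta> \<phi> \<psi>)"
  unfolding conv_def by (intro lin cbilinearI)

lemma lop_lop_expand:
  assumes "clinear \<delta>" "clinear \<phi>"
  shows "lop \<delta> \<phi> (lop \<delta>' \<psi> m) = (\<ointegral>c x\<leftarrow>\<delta>' m. \<ointegral>d y\<leftarrow>\<delta> x. (\<psi> c * \<phi> d) *\<^sub>C y)"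
proof -
  have "lop \<delta> \<phi> (lop \<delta>' \<psi> m) = (\<ointegral>c x\<leftarrow>\<delta>' m. \<psi> c *\<^sub>C lop \<delta> \<phi> x)"
    unfolding lop_def[of \<delta>' \<psi>]
    by (simp only: clinear_tensor_lift_pull[OF clinear_lop[OF assms]]
        clinear_scale[OF clinear_lop[OF assms]])
  then show ?thesis
    unfolding lop_def by (simp add: tensor_lift_scaleC scaleC_scaleC)
qed

text \<open>A left comodule is a right module over the convolution algebra, hence the reversed order
  of the functionals.\<close>

lemma lop_lop:
  assumes "comod \<Delta> \<epsilon> \<delta>" "clinear \<phi>" "clinear \<psi>"
  shows "lop \<delta> \<phi> (lop \<delta> \<psi> m) = lop \<delta> (conv \<Delta> \<psi> \<phi>) m"
proof -
  note [lin] = clinear_compose[OF assms(2)] clinear_compose[OF assms(3)]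
  have "lop \<delta> \<phi> (lop \<delta> \<psi> m) = (\<ointegral>c x\<leftarrow>\<delta> m. \<ointegral>d y\<leftarrow>\<delta> x. (\<psi> c * \<phi> d) *\<^sub>C y)"
    by (rule lop_lop_expand[OF comodD(3)[OF assms(1)] assms(2)])
  also have "\<dots> = (\<ointegral>c x\<leftarrow>\<delta> m. \<ointegral>d e\<leftarrow>\<Delta> c. (\<psi> d * \<phi> e) *\<^sub>C x)"
    by (rule comod_coassoc[OF assms(1)]) (intro ctrilinearI lin)
  also have "\<dots> = lop \<delta> (conv \<Delta> \<psi> \<phi>) m"
    unfolding lop_def conv_def by (simp add: pull)
  finally show ?thesis .
qed

lemma cocommute_lop:
  assumes "cocommute \<delta> \<delta>'" "clinear \<delta>" "clinear \<delta>'" "clinear \<phi>" "clinear \<psi>"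
  shows "lop \<delta> \<phi> (lop \<delta>' \<psi> m) = lop \<delta>' \<psi> (lop \<delta> \<phi> m)"
proof -
  note [lin] = clinear_compose[OF assms(4)] clinear_compose[OF assms(5)]
  have "lop \<delta>' \<psi> (lop \<delta> \<phi> m) = (\<ointegral>c x\<leftarrow>\<delta> m. \<ointegral>d y\<leftarrow>\<delta>' x. (\<phi> c * \<psi> d) *\<^sub>C y)"
    by (rule lop_lop_expand) fact+
  also have "\<dots> = (\<ointegral>d y\<leftarrow>\<delta>' m. \<ointegral>c x\<leftarrow>\<delta> y. (\<phi> c * \<psi> d) *\<^sub>C x)"
    by (rule cocommute_lift[OF assms(1)]) (intro ctrilinearI lin)
  also have "\<dots> = lop \<delta> \<phi> (lop \<delta>' \<psi> m)"
    unfolding lop_lop_expand[OF assms(2,4)] by (simp add: mult.commute)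
  finally show ?thesis by simp
qed

lemma lop_flip: "clinear \<psi> \<Longrightarrow> lop (flip \<circ> \<Delta>) \<psi> c = (\<ointegral>x y\<leftarrow>\<Delta> c. \<psi> y *\<^sub>C x)"
  unfolding lop_def comp_def
  by (subst tensor_lift_flip) (auto intro!: cbilinearI lin clinear_scaleC_left)

text \<open>Convolution is composition of operators seen at one point, so its algebra laws follow
  from those of \<open>lop\<close>.\<close>

lemma conv_lop:
  assumes "clinear \<psi>"
  shows "conv \<Delta> \<phi> \<psi> c = \<psi> (lop \<Delta> \<phi> c)"
  unfolding conv_def lop_def
  by (simp only: clinear_tensor_lift_pull[OF assms] clinear_scale[OF assms] scaleC_complex_def)

lemma conv_lop':
  assumes "clinear \<phi>" "clinear \<psi>"
  shows "conv \<Delta> \<phi> \<psi> c = \<phi> (lop (flip \<circ> \<Delta>) \<psi> c)"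
  unfolding conv_def lop_flip[OF assms(2)]
  by (simp only: clinear_tensor_lift_pull[OF assms(1)] clinear_scale[OF assms(1)]
      scaleC_complex_def mult.commute)

lemma conv_flip:
  assumes "clinear \<phi>" "clinear \<psi>"
  shows "conv (flip \<circ> \<Delta>) \<phi> \<psi> = conv \<Delta> \<psi> \<phi>"
  by (simp only: fun_eq_iff conv_lop'[OF assms] conv_lop[OF assms(1)] flip_comp_flip)
     simp

lemma conv_assoc:
  assumes "comod \<Delta> \<epsilon> \<Delta>" "clinear a" "clinear b" "clinear c"
  shows "conv \<Delta> (conv \<Delta> a b) c = conv \<Delta> a (conv \<Delta> b c)"
  using assms by (simp add: fun_eq_iff conv_lop clinear_conv comodD lop_lop[symmetric])

lemma conv_counit_left:
  assumes "comod \<Delta> \<epsilon> \<Delta>" "clinear a"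
  shows "conv \<Delta> \<epsilon> a = a"
  using assms by (simp add: fun_eq_iff conv_lop comodD)

lemma conv_counit_right:
  assumes "comod (flip \<circ> \<Delta>) \<epsilon> (flip \<circ> \<Delta>)" "clinear a"
  shows "conv \<Delta> a \<epsilon> = a"
  using assms by (simp add: fun_eq_iff conv_lop' comodD)

lemma conv_inverse_unique:
  assumes "comod \<Delta> \<epsilon> \<Delta>" "comod (flip \<circ> \<Delta>) \<epsilon> (flip \<circ> \<Delta>)"
    and "clinear a" "clinear b" "clinear c" "conv \<Delta> b a = \<epsilon>" "conv \<Delta> a c = \<epsilon>"
  shows "b = c"
  by (metis assms conv_assoc conv_counit_left conv_counit_right)

section \<open>Tensor products of comodules\<close>

lemma clinear_tens:
  assumes "clinear \<delta>" "clinear \<eta>"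
  shows "clinear (tens \<delta> \<eta>)"
proof -
  note [lin] = assms[THEN clinear_compose]
  show ?thesis unfolding tens_def tensor_map2_def by (intro lin cbilinearI)
qed

lemma tens_pure:
  assumes "clinear \<delta>" "clinear \<eta>"
  shows "tens \<delta> \<eta> (m \<otimes> n) = tensor_map2 (\<otimes>) (\<otimes>) (\<delta> m) (\<eta> n)"
proof -
  note [lin] = assms[THEN clinear_compose]
  show ?thesis unfolding tens_def tensor_map2_def by (rule tensor_lift_pure) (intro lin cbilinearI)
qed

lemma tensor_lift_tens:
  assumes "cbilinear f" "clinear \<delta>" "clinear \<eta>"
  shows "tensor_lift f (tens \<delta> \<eta> (m \<otimes> n)) = (\<ointegral>c x\<leftarrow>\<delta> m. \<ointegral>d y\<leftarrow>\<eta> n. f (c \<otimes> d) (x \<otimes> y))"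
  unfolding tens_pure[OF assms(2,3)] by (rule tensor_lift_tensor_map2[OF assms(1)])

lemma flip_tens:
  assumes "clinear \<delta>" "clinear \<eta>"
  shows "flip (tens \<delta> \<eta> t) = tens (flip \<circ> \<delta>) (flip \<circ> \<eta>) t"
proof (rule tensor_eqI[where f = "\<lambda>t. flip (tens \<delta> \<eta> t)"])
  have [simp]: "clinear (flip \<circ> \<delta>)" "clinear (flip \<circ> \<eta>)"
    unfolding comp_def by (intro lin assms)+
  show "clinear (\<lambda>t. flip (tens \<delta> \<eta> t))" "clinear (tens (flip \<circ> \<delta>) (flip \<circ> \<eta>))"
    by (intro lin clinear_tens assms, simp add: clinear_tens)
  show "flip (tens \<delta> \<eta> (a \<otimes> b)) = tens (flip \<circ> \<delta>) (flip \<circ> \<eta>) (a \<otimes> b)" for a b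
    by (simp add: tens_pure assms flip_tensor_map2 cbilinear_tensor_pure)
qed

lemma flip_comp_tens:
  "clinear \<delta> \<Longrightarrow> clinear \<eta> \<Longrightarrow> flip \<circ> tens \<delta> \<eta> = tens (flip \<circ> \<delta>) (flip \<circ> \<eta>)"
  by (simp add: fun_eq_iff flip_tens)

definition func_tens ::
    "('a::complex_vector \<Rightarrow> complex) \<Rightarrow> ('b::complex_vector \<Rightarrow> complex) \<Rightarrow> 'a \<otimes> 'b \<Rightarrow> complex"
  where "func_tens \<phi> \<psi> t = (\<ointegral>a b\<leftarrow>t. \<phi> a * \<psi> b)"

lemma cbilinear_func_tens: "clinear \<phi> \<Longrightarrow> clinear \<psi> \<Longrightarrow> cbilinear (\<lambda>a b. \<phi> a * \<psi> b :: complex)"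
  by (intro cbilinearI clinear_mult_left clinear_mult_right)

lemma clinear_func_tens: "clinear \<phi> \<Longrightarrow> clinear \<psi> \<Longrightarrow> clinear (func_tens \<phi> \<psi>)"
  unfolding func_tens_def by (intro lin cbilinear_func_tens)

lemma func_tens_pure [simp]:
  "clinear \<phi> \<Longrightarrow> clinear \<psi> \<Longrightarrow> func_tens \<phi> \<psi> (a \<otimes> b) = \<phi> a * \<psi> b"
  unfolding func_tens_def by (rule tensor_lift_pure[OF cbilinear_func_tens])

lemma lop_tens_pure:
  assumes "clinear \<Phi>" "clinear \<delta>" "clinear \<eta>"
  shows "lop (tens \<delta> \<eta>) \<Phi> (m \<otimes> n) = (\<ointegral>c x\<leftarrow>\<delta> m. \<ointegral>d y\<leftarrow>\<eta> n. \<Phi> (c \<otimes> d) *\<^sub>C (x \<otimes> y))"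
proof -
  note [lin] = assms[THEN clinear_compose]
  show ?thesis
    unfolding lop_def by (rule tensor_lift_tens) (intro lin cbilinearI assms)+
qed

lemma lop_tens:
  assumes "clinear \<phi>" "clinear \<psi>" "clinear \<delta>" "clinear \<eta>"
  shows "lop (tens \<delta> \<eta>) (func_tens \<phi> \<psi>) (m \<otimes> n) = lop \<delta> \<phi> m \<otimes> lop \<eta> \<psi> n"
  by (simp add: lop_tens_pure clinear_func_tens assms)
    (simp add: lop_def pull scale_pure scaleC_scaleC mult.commute)

text \<open>On pure tensors the legs of the two factors can be separated by
  \<open>tensor_lift_swap\<close>; coassociativity is then used once in each factor.\<close>

lemma comod_tens:
  assumes "comod \<Delta> \<epsilon> \<delta>" "comod \<Delta>' \<epsilon>' \<eta>"
  shows "comod (tens \<Delta> \<Delta>') (func_tens \<epsilon> \<epsilon>') (tens \<delta> \<eta>)"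
proof -
  note D = comodD(1-3)[OF assms(1)] comodD(1-3)[OF assms(2)]
  note D' = clinear_tens[OF D(1,4)] clinear_tens[OF D(3,6)] clinear_func_tens[OF D(2,5)]
  note [lin] = D[THEN clinear_compose] D'[THEN clinear_compose]
  have "(\<ointegral>C X\<leftarrow>tens \<delta> \<eta> t. \<ointegral>D Y\<leftarrow>tens \<delta> \<eta> X. C \<otimes> (D \<otimes> Y))
      = (\<ointegral>C X\<leftarrow>tens \<delta> \<eta> t. \<ointegral>D E\<leftarrow>tens \<Delta> \<Delta>' C. D \<otimes> (E \<otimes> X))" (is "?f t = ?g t") for t
  proof (rule tensor_eqI[where f = ?f and g = ?g])
    show "clinear ?f" "clinear ?g" by (intro lin cbilinearI)+
    fix m n
    have "?f (m \<otimes> n) = (\<ointegral>c x\<leftarrow>\<delta> m. \<ointegral>d y\<leftarrow>\<eta> n. \<ointegral>D Y\<leftarrow>tens \<delta> \<eta> (x \<otimes> y). (c \<otimes> d) \<otimes> (D \<otimes> Y))"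
      by (rule tensor_lift_tens[OF _ D(3,6)]) (intro lin cbilinearI)
    also have "\<dots> = (\<ointegral>c x\<leftarrow>\<delta> m. \<ointegral>d y\<leftarrow>\<eta> n.
        \<ointegral>e u\<leftarrow>\<delta> x. \<ointegral>f v\<leftarrow>\<eta> y. (c \<otimes> d) \<otimes> ((e \<otimes> f) \<otimes> (u \<otimes> v)))"
      by (subst tensor_lift_tens[OF _ D(3,6)]) (intro lin cbilinearI, rule refl)
    also have "\<dots> = (\<ointegral>c x\<leftarrow>\<delta> m. \<ointegral>e u\<leftarrow>\<delta> x. \<ointegral>d y\<leftarrow>\<eta> n.
        \<ointegral>f v\<leftarrow>\<eta> y. (c \<otimes> d) \<otimes> ((e \<otimes> f) \<otimes> (u \<otimes> v)))"
      by (subst tensor_lift_swap) (rule refl)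
    also have "\<dots> = (\<ointegral>c x\<leftarrow>\<delta> m. \<ointegral>e u\<leftarrow>\<delta> x. \<ointegral>d y\<leftarrow>\<eta> n.
        \<ointegral>d f\<leftarrow>\<Delta>' d. (c \<otimes> d) \<otimes> ((e \<otimes> f) \<otimes> (u \<otimes> y)))"
      by (subst comod_coassoc[OF assms(2)]) (intro lin ctrilinearI, rule refl)
    also have "\<dots> = (\<ointegral>c x\<leftarrow>\<delta> m. \<ointegral>c e\<leftarrow>\<Delta> c. \<ointegral>d y\<leftarrow>\<eta> n.
        \<ointegral>d f\<leftarrow>\<Delta>' d. (c \<otimes> d) \<otimes> ((e \<otimes> f) \<otimes> (x \<otimes> y)))"
      by (rule comod_coassoc[OF assms(1)]) (intro lin ctrilinearI)
    also have "\<dots> = (\<ointegral>c x\<leftarrow>\<delta> m. \<ointegral>d y\<leftarrow>\<eta> n. \<ointegral>c e\<leftarrow>\<Delta> c.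
        \<ointegral>d f\<leftarrow>\<Delta>' d. (c \<otimes> d) \<otimes> ((e \<otimes> f) \<otimes> (x \<otimes> y)))"
      by (subst tensor_lift_swap) (rule refl)
    also have "\<dots> = (\<ointegral>c x\<leftarrow>\<delta> m. \<ointegral>d y\<leftarrow>\<eta> n.
        \<ointegral>D E\<leftarrow>tens \<Delta> \<Delta>' (c \<otimes> d). D \<otimes> (E \<otimes> (x \<otimes> y)))"
      by (subst tensor_lift_tens[OF _ D(1,4)]) (intro lin cbilinearI, rule refl)
    also have "\<dots> = ?g (m \<otimes> n)"
      by (rule tensor_lift_tens[OF _ D(3,6), symmetric]) (intro lin cbilinearI)
    finally show "?f (m \<otimes> n) = ?g (m \<otimes> n)" .
  qed
  moreover have "lop (tens \<delta> \<eta>) (func_tens \<epsilon> \<epsilon>') t = t" for t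
    by (rule tensor_eqI[where g = "\<lambda>t. t"])
      (simp_all add: lop_tens D assms[THEN comodD(4)] clinear_lop D' lin)
  ultimately show ?thesis
    using D' by (simp add: comod_def)
qed

lemma cocommute_tens:
  assumes "cocommute \<delta> \<delta>'" "cocommute \<eta> \<eta>'"
    and D: "clinear \<delta>" "clinear \<delta>'" "clinear \<eta>" "clinear \<eta>'"
  shows "cocommute (tens \<delta> \<eta>) (tens \<delta>' \<eta>')"
proof -
  note D' = clinear_tens[OF D(1,3)] clinear_tens[OF D(2,4)]
  note [lin] = D[THEN clinear_compose] D'[THEN clinear_compose]
  have "(\<ointegral>C X\<leftarrow>tens \<delta> \<eta> t. \<ointegral>D Y\<leftarrow>tens \<delta>' \<eta>' X. C \<otimes> (D \<otimes> Y))
      = (\<ointegral>D Y\<leftarrow>tens \<delta>' \<eta>' t. \<ointegral>C X\<leftarrow>tens \<delta> \<eta> Y. C \<otimes> (D \<otimes> X))" (is "?f t = ?g t") for t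
  proof (rule tensor_eqI[where f = ?f and g = ?g])
    show "clinear ?f" "clinear ?g" by (intro lin cbilinearI)+
    fix m n
    have "?f (m \<otimes> n) = (\<ointegral>c x\<leftarrow>\<delta> m. \<ointegral>d y\<leftarrow>\<eta> n. \<ointegral>D Y\<leftarrow>tens \<delta>' \<eta>' (x \<otimes> y). (c \<otimes> d) \<otimes> (D \<otimes> Y))"
      by (rule tensor_lift_tens[OF _ D(1,3)]) (intro lin cbilinearI)
    also have "\<dots> = (\<ointegral>c x\<leftarrow>\<delta> m. \<ointegral>d y\<leftarrow>\<eta> n.
        \<ointegral>e u\<leftarrow>\<delta>' x. \<ointegral>f v\<leftarrow>\<eta>' y. (c \<otimes> d) \<otimes> ((e \<otimes> f) \<otimes> (u \<otimes> v)))"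
      by (subst tensor_lift_tens[OF _ D(2,4)]) (intro lin cbilinearI, rule refl)
    also have "\<dots> = (\<ointegral>c x\<leftarrow>\<delta> m. \<ointegral>e u\<leftarrow>\<delta>' x. \<ointegral>d y\<leftarrow>\<eta> n.
        \<ointegral>f v\<leftarrow>\<eta>' y. (c \<otimes> d) \<otimes> ((e \<otimes> f) \<otimes> (u \<otimes> v)))"
      by (subst tensor_lift_swap) (rule refl)
    also have "\<dots> = (\<ointegral>c x\<leftarrow>\<delta> m. \<ointegral>e u\<leftarrow>\<delta>' x. \<ointegral>f v\<leftarrow>\<eta>' n.
        \<ointegral>d y\<leftarrow>\<eta> v. (c \<otimes> d) \<otimes> ((e \<otimes> f) \<otimes> (u \<otimes> y)))"
      by (subst cocommute_lift[OF assms(2)]) (intro lin ctrilinearI, rule refl)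
    also have "\<dots> = (\<ointegral>e u\<leftarrow>\<delta>' m. \<ointegral>c x\<leftarrow>\<delta> u. \<ointegral>f v\<leftarrow>\<eta>' n.
        \<ointegral>d y\<leftarrow>\<eta> v. (c \<otimes> d) \<otimes> ((e \<otimes> f) \<otimes> (x \<otimes> y)))"
      by (rule cocommute_lift[OF assms(1)]) (intro lin ctrilinearI)
    also have "\<dots> = (\<ointegral>e u\<leftarrow>\<delta>' m. \<ointegral>f v\<leftarrow>\<eta>' n. \<ointegral>c x\<leftarrow>\<delta> u.
        \<ointegral>d y\<leftarrow>\<eta> v. (c \<otimes> d) \<otimes> ((e \<otimes> f) \<otimes> (x \<otimes> y)))"
      by (subst tensor_lift_swap) (rule refl)
    also have "\<dots> = (\<ointegral>e u\<leftarrow>\<delta>' m. \<ointegral>f v\<leftarrow>\<eta>' n.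
        \<ointegral>C X\<leftarrow>tens \<delta> \<eta> (u \<otimes> v). C \<otimes> ((e \<otimes> f) \<otimes> X))"
      by (subst tensor_lift_tens[OF _ D(1,3)]) (intro lin cbilinearI, rule refl)
    also have "\<dots> = ?g (m \<otimes> n)"
      by (rule tensor_lift_tens[OF _ D(2,4), symmetric]) (intro lin cbilinearI)
    finally show "?f (m \<otimes> n) = ?g (m \<otimes> n)" .
  qed
  then show ?thesis by (simp add: cocommute_def)
qed

lemma bicomodD:
  assumes "bicomod \<Delta> \<epsilon> \<delta> \<delta>'"
  shows "comod \<Delta> \<epsilon> \<delta>" "comod (flip \<circ> \<Delta>) \<epsilon> \<delta>'" "cocommute \<delta> \<delta>'"
    "clinear \<Delta>" "clinear \<epsilon>" "clinear \<delta>" "clinear \<delta>'"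
  using assms comodD by (auto simp: bicomod_def)

lemma cocommute_sym:
  assumes "cocommute \<delta> \<delta>'"
  shows "cocommute \<delta>' \<delta>"
proof -
  have "ctrilinear (\<lambda>a b c. b \<otimes> (a \<otimes> c))" by (intro ctrilinearI lin)
  from cocommute_lift[OF assms this] show ?thesis by (simp add: cocommute_def)
qed

lemma bicomod_sym: "bicomod \<Delta> \<epsilon> \<delta> \<delta>' \<Longrightarrow> bicomod (flip \<circ> \<Delta>) \<epsilon> \<delta>' \<delta>"
  by (auto simp: bicomod_def cocommute_sym dest: comodD)

lemma bicomod_tens:
  assumes "bicomod \<Delta> \<epsilon> \<delta> \<delta>'" "bicomod \<Delta>' \<epsilon>' \<eta> \<eta>'"
  shows "bicomod (tens \<Delta> \<Delta>') (func_tens \<epsilon> \<epsilon>') (tens \<delta> \<eta>) (tens \<delta>' \<eta>')"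
  using assms[THEN bicomodD(1)] assms[THEN bicomodD(2)] assms[THEN bicomodD(3)]
    assms[THEN bicomodD(4)] assms[THEN bicomodD(6)] assms[THEN bicomodD(7)]
  unfolding bicomod_def
  by (auto simp: flip_comp_tens clinear_tens intro!: comod_tens cocommute_tens)

text \<open>This is coassociativity, read as the commuting of the left and right regular
  coactions.\<close>

lemma cocommute_self:
  assumes "comod \<Delta> \<epsilon> \<Delta>"
  shows "cocommute \<Delta> (flip \<circ> \<Delta>)"
proof -
  have [lin]: "\<And>f. clinear f \<Longrightarrow> clinear (\<lambda>x. \<Delta> (f x))"
    by (rule clinear_compose[OF comodD(1)[OF assms]])
  have "(\<ointegral>c x\<leftarrow>\<Delta> m. \<ointegral>d y\<leftarrow>flip (\<Delta> x). c \<otimes> (d \<otimes> y)) = (\<ointegral>d y\<leftarrow>flip (\<Delta> m). \<ointegral>c x\<leftarrow>\<Delta> y. c \<otimes> (d \<otimes> x))"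
    for m
  proof -
    have "(\<ointegral>c x\<leftarrow>\<Delta> m. \<ointegral>d y\<leftarrow>flip (\<Delta> x). c \<otimes> (d \<otimes> y)) = (\<ointegral>c x\<leftarrow>\<Delta> m. \<ointegral>y d\<leftarrow>\<Delta> x. c \<otimes> (d \<otimes> y))"
      by (subst tensor_lift_flip) (intro lin cbilinearI, rule refl)
    also have "\<dots> = (\<ointegral>c d\<leftarrow>\<Delta> m. \<ointegral>c y\<leftarrow>\<Delta> c. c \<otimes> (d \<otimes> y))"
      by (rule comod_coassoc[OF assms]) (intro lin ctrilinearI)
    also have "\<dots> = (\<ointegral>d y\<leftarrow>flip (\<Delta> m). \<ointegral>c x\<leftarrow>\<Delta> y. c \<otimes> (d \<otimes> x))"
      by (rule tensor_lift_flip[symmetric]) (intro lin cbilinearI)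
    finally show ?thesis .
  qed
  then show ?thesis by (simp add: cocommute_def)
qed

lemma comod_flip_self:
  assumes "comod \<Delta> \<epsilon> \<Delta>" and counit: "\<And>c. (\<ointegral>x y\<leftarrow>\<Delta> c. \<epsilon> y *\<^sub>C x) = c"
  shows "comod (flip \<circ> \<Delta>) \<epsilon> (flip \<circ> \<Delta>)"
proof -
  note D = comodD(1,2)[OF assms(1)]
  note [lin] = D[THEN clinear_compose]
  have "(\<ointegral>c x\<leftarrow>flip (\<Delta> m). \<ointegral>d y\<leftarrow>flip (\<Delta> x). c \<otimes> (d \<otimes> y))
      = (\<ointegral>c x\<leftarrow>flip (\<Delta> m). \<ointegral>d e\<leftarrow>flip (\<Delta> c). d \<otimes> (e \<otimes> x))" for m
  proof -
    have "(\<ointegral>c x\<leftarrow>flip (\<Delta> m). \<ointegral>d y\<leftarrow>flip (\<Delta> x). c \<otimes> (d \<otimes> y))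
        = (\<ointegral>x c\<leftarrow>\<Delta> m. \<ointegral>d y\<leftarrow>flip (\<Delta> x). c \<otimes> (d \<otimes> y))"
      by (rule tensor_lift_flip) (intro lin cbilinearI)
    also have "\<dots> = (\<ointegral>x c\<leftarrow>\<Delta> m. \<ointegral>y d\<leftarrow>\<Delta> x. c \<otimes> (d \<otimes> y))"
      by (subst tensor_lift_flip) (intro lin cbilinearI, rule refl)
    also have "\<dots> = (\<ointegral>y x\<leftarrow>\<Delta> m. \<ointegral>d c\<leftarrow>\<Delta> x. c \<otimes> (d \<otimes> y))"
      by (rule comod_coassoc[OF assms(1), symmetric]) (intro lin ctrilinearI)
    also have "\<dots> = (\<ointegral>x c\<leftarrow>\<Delta> m. \<ointegral>d e\<leftarrow>flip (\<Delta> c). d \<otimes> (e \<otimes> x))"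
      by (subst tensor_lift_flip) (intro lin cbilinearI, rule refl)
    also have "\<dots> = (\<ointegral>c x\<leftarrow>flip (\<Delta> m). \<ointegral>d e\<leftarrow>flip (\<Delta> c). d \<otimes> (e \<otimes> x))"
      by (rule tensor_lift_flip[symmetric]) (intro lin cbilinearI)
    finally show ?thesis .
  qed
  moreover have "clinear (flip \<circ> \<Delta>)" unfolding comp_def by (intro lin)
  ultimately show ?thesis
    using D counit by (simp add: comod_def lop_flip)
qed

lemma bicomod_self:
  assumes "comod \<Delta> \<epsilon> \<Delta>" "\<And>c. (\<ointegral>x y\<leftarrow>\<Delta> c. \<epsilon> y *\<^sub>C x) = c"
  shows "bicomod \<Delta> \<epsilon> \<Delta> (flip \<circ> \<Delta>)"
  using cocommute_self[OF assms(1)] comod_flip_self[OF assms] assms(1) comodD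
  by (auto simp: bicomod_def)

section \<open>Maps of comodules\<close>

text \<open>The coefficients may change along \<open>p\<close>. This covers multiplication,
  reassociation and the antipode, none of which leaves the coefficients fixed.\<close>

definition comod_map ::
    "('m::complex_vector \<Rightarrow> 'c::complex_vector \<otimes> 'm) \<Rightarrow> ('n::complex_vector \<Rightarrow> 'd::complex_vector \<otimes> 'n)
      \<Rightarrow> ('c \<Rightarrow> 'd) \<Rightarrow> ('m \<Rightarrow> 'n) \<Rightarrow> bool"
  where "comod_map \<delta> \<eta> p h \<longleftrightarrow> clinear p \<and> clinear h \<and> (\<forall>m. \<eta> (h m) = tensor_map p h (\<delta> m))"

lemma comod_mapD:
  assumes "comod_map \<delta> \<eta> p h"
  shows "clinear p" "clinear h" "\<eta> (h m) = tensor_map p h (\<delta> m)"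
  using assms by (simp_all add: comod_map_def)

lemma lop_comod_map:
  assumes "comod_map \<delta> \<eta> p h" "clinear \<phi>"
  shows "lop \<eta> \<phi> (h m) = h (lop \<delta> (\<lambda>c. \<phi> (p c)) m)"
proof -
  note h = comod_mapD[OF assms(1)]
  have "lop \<eta> \<phi> (h m) = (\<ointegral>a b\<leftarrow>\<delta> m. \<phi> (p a) *\<^sub>C h b)"
    unfolding lop_def h(3)
    by (rule tensor_lift_tensor_map[OF _ h(1,2)])
      (intro cbilinearI lin clinear_scaleC_left assms)
  then show ?thesis
    unfolding lop_def by (simp only: clinear_tensor_lift_pull[OF h(2)] clinear_scale[OF h(2)])
qed

text \<open>By \<open>tensor_separate\<close> the operators determine the coaction, so it suffices
  to intertwine all of them.\<close>

lemma comod_mapI: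
  assumes "clinear p" "clinear h" "\<And>\<phi> m. clinear \<phi> \<Longrightarrow> lop \<eta> \<phi> (h m) = h (lop \<delta> (\<lambda>c. \<phi> (p c)) m)"
  shows "comod_map \<delta> \<eta> p h"
proof -
  have "\<eta> (h m) = tensor_map p h (\<delta> m)" for m
  proof (rule tensor_separate)
    fix \<phi> :: "'b \<Rightarrow> complex" assume "clinear \<phi>"
    have "(\<ointegral>a x\<leftarrow>tensor_map p h (\<delta> m). \<phi> a *\<^sub>C x) = (\<ointegral>a b\<leftarrow>\<delta> m. \<phi> (p a) *\<^sub>C h b)"
      by (rule tensor_lift_tensor_map[OF _ assms(1,2)])
        (intro cbilinearI lin clinear_scaleC_left \<open>clinear \<phi>\<close>)
    also have "\<dots> = h (lop \<delta> (\<lambda>c. \<phi> (p c)) m)"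
      unfolding lop_def by (simp only: clinear_tensor_lift_pull[OF assms(2)] clinear_scale[OF assms(2)])
    finally show "(\<ointegral>a x\<leftarrow>\<eta> (h m). \<phi> a *\<^sub>C x) = (\<ointegral>a x\<leftarrow>tensor_map p h (\<delta> m). \<phi> a *\<^sub>C x)"
      using assms(3)[OF \<open>clinear \<phi>\<close>] by (simp add: lop_def)
  qed
  then show ?thesis using assms by (simp add: comod_map_def)
qed

text \<open>Used to see that the pullbacks of mutually inverse functionals along a coalgebra map
  stay mutually inverse.\<close>

lemma conv_comod_map:
  assumes "comod_map \<Delta> \<Delta>' p p" "clinear \<phi>" "clinear \<psi>"
  shows "conv \<Delta> (\<lambda>c. \<phi> (p c)) (\<lambda>c. \<psi> (p c)) = (\<lambda>c. conv \<Delta>' \<phi> \<psi> (p c))"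
  using assms clinear_compose[OF assms(3) comod_mapD(1)[OF assms(1)]]
  by (simp add: fun_eq_iff conv_lop lop_comod_map)

lemma comod_map_id: "clinear \<delta> \<Longrightarrow> comod_map \<delta> \<delta> id id"
  by (simp add: comod_map_def lin tensor_map_def tensor_lift_pure_self)

lemma comod_map_tens:
  assumes "comod_map \<delta> \<delta>' p h" "comod_map \<eta> \<eta>' q k"
    and "clinear \<delta>" "clinear \<delta>'" "clinear \<eta>" "clinear \<eta>'"
  shows "comod_map (tens \<delta> \<eta>) (tens \<delta>' \<eta>') (tensor_map p q) (tensor_map h k)"
proof -
  note h = comod_mapD[OF assms(1)] and k = comod_mapD[OF assms(2)]
  note [lin] = clinear_compose[OF h(1)] clinear_compose[OF h(2)]
    clinear_compose[OF k(1)] clinear_compose[OF k(2)]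
  have lin1: "clinear (tensor_map p q)" "clinear (tensor_map h k)"
    by (intro lin h k)+
  have "tens \<delta>' \<eta>' (tensor_map h k t) = tensor_map (tensor_map p q) (tensor_map h k) (tens \<delta> \<eta> t)" for t
  proof (rule tensor_eqI[where g = "\<lambda>t. tensor_map (tensor_map p q) (tensor_map h k) (tens \<delta> \<eta> t)"])
    show "clinear (\<lambda>t. tens \<delta>' \<eta>' (tensor_map h k t))"
      by (rule clinear_compose[OF clinear_tens[OF assms(4,6)] lin1(2)])
    show "clinear (\<lambda>t. tensor_map (tensor_map p q) (tensor_map h k) (tens \<delta> \<eta> t))"
      by (intro clinear_compose[OF clinear_tensor_map[OF lin1] clinear_tens[OF assms(3,5)]])
    fix m n
    have "tens \<delta>' \<eta>' (tensor_map h k (m \<otimes> n)) = tensor_map2 (\<otimes>) (\<otimes>) (tensor_map p h (\<delta> m)) (tensor_map q k (\<eta> n))"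
      by (simp add: tensor_map_pure h k tens_pure assms)
    also have "\<dots> = (\<ointegral>a b\<leftarrow>\<delta> m. \<ointegral>c d\<leftarrow>\<eta> n. (p a \<otimes> q c) \<otimes> (h b \<otimes> k d))"
      unfolding tensor_map2_def
      by (subst tensor_lift_tensor_map, intro cbilinearI lin, rule h, rule h,
          subst tensor_lift_tensor_map, intro cbilinearI lin, rule k, rule k, rule refl)
    also have "\<dots> = tensor_map (tensor_map p q) (tensor_map h k) (tens \<delta> \<eta> (m \<otimes> n))"
      unfolding tensor_map_def[of "tensor_map p q"]
      by (subst tensor_lift_tens) (simp_all add: cbilinear_pure_maps lin1 tensor_map_pure h k assms)
    finally show "tens \<delta>' \<eta>' (tensor_map h k (m \<otimes> n)) = tensor_map (tensor_map p q) (tensor_map h k) (tens \<delta> \<eta> (m \<otimes> n))" .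
  qed
  then show ?thesis using lin1 by (simp add: comod_map_def)
qed

lemma tensor_assoc_pure [simp]: "tensor_assoc ((a \<otimes> b) \<otimes> c) = a \<otimes> (b \<otimes> c)"
  unfolding tensor_assoc_def
  by (subst tensor_lift_pure, intro cbilinearI lin, rule tensor_lift_pure, intro cbilinearI lin)

lemma clinear_tensor_assoc: "clinear tensor_assoc"
  unfolding tensor_assoc_def by (intro cbilinearI lin)

lemma tensor3_eqI:
  assumes "clinear f" "clinear g" "\<And>a b c. f ((a \<otimes> b) \<otimes> c) = g ((a \<otimes> b) \<otimes> c)"
  shows "f t = g t"
proof (rule tensor_eqI[OF assms(1,2)])
  fix u c
  show "f (u \<otimes> c) = g (u \<otimes> c)"
    by (rule tensor_eqI[where f = "\<lambda>u. f (u \<otimes> c)"])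
      (intro clinear_compose[OF assms(1)] clinear_compose[OF assms(2)] lin assms(3))+
qed

lemma comod_map_assoc:
  assumes "clinear \<delta>" "clinear \<eta>" "clinear \<theta>"
  shows "comod_map (tens (tens \<delta> \<eta>) \<theta>) (tens \<delta> (tens \<eta> \<theta>)) tensor_assoc tensor_assoc"
proof -
  note [lin] = clinear_compose[OF clinear_tensor_assoc]
  note D = clinear_tens[OF assms(1,2)] clinear_tens[OF assms(2,3)]
  have "tens \<delta> (tens \<eta> \<theta>) (tensor_assoc t) = tensor_map tensor_assoc tensor_assoc (tens (tens \<delta> \<eta>) \<theta> t)" for t
  proof (rule tensor3_eqI[where f = "\<lambda>t. tens \<delta> (tens \<eta> \<theta>) (tensor_assoc t)"])
    show "clinear (\<lambda>t. tens \<delta> (tens \<eta> \<theta>) (tensor_assoc t))"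
      by (rule clinear_compose[OF clinear_tens[OF assms(1) D(2)] clinear_tensor_assoc])
    show "clinear (\<lambda>t. tensor_map tensor_assoc tensor_assoc (tens (tens \<delta> \<eta>) \<theta> t))"
      by (rule clinear_compose[OF clinear_tensor_map clinear_tens[OF D(1) assms(3)]])
        (rule clinear_tensor_assoc)+
    fix a b c
    have "tens \<delta> (tens \<eta> \<theta>) (tensor_assoc ((a \<otimes> b) \<otimes> c))
        = (\<ointegral>x u\<leftarrow>\<delta> a. \<ointegral>y v\<leftarrow>\<eta> b. \<ointegral>z w\<leftarrow>\<theta> c. (x \<otimes> (y \<otimes> z)) \<otimes> (u \<otimes> (v \<otimes> w)))"
      unfolding tensor_assoc_pure tens_pure[OF assms(1) D(2)] unfolding tensor_map2_def
      by (subst tensor_lift_tens[OF _ assms(2,3)]) (intro cbilinearI lin, rule refl)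
    also have "\<dots> = tensor_map tensor_assoc tensor_assoc (tens (tens \<delta> \<eta>) \<theta> ((a \<otimes> b) \<otimes> c))"
      unfolding tensor_map_def
      by (subst tensor_lift_tens[OF _ D(1) assms(3)], intro cbilinearI lin,
          subst tensor_lift_tens[OF _ assms(1,2)], intro cbilinearI lin, simp)
    finally show "tens \<delta> (tens \<eta> \<theta>) (tensor_assoc ((a \<otimes> b) \<otimes> c))
        = tensor_map tensor_assoc tensor_assoc (tens (tens \<delta> \<eta>) \<theta> ((a \<otimes> b) \<otimes> c))" .
  qed
  then show ?thesis by (simp add: comod_map_def clinear_tensor_assoc)
qed

section \<open>Twisting by a cocycle\<close>

lemma conv_func_tens:
  assumes "clinear \<Delta>" "clinear \<Delta>'" "clinear a" "clinear b" "clinear c" "clinear d"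
  shows "conv (tens \<Delta> \<Delta>') (func_tens a b) (func_tens c d) = func_tens (conv \<Delta> a c) (conv \<Delta>' b d)"
proof (rule ext, rule tensor_eqI)
  show "clinear (conv (tens \<Delta> \<Delta>') (func_tens a b) (func_tens c d))"
    "clinear (func_tens (conv \<Delta> a c) (conv \<Delta>' b d))"
    by (intro clinear_conv clinear_tens clinear_func_tens assms)+
  show "conv (tens \<Delta> \<Delta>') (func_tens a b) (func_tens c d) (x \<otimes> y)
      = func_tens (conv \<Delta> a c) (conv \<Delta>' b d) (x \<otimes> y)" for x y
    by (simp add: conv_lop clinear_func_tens assms lop_tens clinear_conv)
qed

text \<open>The product telescopes from the inside: \<open>b\<close> meets \<open>c\<close> first,
  then \<open>a\<close> meets \<open>d\<close>.\<close>

lemma conv_inverse_mult: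
  assumes "comod \<Delta> \<epsilon> \<Delta>"
    and "clinear a" "clinear b" "clinear c" "clinear d" "conv \<Delta> b c = \<epsilon>" "conv \<Delta> a d = \<epsilon>"
  shows "conv \<Delta> (conv \<Delta> a b) (conv \<Delta> c d) = \<epsilon>"
proof -
  note D = comodD(1,2)[OF assms(1)]
  have "conv \<Delta> (conv \<Delta> a b) (conv \<Delta> c d) = conv \<Delta> a (conv \<Delta> (conv \<Delta> b c) d)"
    by (simp add: conv_assoc[OF assms(1)] clinear_conv D assms(2-5))
  then show ?thesis
    by (simp add: assms conv_counit_left[OF assms(1)])
qed

text \<open>The common form of multiplicativity of the coproduct, of the covariance axioms for both
  actions and, with target \<open>\<Delta>\<close>, of the invariance of a metric. The right-handed
  versions use flipped coactions.\<close>

definition colin ::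
    "('a::complex_vector \<Rightarrow> 'b::complex_vector \<Rightarrow> 'c::complex_vector) \<Rightarrow> ('m::complex_vector \<Rightarrow> 'a \<otimes> 'm)
      \<Rightarrow> ('n::complex_vector \<Rightarrow> 'b \<otimes> 'n) \<Rightarrow> ('p::complex_vector \<Rightarrow> 'c \<otimes> 'p) \<Rightarrow> ('m \<Rightarrow> 'n \<Rightarrow> 'p) \<Rightarrow> bool"
  where "colin \<kappa> \<delta> \<eta> \<theta> \<mu> \<longleftrightarrow> (\<forall>m n. \<theta> (\<mu> m n) = tensor_map2 \<kappa> \<mu> (\<delta> m) (\<eta> n))"

lemma tensor_map_tens:
  assumes "cbilinear \<kappa>" "cbilinear \<mu>" "clinear \<delta>" "clinear \<eta>"
  shows "tensor_map (tensor_lift \<kappa>) (tensor_lift \<mu>) (tens \<delta> \<eta> (m \<otimes> n)) = tensor_map2 \<kappa> \<mu> (\<delta> m) (\<eta> n)"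
  unfolding tensor_map_def tensor_map2_def
  by (subst tensor_lift_tens[OF _ assms(3,4)])
    (simp_all add: cbilinear_pure_maps clinear_tensor_lift assms tensor_lift_pure)

lemma colin_iff:
  assumes "cbilinear \<kappa>" "cbilinear \<mu>" "clinear \<delta>" "clinear \<eta>" "clinear \<theta>"
  shows "colin \<kappa> \<delta> \<eta> \<theta> \<mu> \<longleftrightarrow> comod_map (tens \<delta> \<eta>) \<theta> (tensor_lift \<kappa>) (tensor_lift \<mu>)"
proof
  assume colin: "colin \<kappa> \<delta> \<eta> \<theta> \<mu>"
  have "\<theta> (tensor_lift \<mu> t) = tensor_map (tensor_lift \<kappa>) (tensor_lift \<mu>) (tens \<delta> \<eta> t)" for t
  proof (rule tensor_eqI[where f = "\<lambda>t. \<theta> (tensor_lift \<mu> t)"])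
    show "clinear (\<lambda>t. \<theta> (tensor_lift \<mu> t))"
      "clinear (\<lambda>t. tensor_map (tensor_lift \<kappa>) (tensor_lift \<mu>) (tens \<delta> \<eta> t))"
      by (intro clinear_compose[OF assms(5)] clinear_tensor_lift assms
          clinear_compose[OF clinear_tensor_map] clinear_tens)+
    show "\<theta> (tensor_lift \<mu> (m \<otimes> n))
        = tensor_map (tensor_lift \<kappa>) (tensor_lift \<mu>) (tens \<delta> \<eta> (m \<otimes> n))" for m n
      using colin by (simp add: tensor_map_tens assms tensor_lift_pure colin_def)
  qed
  then show "comod_map (tens \<delta> \<eta>) \<theta> (tensor_lift \<kappa>) (tensor_lift \<mu>)"
    by (simp add: comod_map_def clinear_tensor_lift assms)
next
  assume *: "comod_map (tens \<delta> \<eta>) \<theta> (tensor_lift \<kappa>) (tensor_lift \<mu>)"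
  show "colin \<kappa> \<delta> \<eta> \<theta> \<mu>"
    unfolding colin_def
    using comod_mapD(3)[OF *, of "_ \<otimes> _"]
    by (simp add: tensor_map_tens assms tensor_lift_pure)
qed

text \<open>\<open>dpair \<gamma> \<gamma>b\<close> sends \<open>\<mu>\<close> to \<open>\<gamma>(m\<^sub>(\<^sub>-\<^sub>1\<^sub>) \<otimes> n\<^sub>(\<^sub>-\<^sub>1\<^sub>)) \<mu> m\<^sub>(\<^sub>0\<^sub>) n\<^sub>(\<^sub>0\<^sub>) \<gamma>b(m\<^sub>(\<^sub>1\<^sub>) \<otimes> n\<^sub>(\<^sub>1\<^sub>))\<close>. The deformed
  product and actions and the deformed metric are all of this form.\<close>

definition twist ::
    "('c::complex_vector \<Rightarrow> complex) \<Rightarrow> ('c \<Rightarrow> complex) \<Rightarrow> ('m::complex_vector \<Rightarrow> 'c \<otimes> 'm)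
      \<Rightarrow> ('m \<Rightarrow> 'c \<otimes> 'm) \<Rightarrow> 'm \<Rightarrow> 'm"
  where "twist \<gamma> \<gamma>b \<delta> \<delta>' m = lop \<delta>' \<gamma>b (lop \<delta> \<gamma> m)"

definition dpair ::
    "('a::complex_vector \<otimes> 'a \<Rightarrow> complex) \<Rightarrow> ('a \<otimes> 'a \<Rightarrow> complex)
      \<Rightarrow> ('m::complex_vector \<Rightarrow> 'a \<otimes> 'm) \<Rightarrow> ('m \<Rightarrow> 'a \<otimes> 'm)
      \<Rightarrow> ('n::complex_vector \<Rightarrow> 'a \<otimes> 'n) \<Rightarrow> ('n \<Rightarrow> 'a \<otimes> 'n)
      \<Rightarrow> ('m \<Rightarrow> 'n \<Rightarrow> 'p::complex_vector) \<Rightarrow> 'm \<Rightarrow> 'n \<Rightarrow> 'p"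
  where "dpair \<gamma> \<gamma>b \<delta> \<delta>' \<eta> \<eta>' \<mu> m n = tensor_lift \<mu> (twist \<gamma> \<gamma>b (tens \<delta> \<eta>) (tens \<delta>' \<eta>') (m \<otimes> n))"

lemma clinear_twist:
  assumes "clinear \<gamma>" "clinear \<gamma>b" "clinear \<delta>" "clinear \<delta>'"
  shows "clinear (twist \<gamma> \<gamma>b \<delta> \<delta>')"
  unfolding twist_def[abs_def]
  by (rule clinear_compose[OF clinear_lop[OF assms(4,2)] clinear_lop[OF assms(3,1)]])

lemma cbilinear_compose: "clinear h \<Longrightarrow> cbilinear p \<Longrightarrow> cbilinear (\<lambda>x y. h (p x y))"
  by (rule cbilinearI) (erule clinear_compose, erule cbilinearD1 cbilinearD2)+

lemma cbilinear_dpair: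
  assumes "cbilinear \<mu>" "clinear \<gamma>" "clinear \<gamma>b" "clinear \<delta>" "clinear \<delta>'" "clinear \<eta>" "clinear \<eta>'"
  shows "cbilinear (dpair \<gamma> \<gamma>b \<delta> \<delta>' \<eta> \<eta>' \<mu>)"
proof -
  have "clinear (\<lambda>t. tensor_lift \<mu> (twist \<gamma> \<gamma>b (tens \<delta> \<eta>) (tens \<delta>' \<eta>') t))"
    by (rule clinear_compose[OF clinear_tensor_lift[OF assms(1)]])
      (intro clinear_twist clinear_tens assms)
  from cbilinear_compose[OF this cbilinear_tensor_pure] show ?thesis
    by (simp add: dpair_def[abs_def])
qed

lemma tensor_lift_dpair:
  assumes "cbilinear \<mu>" "clinear \<gamma>" "clinear \<gamma>b" "clinear \<delta>" "clinear \<delta>'" "clinear \<eta>" "clinear \<eta>'"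
  shows "tensor_lift (dpair \<gamma> \<gamma>b \<delta> \<delta>' \<eta> \<eta>' \<mu>) t
    = tensor_lift \<mu> (twist \<gamma> \<gamma>b (tens \<delta> \<eta>) (tens \<delta>' \<eta>') t)"
proof (rule tensor_eqI[where f = "tensor_lift (dpair \<gamma> \<gamma>b \<delta> \<delta>' \<eta> \<eta>' \<mu>)"
      and g = "\<lambda>t. tensor_lift \<mu> (twist \<gamma> \<gamma>b (tens \<delta> \<eta>) (tens \<delta>' \<eta>') t)"])
  show "clinear (tensor_lift (dpair \<gamma> \<gamma>b \<delta> \<delta>' \<eta> \<eta>' \<mu>))"
    by (intro clinear_tensor_lift cbilinear_dpair assms)
  show "clinear (\<lambda>t. tensor_lift \<mu> (twist \<gamma> \<gamma>b (tens \<delta> \<eta>) (tens \<delta>' \<eta>') t))"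
    by (rule clinear_compose[OF clinear_tensor_lift[OF assms(1)]])
      (intro clinear_twist clinear_tens assms)
  show "tensor_lift (dpair \<gamma> \<gamma>b \<delta> \<delta>' \<eta> \<eta>' \<mu>) (m \<otimes> n)
      = tensor_lift \<mu> (twist \<gamma> \<gamma>b (tens \<delta> \<eta>) (tens \<delta>' \<eta>') (m \<otimes> n))" for m n
    by (subst tensor_lift_pure) (simp_all add: cbilinear_dpair assms dpair_def)
qed

text \<open>Left and right operators commute, so the same twist can be read from the other side; the
  right-handed statements about twists are obtained this way.\<close>

lemma twist_sym:
  assumes "bicomod \<Delta> \<epsilon> \<delta> \<delta>'" "clinear \<gamma>" "clinear \<gamma>b"
  shows "twist \<gamma> \<gamma>b \<delta> \<delta>' = twist \<gamma>b \<gamma> \<delta>' \<delta>"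
  using cocommute_lop[OF bicomodD(3,6,7)[OF assms(1)] assms(2,3)]
  by (simp add: fun_eq_iff twist_def)

text \<open>With \<open>\<phi>\<close> pulled back along the product, this says that twisted maps are colinear over the
  twisted product.\<close>

lemma twist_lop:
  assumes V: "bicomod \<Delta> \<epsilon> \<delta> \<delta>'" and self: "bicomod \<Delta> \<epsilon> \<Delta> (flip \<circ> \<Delta>)"
    and lin: "clinear \<gamma>" "clinear \<gamma>b" "clinear \<phi>" and inv: "conv \<Delta> \<gamma>b \<gamma> = \<epsilon>"
  shows "twist \<gamma> \<gamma>b \<delta> \<delta>' (lop \<delta> (\<lambda>c. \<phi> (twist \<gamma> \<gamma>b \<Delta> (flip \<circ> \<Delta>) c)) v)
    = lop \<delta> \<phi> (twist \<gamma> \<gamma>b \<delta> \<delta>' v)"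
proof -
  note D = bicomodD[OF V]
  note l = lin clinear_conv[OF D(4)]
  \<comment> \<open>Precomposing with the twist of the regular coactions conjugates
    \<open>\<phi>\<close> in the convolution algebra: the result is \<gamma> * \<phi> *
    \<gamma>b.\<close>
  have "(\<lambda>c. \<phi> (twist \<gamma> \<gamma>b \<Delta> (flip \<circ> \<Delta>) c)) = conv \<Delta> (conv \<Delta> \<gamma> \<phi>) \<gamma>b"
    unfolding twist_sym[OF self lin(1,2)] twist_def fun_eq_iff
    by (simp add: conv_lop'[OF clinear_conv[OF D(4) lin(1,3)] lin(2)] conv_lop[OF lin(3)])
  then have "twist \<gamma> \<gamma>b \<delta> \<delta>' (lop \<delta> (\<lambda>c. \<phi> (twist \<gamma> \<gamma>b \<Delta> (flip \<circ> \<Delta>) c)) v)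
      = lop \<delta>' \<gamma>b (lop \<delta> \<gamma> (lop \<delta> \<gamma>b (lop \<delta> \<phi> (lop \<delta> \<gamma> v))))"
    by (simp add: twist_def lop_lop[OF D(1), symmetric] l)
  \<comment> \<open>The factor \<gamma>b of the conjugate cancels the \<gamma> of the outer
    twist.\<close>
  also have "\<dots> = lop \<delta>' \<gamma>b (lop \<delta> \<phi> (lop \<delta> \<gamma> v))"
    by (simp only: lop_lop[OF D(1) lin(1,2)] inv comodD(4)[OF D(1)])
  also have "\<dots> = lop \<delta> \<phi> (twist \<gamma> \<gamma>b \<delta> \<delta>' v)"
    unfolding twist_def by (rule cocommute_lop[OF D(3,6,7), symmetric]) (rule l)+
  finally show ?thesis .
qed

lemma twist_twist:
  assumes "bicomod \<Delta> \<epsilon> \<delta> \<delta>'" "clinear \<gamma>" "clinear \<gamma>b"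
    and "conv \<Delta> \<gamma>b \<gamma> = \<epsilon>" "conv \<Delta> \<gamma> \<gamma>b = \<epsilon>"
  shows "twist \<gamma>b \<gamma> \<delta> \<delta>' (twist \<gamma> \<gamma>b \<delta> \<delta>' v) = v"
proof -
  note D = bicomodD[OF assms(1)]
  have "twist \<gamma>b \<gamma> \<delta> \<delta>' (twist \<gamma> \<gamma>b \<delta> \<delta>' v)
      = lop \<delta>' \<gamma> (lop \<delta>' \<gamma>b (lop \<delta> \<gamma>b (lop \<delta> \<gamma> v)))"
    by (simp add: twist_def cocommute_lop[OF D(3,6,7)] assms)
  also have "\<dots> = v"
    by (simp add: lop_lop[OF D(1)] lop_lop[OF D(2)] conv_flip assms comodD(4)[OF D(1)] comodD(4)[OF D(2)])
  finally show ?thesis .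
qed

text \<open>The operations are parameters, since the opposite co-opposite and the deformed bialgebra
  live on the same type.\<close>

locale bialgebra =
  fixes \<kappa> :: "'a::complex_vector \<Rightarrow> 'a \<Rightarrow> 'a" and u :: 'a and \<Delta> :: "'a \<Rightarrow> 'a \<otimes> 'a" and \<epsilon> :: "'a \<Rightarrow> complex"
  assumes mult_bilin: "cbilinear \<kappa>"
    and mult_assoc: "\<kappa> (\<kappa> a b) c = \<kappa> a (\<kappa> b c)"
    and unit_left: "\<kappa> u a = a" and unit_right: "\<kappa> a u = a"
    and self: "bicomod \<Delta> \<epsilon> \<Delta> (flip \<circ> \<Delta>)"
    and comult_mult: "colin \<kappa> \<Delta> \<Delta> \<Delta> \<kappa>"
    and comult_unit: "\<Delta> u = u \<otimes> u"
    and counit_mult: "\<epsilon> (\<kappa> a b) = \<epsilon> a * \<epsilon> b"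
    and counit_unit: "\<epsilon> u = 1"
begin

abbreviation "\<Delta>' \<equiv> flip \<circ> \<Delta>"
abbreviation "\<Delta>2 \<equiv> tens \<Delta> \<Delta>"
abbreviation "\<epsilon>2 \<equiv> func_tens \<epsilon> \<epsilon>"

lemmas comod_self = bicomodD(1)[OF self]
lemmas comod_self' = bicomodD(2)[OF self]
lemmas clinear_comult = bicomodD(4)[OF self]
lemmas clinear_counit = bicomodD(5)[OF self]

lemma clinear_comult': "clinear (flip \<circ> \<Delta>)"
  by (rule bicomodD(7)[OF self])

lemmas mult_lin [lin] = bilinear_lin(1,2)[OF mult_bilin]
lemmas comult_lin [lin] = clinear_compose[OF clinear_comult]
lemmas counit_lin [lin] = clinear_compose[OF clinear_counit]

lemma comult_mult_flip: "colin \<kappa> (flip \<circ> \<Delta>) (flip \<circ> \<Delta>) (flip \<circ> \<Delta>) \<kappa>"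
  using comult_mult by (simp add: colin_def flip_tensor_map2 mult_bilin)

lemma counit_mult_lift: "\<epsilon> (tensor_lift \<kappa> t) = \<epsilon>2 t"
  by (rule tensor_eqI[where f = "\<lambda>t. \<epsilon> (tensor_lift \<kappa> t)"])
    (simp_all add: clinear_func_tens clinear_counit tensor_lift_pure mult_bilin counit_mult
      clinear_compose clinear_tensor_lift)

lemma bicomod_self2: "bicomod \<Delta>2 \<epsilon>2 \<Delta>2 (tens \<Delta>' \<Delta>')"
  by (rule bicomod_tens[OF self self])

lemma flip_comult2: "flip \<circ> \<Delta>2 = tens \<Delta>' \<Delta>'"
  by (rule flip_comp_tens[OF clinear_comult clinear_comult])

end

text \<open>\<open>lop \<Delta>2 \<gamma>\<close> sends a \<otimes> b to \<gamma>(a_1 \<otimes> b_1)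
  a_2 \<otimes> b_2, so \<open>cocycle\<close> is the usual identity. The inverse is a parameter as
  well, so that the locale can be instantiated with the two functionals exchanged.\<close>

locale cocycle = bialgebra +
  fixes \<gamma> \<gamma>b :: "'a \<otimes> 'a \<Rightarrow> complex"
  assumes clinear_cocycle: "clinear \<gamma>" "clinear \<gamma>b"
    and inverse: "conv \<Delta>2 \<gamma> \<gamma>b = \<epsilon>2" "conv \<Delta>2 \<gamma>b \<gamma> = \<epsilon>2"
    and cocycle_unit: "\<gamma> (a \<otimes> u) = \<epsilon> a" "\<gamma> (u \<otimes> a) = \<epsilon> a"
    and cocycle: "\<gamma> (tensor_lift \<kappa> (lop \<Delta>2 \<gamma> (a \<otimes> b)) \<otimes> c) = \<gamma> (a \<otimes> tensor_lift \<kappa> (lop \<Delta>2 \<gamma> (b \<otimes> c)))"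
begin

lemmas cocycle_lin [lin] = clinear_cocycle[THEN clinear_compose]

section \<open>The cocycle identity on threefold tensor products\<close>

lemma comod_map_left:
  assumes "bicomod \<Delta> \<epsilon> \<delta> \<delta>'" "clinear \<eta>" "clinear \<theta>" "clinear \<rho>"
    and "cbilinear \<mu>" "colin \<kappa> \<eta> \<theta> \<rho> \<mu>"
  shows "comod_map (tens \<delta> (tens \<eta> \<theta>)) (tens \<delta> \<rho>) (tensor_map id (tensor_lift \<kappa>)) (tensor_map id (tensor_lift \<mu>))"
    "comod_map (tens (tens \<eta> \<theta>) \<delta>) (tens \<rho> \<delta>) (tensor_map (tensor_lift \<kappa>) id) (tensor_map (tensor_lift \<mu>) id)"
  using assms colin_iff[OF mult_bilin assms(5,2,3,4)] bicomodD(6)[OF assms(1)]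
  by (auto intro!: comod_map_tens comod_map_id clinear_tens)

abbreviation "F12 \<equiv> func_tens \<gamma> \<epsilon>"
abbreviation "F23 \<equiv> func_tens \<epsilon> \<gamma>"
abbreviation "G12 \<equiv> func_tens \<gamma>b \<epsilon>"
abbreviation "G23 \<equiv> func_tens \<epsilon> \<gamma>b"

lemmas coalg_L = comod_tens[OF comod_tens[OF comod_self comod_self] comod_self]
lemmas coalg_R = comod_tens[OF comod_self comod_tens[OF comod_self comod_self]]

lemma clinear_pullback:
  "clinear \<phi> \<Longrightarrow> clinear (\<lambda>t. \<phi> (tensor_map (tensor_lift \<kappa>) id t))"
  "clinear \<phi> \<Longrightarrow> clinear (\<lambda>t. \<phi> (tensor_map id (tensor_lift \<kappa>) t))"
  by (erule clinear_compose, intro clinear_tensor_map clinear_tensor_lift mult_bilin clinear_id)+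

lemmas clinear_F = clinear_func_tens[OF clinear_cocycle(1) clinear_counit]
  clinear_func_tens[OF clinear_counit clinear_cocycle(1)]
  clinear_func_tens[OF clinear_cocycle(2) clinear_counit]
  clinear_func_tens[OF clinear_counit clinear_cocycle(2)]

text \<open>\<open>FL\<close> and \<open>FR\<close> are the two sides of the cocycle identity as
  functionals on threefold tensors; \<open>GL\<close> and \<open>GR\<close> are their convolution
  inverses, hence the reversed order of the factors.\<close>

definition "FL = conv (tens \<Delta>2 \<Delta>) F12 (\<lambda>t. \<gamma> (tensor_map (tensor_lift \<kappa>) id t))"
definition "FR = conv (tens \<Delta> \<Delta>2) F23 (\<lambda>t. \<gamma> (tensor_map id (tensor_lift \<kappa>) t))"
definition "GL = conv (tens \<Delta>2 \<Delta>) (\<lambda>t. \<gamma>b (tensor_map (tensor_lift \<kappa>) id t)) G12"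
definition "GR = conv (tens \<Delta> \<Delta>2) (\<lambda>t. \<gamma>b (tensor_map id (tensor_lift \<kappa>) t)) G23"

lemma clinear_FG: "clinear FL" "clinear FR" "clinear GL" "clinear GR"
  unfolding FL_def FR_def GL_def GR_def
  by (intro clinear_conv clinear_tens clinear_comult clinear_F clinear_pullback clinear_cocycle)+

lemma FL_pure: "FL ((a \<otimes> b) \<otimes> c) = \<gamma> (tensor_lift \<kappa> (lop \<Delta>2 \<gamma> (a \<otimes> b)) \<otimes> c)"
  unfolding FL_def
  by (simp add: conv_lop clinear_pullback clinear_cocycle lop_tens clinear_counit clinear_tens
      clinear_comult tensor_map_pure clinear_id clinear_tensor_lift mult_bilin comodD(4)[OF comod_self])

lemma FR_pure: "FR (a \<otimes> (b \<otimes> c)) = \<gamma> (a \<otimes> tensor_lift \<kappa> (lop \<Delta>2 \<gamma> (b \<otimes> c)))"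
  unfolding FR_def
  by (simp add: conv_lop clinear_pullback clinear_cocycle lop_tens clinear_counit clinear_tens
      clinear_comult tensor_map_pure clinear_id clinear_tensor_lift mult_bilin comodD(4)[OF comod_self])

lemma GL_pure: "GL ((a \<otimes> b) \<otimes> c) = \<gamma>b (tensor_lift \<kappa> (lop (tens \<Delta>' \<Delta>') \<gamma>b (a \<otimes> b)) \<otimes> c)"
  unfolding GL_def
  by (simp add: conv_lop' clinear_pullback clinear_cocycle lop_tens clinear_counit clinear_tens clinear_F
      flip_comp_tens clinear_comult' clinear_comult tensor_map_pure clinear_id clinear_tensor_lift mult_bilin
      comodD(4)[OF comod_self'])

lemma GR_pure: "GR (a \<otimes> (b \<otimes> c)) = \<gamma>b (a \<otimes> tensor_lift \<kappa> (lop (tens \<Delta>' \<Delta>') \<gamma>b (b \<otimes> c)))"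
  unfolding GR_def
  by (simp add: conv_lop' clinear_pullback clinear_cocycle lop_tens clinear_counit clinear_tens clinear_F
      flip_comp_tens clinear_comult' clinear_comult tensor_map_pure clinear_id clinear_tensor_lift mult_bilin
      comodD(4)[OF comod_self'])

lemma FL_eq_FR: "FL t = FR (tensor_assoc t)"
  by (rule tensor3_eqI[where g = "\<lambda>t. FR (tensor_assoc t)"])
    (simp_all add: clinear_FG clinear_compose clinear_tensor_assoc FL_pure FR_pure cocycle)

text \<open>Multiplication is a coalgebra map, so the pulled back \<gamma> and \<gamma>b remain
  inverse to each other, and the four factors telescope.\<close>

lemma FL_GL: "conv (tens \<Delta>2 \<Delta>) FL GL = func_tens \<epsilon>2 \<epsilon>"
  unfolding FL_def GL_def
proof (rule conv_inverse_mult[OF coalg_L])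
  have "func_tens \<epsilon> \<epsilon> (tensor_map (tensor_lift \<kappa>) id t) = func_tens \<epsilon>2 \<epsilon> t" for t
    by (rule tensor_eqI[where f = "\<lambda>t. func_tens \<epsilon> \<epsilon> (tensor_map (tensor_lift \<kappa>) id t)"])
      (simp_all add: clinear_pullback clinear_func_tens clinear_counit tensor_map_pure clinear_id
        clinear_tensor_lift mult_bilin counit_mult_lift)
  then show "conv (tens \<Delta>2 \<Delta>) (\<lambda>t. \<gamma> (tensor_map (tensor_lift \<kappa>) id t)) (\<lambda>t. \<gamma>b (tensor_map (tensor_lift \<kappa>) id t))
      = func_tens \<epsilon>2 \<epsilon>"
    by (subst conv_comod_map[OF comod_map_left(2)[OF self clinear_comult clinear_comult clinear_comult mult_bilin comult_mult]])
      (simp_all add: clinear_cocycle inverse)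
  show "conv (tens \<Delta>2 \<Delta>) F12 G12 = func_tens \<epsilon>2 \<epsilon>"
    by (simp add: conv_func_tens clinear_tens clinear_comult clinear_cocycle clinear_counit inverse
        conv_counit_left[OF comod_self])
qed (intro clinear_F clinear_pullback clinear_cocycle)+

lemma GR_FR: "conv (tens \<Delta> \<Delta>2) GR FR = func_tens \<epsilon> \<epsilon>2"
  unfolding FR_def GR_def
proof (rule conv_inverse_mult[OF coalg_R])
  have "func_tens \<epsilon> \<epsilon> (tensor_map id (tensor_lift \<kappa>) t) = func_tens \<epsilon> \<epsilon>2 t" for t
    by (rule tensor_eqI[where f = "\<lambda>t. func_tens \<epsilon> \<epsilon> (tensor_map id (tensor_lift \<kappa>) t)"])
      (simp_all add: clinear_pullback clinear_func_tens clinear_counit tensor_map_pure clinear_id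
        clinear_tensor_lift mult_bilin counit_mult_lift)
  then show "conv (tens \<Delta> \<Delta>2) (\<lambda>t. \<gamma>b (tensor_map id (tensor_lift \<kappa>) t)) (\<lambda>t. \<gamma> (tensor_map id (tensor_lift \<kappa>) t))
      = func_tens \<epsilon> \<epsilon>2"
    by (subst conv_comod_map[OF comod_map_left(1)[OF self clinear_comult clinear_comult clinear_comult mult_bilin comult_mult]])
      (simp_all add: clinear_cocycle inverse)
  show "conv (tens \<Delta> \<Delta>2) G23 F23 = func_tens \<epsilon> \<epsilon>2"
    by (simp add: conv_func_tens clinear_tens clinear_comult clinear_cocycle clinear_counit inverse
        conv_counit_left[OF comod_self])
qed (intro clinear_F clinear_pullback clinear_cocycle)+

end

text \<open>Colinearity of \<open>\<mu>\<close> moves a functional \<open>\<phi>\<close> on the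
  target to the tensor product, where it becomes its pullback along \<open>\<kappa>\<close>. There
  \<open>twist_lop\<close> exchanges it with the twist, at the price of replacing
  \<open>\<kappa>\<close> by the twisted product.\<close>

lemma dpair_colin:
  fixes \<kappa> :: "'c::complex_vector \<Rightarrow> 'c \<Rightarrow> 'c"
  assumes self: "bicomod \<Delta> \<epsilon> \<Delta> (flip \<circ> \<Delta>)"
    and M: "bicomod \<Delta> \<epsilon> \<delta> \<delta>'" and N: "bicomod \<Delta> \<epsilon> \<eta> \<eta>'" and P: "clinear \<theta>"
    and lin: "clinear \<gamma>" "clinear \<gamma>b" and inv: "conv (tens \<Delta> \<Delta>) \<gamma>b \<gamma> = func_tens \<epsilon> \<epsilon>"
    and bilin: "cbilinear \<kappa>" "cbilinear \<mu>" and colin: "colin \<kappa> \<delta> \<eta> \<theta> \<mu>"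
  shows "colin (dpair \<gamma> \<gamma>b \<Delta> (flip \<circ> \<Delta>) \<Delta> (flip \<circ> \<Delta>) \<kappa>) \<delta> \<eta> \<theta> (dpair \<gamma> \<gamma>b \<delta> \<delta>' \<eta> \<eta>' \<mu>)"
proof -
  note D = bicomodD[OF self] and DM = bicomodD[OF M] and DN = bicomodD[OF N]
  note MN = bicomod_tens[OF M N]
  have self2: "bicomod (tens \<Delta> \<Delta>) (func_tens \<epsilon> \<epsilon>) (tens \<Delta> \<Delta>) (flip \<circ> tens \<Delta> \<Delta>)"
    unfolding flip_comp_tens[OF D(4) D(4)] by (rule bicomod_tens[OF self self])
  note bil = cbilinear_dpair[OF bilin(1) lin D(4) D(7) D(4) D(7)]
    cbilinear_dpair[OF bilin(2) lin DM(6,7) DN(6,7)]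
  show ?thesis
    unfolding colin_iff[OF bil DM(6) DN(6) P]
  proof (rule comod_mapI)
    fix \<phi> :: "'c \<Rightarrow> complex" and v
    assume \<phi>: "clinear \<phi>"
    have \<phi>\<kappa>: "clinear (\<lambda>t. \<phi> (tensor_lift \<kappa> t))"
      by (rule clinear_compose[OF \<phi> clinear_tensor_lift[OF bilin(1)]])
    show "lop \<theta> \<phi> (tensor_lift (dpair \<gamma> \<gamma>b \<delta> \<delta>' \<eta> \<eta>' \<mu>) v)
      = tensor_lift (dpair \<gamma> \<gamma>b \<delta> \<delta>' \<eta> \<eta>' \<mu>) (lop (tens \<delta> \<eta>)
          (\<lambda>c. \<phi> (tensor_lift (dpair \<gamma> \<gamma>b \<Delta> (flip \<circ> \<Delta>) \<Delta> (flip \<circ> \<Delta>) \<kappa>) c)) v)"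
      unfolding tensor_lift_dpair[OF bilin(2) lin DM(6,7) DN(6,7)]
        tensor_lift_dpair[OF bilin(1) lin D(4) D(7) D(4) D(7)]
      unfolding lop_comod_map[OF colin[unfolded colin_iff[OF bilin DM(6) DN(6) P]] \<phi>]
      by (simp only: twist_lop[OF MN self2 lin \<phi>\<kappa> inv, unfolded flip_comp_tens[OF D(4) D(4)]])
  qed (intro clinear_tensor_lift bil)+
qed

lemma lop_inv: "clinear \<phi> \<Longrightarrow> \<delta> m = w \<otimes> m \<Longrightarrow> lop \<delta> \<phi> m = \<phi> w *\<^sub>C m"
  unfolding lop_def
  by (simp, rule tensor_lift_pure) (intro cbilinearI lin clinear_scaleC_left)

text \<open>The coefficient of the first factor is the constant \<open>w\<close>, so a functional on
  pairs becomes a functional of the second coefficient alone.\<close>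

lemma lop_tens_left_inv:
  assumes "clinear \<Phi>" "clinear \<delta>" "clinear \<eta>" "\<delta> m = w \<otimes> m"
  shows "lop (tens \<delta> \<eta>) \<Phi> (m \<otimes> n) = m \<otimes> lop \<eta> (\<lambda>d. \<Phi> (w \<otimes> d)) n"
proof -
  note [lin] = clinear_compose[OF assms(1)]
  have "lop (tens \<delta> \<eta>) \<Phi> (m \<otimes> n) = (\<ointegral>d y\<leftarrow>\<eta> n. \<Phi> (w \<otimes> d) *\<^sub>C (m \<otimes> y))"
    unfolding lop_tens_pure[OF assms(1-3)] assms(4) by (rule tensor_lift_pure) (intro cbilinearI lin)
  then show ?thesis by (simp add: lop_def pull scale_pure)
qed

lemma lop_tens_right_inv:
  assumes "clinear \<Phi>" "clinear \<delta>" "clinear \<eta>" "\<eta> n = w \<otimes> n"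
  shows "lop (tens \<delta> \<eta>) \<Phi> (m \<otimes> n) = lop \<delta> (\<lambda>c. \<Phi> (c \<otimes> w)) m \<otimes> n"
proof -
  note [lin] = clinear_compose[OF assms(1)]
  have "lop (tens \<delta> \<eta>) \<Phi> (m \<otimes> n) = (\<ointegral>c x\<leftarrow>\<delta> m. \<Phi> (c \<otimes> w) *\<^sub>C (x \<otimes> n))"
    unfolding lop_tens_pure[OF assms(1-3)] assms(4)
    by (subst tensor_lift_pure) (intro cbilinearI lin, rule refl)
  then show ?thesis by (simp add: lop_def pull scale_pure)
qed

context cocycle
begin

text \<open>Equal functionals have equal convolution inverses: pulled back along the associator,
  \<open>GR\<close> is a left inverse of \<open>FL\<close>, while \<open>GL\<close> is a right
  inverse.\<close>

lemma GL_eq_GR: "GL t = GR (tensor_assoc t)"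
proof -
  note assoc = comod_map_assoc[OF clinear_comult clinear_comult clinear_comult]
  have eps: "func_tens \<epsilon> \<epsilon>2 (tensor_assoc t) = func_tens \<epsilon>2 \<epsilon> t" for t
    by (rule tensor3_eqI[where f = "\<lambda>t. func_tens \<epsilon> \<epsilon>2 (tensor_assoc t)"])
      (simp_all add: clinear_func_tens clinear_counit clinear_compose clinear_tensor_assoc)
  have lin: "clinear (\<lambda>t. GR (tensor_assoc t))"
    by (rule clinear_compose[OF clinear_FG(4) clinear_tensor_assoc])
  have "conv (tens \<Delta>2 \<Delta>) (\<lambda>t. GR (tensor_assoc t)) (\<lambda>t. FR (tensor_assoc t)) = func_tens \<epsilon>2 \<epsilon>"
    unfolding conv_comod_map[OF assoc clinear_FG(4,2)] GR_FR by (rule ext, rule eps)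
  moreover have "(\<lambda>t. FR (tensor_assoc t)) = FL"
    by (simp add: fun_eq_iff FL_eq_FR)
  moreover have "comod (flip \<circ> tens \<Delta>2 \<Delta>) (func_tens \<epsilon>2 \<epsilon>) (flip \<circ> tens \<Delta>2 \<Delta>)"
    unfolding flip_comp_tens[OF clinear_tens[OF clinear_comult clinear_comult] clinear_comult]
      flip_comult2
    by (intro comod_tens comod_self')
  ultimately have "(\<lambda>t. GR (tensor_assoc t)) = GL"
    by (intro conv_inverse_unique[OF coalg_L _ clinear_FG(1) lin clinear_FG(3) _ FL_GL]) simp_all
  then show ?thesis by (simp add: fun_eq_iff)
qed

text \<open>The inverse of a left cocycle is a right cocycle, which is why the legs are split off by
  the flipped coproduct.\<close>

lemma cocycle_inverse:
  "\<gamma>b (tensor_lift \<kappa> (lop (tens \<Delta>' \<Delta>') \<gamma>b (a \<otimes> b)) \<otimes> c)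
    = \<gamma>b (a \<otimes> tensor_lift \<kappa> (lop (tens \<Delta>' \<Delta>') \<gamma>b (b \<otimes> c)))"
  using GL_eq_GR[of "(a \<otimes> b) \<otimes> c"] by (simp add: GL_pure GR_pure)

text \<open>Evaluated with one argument \<open>u\<close>, the factor \<gamma> in \<gamma> *
  \<gamma>b = \<epsilon>2 becomes the counit and only \<gamma>b remains.\<close>

lemma inverse_unit: "\<gamma>b (a \<otimes> u) = \<epsilon> a" "\<gamma>b (u \<otimes> a) = \<epsilon> a"
proof -
  have "conv \<Delta>2 \<gamma> \<gamma>b (a \<otimes> u) = \<gamma>b (a \<otimes> u)"
    by (simp add: conv_lop clinear_cocycle lop_tens_right_inv clinear_comult comult_unit
        cocycle_unit comodD(4)[OF comod_self])
  then show "\<gamma>b (a \<otimes> u) = \<epsilon> a"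
    by (simp add: inverse clinear_counit counit_unit)
  have "conv \<Delta>2 \<gamma> \<gamma>b (u \<otimes> a) = \<gamma>b (u \<otimes> a)"
    by (simp add: conv_lop clinear_cocycle lop_tens_left_inv clinear_comult comult_unit
        cocycle_unit comodD(4)[OF comod_self])
  then show "\<gamma>b (u \<otimes> a) = \<epsilon> a"
    by (simp add: inverse clinear_counit counit_unit)
qed

text \<open>Left invariance of \<open>m\<close> leaves only \<gamma> with first argument
  \<open>u\<close>, and right invariance of \<open>n\<close> leaves only \<gamma>b with second
  argument \<open>u\<close>; both are counits.\<close>

lemma twist_left_right_inv:
  assumes "bicomod \<Delta> \<epsilon> \<delta> \<delta>'" "bicomod \<Delta> \<epsilon> \<eta> \<eta>'" "\<delta> m = u \<otimes> m" "\<eta>' n = u \<otimes> n"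
  shows "twist \<gamma> \<gamma>b (tens \<delta> \<eta>) (tens \<delta>' \<eta>') (m \<otimes> n) = m \<otimes> n"
  using assms(3,4) bicomodD[OF assms(1)] bicomodD[OF assms(2)]
  by (simp add: twist_def lop_tens_left_inv lop_tens_right_inv clinear_cocycle cocycle_unit
      inverse_unit comodD(4))

lemma twist_right_left_inv:
  assumes "bicomod \<Delta> \<epsilon> \<delta> \<delta>'" "bicomod \<Delta> \<epsilon> \<eta> \<eta>'" "\<delta>' m = u \<otimes> m" "\<eta> n = u \<otimes> n"
  shows "twist \<gamma> \<gamma>b (tens \<delta> \<eta>) (tens \<delta>' \<eta>') (m \<otimes> n) = m \<otimes> n"
  using assms(3,4) bicomodD[OF assms(1)] bicomodD[OF assms(2)]
  by (simp add: twist_def lop_tens_left_inv lop_tens_right_inv clinear_cocycle cocycle_unit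
      inverse_unit comodD(4))

lemma dpair_unit:
  assumes "bicomod \<Delta> \<epsilon> \<delta> \<delta>'"
  shows "cbilinear \<mu> \<Longrightarrow> dpair \<gamma> \<gamma>b \<Delta> \<Delta>' \<delta> \<delta>' \<mu> u m = \<mu> u m"
    "cbilinear \<nu> \<Longrightarrow> dpair \<gamma> \<gamma>b \<delta> \<delta>' \<Delta> \<Delta>' \<nu> m u = \<nu> m u"
  using comult_unit bicomodD[OF assms(1)]
  by (simp_all add: dpair_def twist_def lop_tens_left_inv lop_tens_right_inv clinear_cocycle
      clinear_comult clinear_comult' cocycle_unit inverse_unit comodD(4) tensor_lift_pure)

text \<open>The inner twist acts on the triple through \<open>F12\<close> and \<open>G12\<close>.
  Colinearity of \<open>\<mu>\<close> pulls the outer \<gamma> and \<gamma>b back along the product,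
  and since left operators commute with right ones, the left factors merge into \<open>FL\<close>
  and the right ones into \<open>GL\<close>.\<close>

lemma dpair_left_nested:
  assumes M: "bicomod \<Delta> \<epsilon> \<delta> \<delta>'" and N: "bicomod \<Delta> \<epsilon> \<eta> \<eta>'" and P: "bicomod \<Delta> \<epsilon> \<theta> \<theta>'"
    and Q: "clinear \<rho>" "clinear \<rho>'"
    and \<mu>: "cbilinear \<mu>" "colin \<kappa> \<delta> \<eta> \<rho> \<mu>" "colin \<kappa> \<delta>' \<eta>' \<rho>' \<mu>"
  shows "dpair \<gamma> \<gamma>b \<rho> \<rho>' \<theta> \<theta>' \<nu> (dpair \<gamma> \<gamma>b \<delta> \<delta>' \<eta> \<eta>' \<mu> m n) p
    = tensor_lift \<nu> (tensor_map (tensor_lift \<mu>) id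
        (lop (tens (tens \<delta>' \<eta>') \<theta>') GL (lop (tens (tens \<delta> \<eta>) \<theta>) FL ((m \<otimes> n) \<otimes> p))))"
proof -
  note DM = bicomodD[OF M] and DN = bicomodD[OF N] and DP = bicomodD[OF P]
  let ?D = "tens (tens \<delta> \<eta>) \<theta>" and ?D' = "tens (tens \<delta>' \<eta>') \<theta>'"
  let ?h = "tensor_map (tensor_lift \<mu>) id" and ?p = "tensor_map (tensor_lift \<kappa>) id"
  let ?x = "(m \<otimes> n) \<otimes> p"
  note B = bicomodD[OF bicomod_tens[OF bicomod_tens[OF M N] P]]
  note maps = comod_map_left(2)[OF P DM(6) DN(6) Q(1) \<mu>(1,2)]
  have maps': "comod_map ?D' (tens \<rho>' \<theta>') ?p ?h"
    using \<mu> colin_iff[OF mult_bilin \<mu>(1) DM(7) DN(7) Q(2)] DP(7) Q DM DN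
    by (auto intro!: comod_map_tens comod_map_id clinear_tens)
  have s: "twist \<gamma> \<gamma>b (tens \<delta> \<eta>) (tens \<delta>' \<eta>') (m \<otimes> n) \<otimes> p = lop ?D' G12 (lop ?D F12 ?x)"
    using DM DN DP
    by (simp add: twist_def lop_tens clinear_tens clinear_cocycle comodD(4))
  have h: "dpair \<gamma> \<gamma>b \<delta> \<delta>' \<eta> \<eta>' \<mu> m n \<otimes> p = ?h (lop ?D' G12 (lop ?D F12 ?x))"
    unfolding s[symmetric] dpair_def
    by (simp add: tensor_map_pure clinear_tensor_lift \<mu>(1) clinear_id)
  have "twist \<gamma> \<gamma>b (tens \<rho> \<theta>) (tens \<rho>' \<theta>') (dpair \<gamma> \<gamma>b \<delta> \<delta>' \<eta> \<eta>' \<mu> m n \<otimes> p)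
      = ?h (lop ?D' (\<lambda>t. \<gamma>b (?p t)) (lop ?D (\<lambda>t. \<gamma> (?p t)) (lop ?D' G12 (lop ?D F12 ?x))))"
    unfolding h twist_def
    by (simp only: lop_comod_map[OF maps clinear_cocycle(1)] lop_comod_map[OF maps' clinear_cocycle(2)])
  moreover have "lop ?D (\<lambda>t. \<gamma> (?p t)) (lop ?D' G12 (lop ?D F12 ?x))
      = lop ?D' G12 (lop ?D FL ?x)"
    unfolding FL_def lop_lop[OF B(1) clinear_pullback(1)[OF clinear_cocycle(1)] clinear_F(1), symmetric]
    by (rule cocommute_lop[OF B(3,6,7) clinear_pullback(1)[OF clinear_cocycle(1)] clinear_F(3)])
  moreover have "lop ?D' (\<lambda>t. \<gamma>b (?p t)) (lop ?D' G12 (lop ?D FL ?x)) = lop ?D' GL (lop ?D FL ?x)"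
    unfolding GL_def lop_lop[OF B(2) clinear_pullback(1)[OF clinear_cocycle(2)] clinear_F(3)]
      conv_flip[OF clinear_F(3) clinear_pullback(1)[OF clinear_cocycle(2)]] ..
  ultimately show ?thesis by (simp only: dpair_def)
qed

lemma dpair_right_nested:
  assumes M: "bicomod \<Delta> \<epsilon> \<delta> \<delta>'" and N: "bicomod \<Delta> \<epsilon> \<eta> \<eta>'" and P: "bicomod \<Delta> \<epsilon> \<theta> \<theta>'"
    and Q: "clinear \<rho>" "clinear \<rho>'"
    and \<mu>: "cbilinear \<mu>" "colin \<kappa> \<eta> \<theta> \<rho> \<mu>" "colin \<kappa> \<eta>' \<theta>' \<rho>' \<mu>"
  shows "dpair \<gamma> \<gamma>b \<delta> \<delta>' \<rho> \<rho>' \<nu> m (dpair \<gamma> \<gamma>b \<eta> \<eta>' \<theta> \<theta>' \<mu> n p)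
    = tensor_lift \<nu> (tensor_map id (tensor_lift \<mu>)
        (lop (tens \<delta>' (tens \<eta>' \<theta>')) GR (lop (tens \<delta> (tens \<eta> \<theta>)) FR (m \<otimes> (n \<otimes> p)))))"
proof -
  note DM = bicomodD[OF M] and DN = bicomodD[OF N] and DP = bicomodD[OF P]
  let ?D = "tens \<delta> (tens \<eta> \<theta>)" and ?D' = "tens \<delta>' (tens \<eta>' \<theta>')"
  let ?h = "tensor_map id (tensor_lift \<mu>)" and ?p = "tensor_map id (tensor_lift \<kappa>)"
  let ?x = "m \<otimes> (n \<otimes> p)"
  note B = bicomodD[OF bicomod_tens[OF M bicomod_tens[OF N P]]]
  note maps = comod_map_left(1)[OF M DN(6) DP(6) Q(1) \<mu>(1,2)]
  have maps': "comod_map ?D' (tens \<delta>' \<rho>') ?p ?h"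
    using \<mu> colin_iff[OF mult_bilin \<mu>(1) DN(7) DP(7) Q(2)] DP(7) Q DM DN
    by (auto intro!: comod_map_tens comod_map_id clinear_tens)
  have s: "m \<otimes> twist \<gamma> \<gamma>b (tens \<eta> \<theta>) (tens \<eta>' \<theta>') (n \<otimes> p) = lop ?D' G23 (lop ?D F23 ?x)"
    using DM DN DP
    by (simp add: twist_def lop_tens clinear_tens clinear_cocycle comodD(4))
  have h: "m \<otimes> dpair \<gamma> \<gamma>b \<eta> \<eta>' \<theta> \<theta>' \<mu> n p = ?h (lop ?D' G23 (lop ?D F23 ?x))"
    unfolding s[symmetric] dpair_def
    by (simp add: tensor_map_pure clinear_tensor_lift \<mu>(1) clinear_id)
  have "twist \<gamma> \<gamma>b (tens \<delta> \<rho>) (tens \<delta>' \<rho>') (m \<otimes> dpair \<gamma> \<gamma>b \<eta> \<eta>' \<theta> \<theta>' \<mu> n p)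
      = ?h (lop ?D' (\<lambda>t. \<gamma>b (?p t)) (lop ?D (\<lambda>t. \<gamma> (?p t)) (lop ?D' G23 (lop ?D F23 ?x))))"
    unfolding h twist_def
    by (simp only: lop_comod_map[OF maps clinear_cocycle(1)] lop_comod_map[OF maps' clinear_cocycle(2)])
  moreover have "lop ?D (\<lambda>t. \<gamma> (?p t)) (lop ?D' G23 (lop ?D F23 ?x))
      = lop ?D' G23 (lop ?D FR ?x)"
    unfolding FR_def lop_lop[OF B(1) clinear_pullback(2)[OF clinear_cocycle(1)] clinear_F(2), symmetric]
    by (rule cocommute_lop[OF B(3,6,7) clinear_pullback(2)[OF clinear_cocycle(1)] clinear_F(4)])
  moreover have "lop ?D' (\<lambda>t. \<gamma>b (?p t)) (lop ?D' G23 (lop ?D FR ?x)) = lop ?D' GR (lop ?D FR ?x)"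
    unfolding GR_def lop_lop[OF B(2) clinear_pullback(2)[OF clinear_cocycle(2)] clinear_F(4)]
      conv_flip[OF clinear_F(4) clinear_pullback(2)[OF clinear_cocycle(2)]] ..
  ultimately show ?thesis by (simp only: dpair_def)
qed

text \<open>\<open>FL\<close> and \<open>FR\<close>, and likewise \<open>GL\<close> and
  \<open>GR\<close>, correspond under the associator, so both bracketings apply the same operators.
  Four separate maps cover associativity of the product, the bimodule laws, and balancing and right
  linearity of a metric. Colinearity concerns the inner maps, across which the outer cocycle is
  pulled back.\<close>

theorem dpair_assoc:
  assumes M: "bicomod \<Delta> \<epsilon> \<delta> \<delta>'" and N: "bicomod \<Delta> \<epsilon> \<eta> \<eta>'" and P: "bicomod \<Delta> \<epsilon> \<theta> \<theta>'"
    and Q: "clinear \<rho>" "clinear \<rho>'" and R: "clinear \<sigma>" "clinear \<sigma>'"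
    and \<mu>1: "cbilinear \<mu>1" "colin \<kappa> \<delta> \<eta> \<rho> \<mu>1" "colin \<kappa> \<delta>' \<eta>' \<rho>' \<mu>1"
    and \<mu>3: "cbilinear \<mu>3" "colin \<kappa> \<eta> \<theta> \<sigma> \<mu>3" "colin \<kappa> \<eta>' \<theta>' \<sigma>' \<mu>3"
    and bilin: "cbilinear \<mu>2" "cbilinear \<mu>4" and assoc: "\<And>m n p. \<mu>2 (\<mu>1 m n) p = \<mu>4 m (\<mu>3 n p)"
  shows "dpair \<gamma> \<gamma>b \<rho> \<rho>' \<theta> \<theta>' \<mu>2 (dpair \<gamma> \<gamma>b \<delta> \<delta>' \<eta> \<eta>' \<mu>1 m n) p
    = dpair \<gamma> \<gamma>b \<delta> \<delta>' \<sigma> \<sigma>' \<mu>4 m (dpair \<gamma> \<gamma>b \<eta> \<eta>' \<theta> \<theta>' \<mu>3 n p)"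
proof -
  note DM = bicomodD[OF M] and DN = bicomodD[OF N] and DP = bicomodD[OF P]
  note [simp] = clinear_tensor_lift bilin \<mu>1(1) \<mu>3(1) clinear_id
  have "tensor_lift \<mu>2 (tensor_map (tensor_lift \<mu>1) id t)
      = tensor_lift \<mu>4 (tensor_map id (tensor_lift \<mu>3) (tensor_assoc t))" for t
    by (rule tensor3_eqI[where f = "\<lambda>t. tensor_lift \<mu>2 (tensor_map (tensor_lift \<mu>1) id t)"
          and g = "\<lambda>t. tensor_lift \<mu>4 (tensor_map id (tensor_lift \<mu>3) (tensor_assoc t))"])
      (simp_all add: clinear_compose[OF clinear_tensor_lift] clinear_compose[OF clinear_tensor_map]
        clinear_tensor_map clinear_tensor_assoc tensor_map_pure tensor_lift_pure assoc)
  moreover have "lop (tens \<delta> (tens \<eta> \<theta>)) FR (m \<otimes> (n \<otimes> p))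
      = tensor_assoc (lop (tens (tens \<delta> \<eta>) \<theta>) FL ((m \<otimes> n) \<otimes> p))"
    using lop_comod_map[OF comod_map_assoc[OF DM(6) DN(6) DP(6)] clinear_FG(2), of "(m \<otimes> n) \<otimes> p"]
    by (simp add: FL_eq_FR[symmetric])
  moreover have "lop (tens \<delta>' (tens \<eta>' \<theta>')) GR (tensor_assoc t)
      = tensor_assoc (lop (tens (tens \<delta>' \<eta>') \<theta>') GL t)" for t
    using lop_comod_map[OF comod_map_assoc[OF DM(7) DN(7) DP(7)] clinear_FG(4), of t]
    by (simp add: GL_eq_GR[symmetric])
  ultimately show ?thesis
    unfolding dpair_left_nested[OF M N P Q \<mu>1] dpair_right_nested[OF M N P R \<mu>3] by simp
qed

lemma dpair_colin_left:
  assumes "bicomod \<Delta> \<epsilon> \<delta> \<delta>'" "bicomod \<Delta> \<epsilon> \<eta> \<eta>'" "clinear \<theta>" "cbilinear \<mu>" "colin \<kappa> \<delta> \<eta> \<theta> \<mu>"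
  shows "colin (dpair \<gamma> \<gamma>b \<Delta> \<Delta>' \<Delta> \<Delta>' \<kappa>) \<delta> \<eta> \<theta> (dpair \<gamma> \<gamma>b \<delta> \<delta>' \<eta> \<eta>' \<mu>)"
  by (rule dpair_colin[OF self assms(1-3) clinear_cocycle inverse(2) mult_bilin assms(4,5)])

lemma dpair_sym:
  assumes "bicomod \<Delta> \<epsilon> \<delta> \<delta>'" "bicomod \<Delta> \<epsilon> \<eta> \<eta>'"
  shows "dpair \<gamma>b \<gamma> \<delta>' \<delta> \<eta>' \<eta> \<mu> = dpair \<gamma> \<gamma>b \<delta> \<delta>' \<eta> \<eta>' \<mu>"
  using twist_sym[OF bicomod_tens[OF assms] clinear_cocycle] by (simp add: fun_eq_iff dpair_def)

text \<open>This is \<open>dpair_colin\<close> for the co-opposite coalgebra with \<gamma> and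
  \<gamma>b exchanged, brought back by \<open>dpair_sym\<close>.\<close>

lemma dpair_colin_right:
  assumes "bicomod \<Delta> \<epsilon> \<delta> \<delta>'" "bicomod \<Delta> \<epsilon> \<eta> \<eta>'" "clinear \<theta>'" "cbilinear \<mu>" "colin \<kappa> \<delta>' \<eta>' \<theta>' \<mu>"
  shows "colin (dpair \<gamma> \<gamma>b \<Delta> \<Delta>' \<Delta> \<Delta>' \<kappa>) \<delta>' \<eta>' \<theta>' (dpair \<gamma> \<gamma>b \<delta> \<delta>' \<eta> \<eta>' \<mu>)"
proof -
  have "conv (tens \<Delta>' \<Delta>') \<gamma> \<gamma>b = \<epsilon>2"
    unfolding flip_comult2[symmetric] conv_flip[OF clinear_cocycle] by (rule inverse)
  moreover have "bicomod \<Delta>' \<epsilon> \<Delta>' (flip \<circ> \<Delta>')"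
    using bicomod_sym[OF self] by simp
  ultimately have "colin (dpair \<gamma>b \<gamma> \<Delta>' (flip \<circ> \<Delta>') \<Delta>' (flip \<circ> \<Delta>') \<kappa>) \<delta>' \<eta>' \<theta>' (dpair \<gamma>b \<gamma> \<delta>' \<delta> \<eta>' \<eta> \<mu>)"
    by (rule dpair_colin[OF _ assms(1)[THEN bicomod_sym] assms(2)[THEN bicomod_sym] assms(3)
          clinear_cocycle(2,1) _ mult_bilin assms(4,5), rotated])
  then show ?thesis
    unfolding flip_comp_flip dpair_sym[OF self self] dpair_sym[OF assms(1,2)] .
qed

lemma dpair_dpair:
  assumes "bicomod \<Delta> \<epsilon> \<delta> \<delta>'" "bicomod \<Delta> \<epsilon> \<eta> \<eta>'" "cbilinear \<mu>"
  shows "dpair \<gamma>b \<gamma> \<delta> \<delta>' \<eta> \<eta>' (dpair \<gamma> \<gamma>b \<delta> \<delta>' \<eta> \<eta>' \<mu>) = \<mu>"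
proof (intro ext)
  fix m n
  show "dpair \<gamma>b \<gamma> \<delta> \<delta>' \<eta> \<eta>' (dpair \<gamma> \<gamma>b \<delta> \<delta>' \<eta> \<eta>' \<mu>) m n = \<mu> m n"
    unfolding dpair_def[of \<gamma>b \<gamma>]
      tensor_lift_dpair[OF assms(3) clinear_cocycle bicomodD(6,7)[OF assms(1)] bicomodD(6,7)[OF assms(2)]]
      twist_twist[OF bicomod_tens[OF assms(1,2)] clinear_cocycle(2,1) inverse]
    by (rule tensor_lift_pure[OF assms(3)])
qed

section \<open>The deformed bialgebra and its inverse cocycle\<close>

definition "\<kappa>\<gamma> = dpair \<gamma> \<gamma>b \<Delta> \<Delta>' \<Delta> \<Delta>' \<kappa>"

lemma tensor_lift_deformed_mult: "tensor_lift \<kappa>\<gamma> t = tensor_lift \<kappa> (twist \<gamma> \<gamma>b \<Delta>2 (tens \<Delta>' \<Delta>') t)"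
  unfolding \<kappa>\<gamma>_def
  by (rule tensor_lift_dpair[OF mult_bilin clinear_cocycle clinear_comult clinear_comult' clinear_comult clinear_comult'])

lemma cbilinear_deformed_mult: "cbilinear \<kappa>\<gamma>"
  unfolding \<kappa>\<gamma>_def
  by (rule cbilinear_dpair[OF mult_bilin clinear_cocycle clinear_comult clinear_comult' clinear_comult clinear_comult'])

lemma deformed_bialgebra: "bialgebra \<kappa>\<gamma> u \<Delta> \<epsilon>"
proof
  show "cbilinear \<kappa>\<gamma>" by (rule cbilinear_deformed_mult)
  show "\<kappa>\<gamma> (\<kappa>\<gamma> a b) c = \<kappa>\<gamma> a (\<kappa>\<gamma> b c)" for a b c
    unfolding \<kappa>\<gamma>_def
    by (rule dpair_assoc[OF self self self clinear_comult clinear_comult' clinear_comult clinear_comult'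
          mult_bilin comult_mult comult_mult_flip mult_bilin comult_mult comult_mult_flip
          mult_bilin mult_bilin mult_assoc])
  show "\<kappa>\<gamma> u a = a" "\<kappa>\<gamma> a u = a" for a
    unfolding \<kappa>\<gamma>_def
    by (simp_all add: dpair_unit[OF self] unit_left unit_right mult_bilin)
  show "bicomod \<Delta> \<epsilon> \<Delta> \<Delta>'" by (rule self)
  show "colin \<kappa>\<gamma> \<Delta> \<Delta> \<Delta> \<kappa>\<gamma>"
    unfolding \<kappa>\<gamma>_def
    by (rule dpair_colin_left[OF self self clinear_comult mult_bilin comult_mult])
  show "\<Delta> u = u \<otimes> u" "\<epsilon> u = 1" by (rule comult_unit counit_unit)+
  fix a b
  note l = clinear_func_tens[OF clinear_counit clinear_counit]
  \<comment> \<open>Under the counit the twist turns into the convolution \<gamma> * \<epsilon>2 *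
    \<gamma>b, which is \<epsilon>2.\<close>
  have "\<epsilon> (\<kappa>\<gamma> a b) = \<epsilon>2 (lop \<Delta>2 \<gamma> (lop (tens \<Delta>' \<Delta>') \<gamma>b (a \<otimes> b)))"
    unfolding \<kappa>\<gamma>_def dpair_def twist_sym[OF bicomod_self2 clinear_cocycle]
    by (simp add: counit_mult_lift twist_def)
  also have "\<dots> = conv \<Delta>2 (conv \<Delta>2 \<gamma> \<epsilon>2) \<gamma>b (a \<otimes> b)"
    by (simp add: conv_lop[OF l] conv_lop'[OF clinear_conv clinear_cocycle(2)] l clinear_tens
        clinear_comult clinear_cocycle flip_comult2)
  also have "\<dots> = \<epsilon> a * \<epsilon> b"
    using conv_counit_right[of \<Delta>2 \<epsilon>2 \<gamma>] comod_tens[OF comod_self' comod_self']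
    by (simp add: flip_comult2 clinear_cocycle inverse clinear_counit)
  finally show "\<epsilon> (\<kappa>\<gamma> a b) = \<epsilon> a * \<epsilon> b" .
qed

text \<open>The left operator of \<gamma>b cancels the \<gamma> inside the deformed product and
  leaves only its right-hand factor \<gamma>b; what has to be checked is then
  \<open>cocycle_inverse\<close>. This instance makes it possible to deform back.\<close>

lemma deformed_cocycle: "cocycle \<kappa>\<gamma> u \<Delta> \<epsilon> \<gamma>b \<gamma>"
proof -
  interpret d: bialgebra \<kappa>\<gamma> u \<Delta> \<epsilon> by (rule deformed_bialgebra)
  have *: "tensor_lift \<kappa>\<gamma> (lop \<Delta>2 \<gamma>b t) = tensor_lift \<kappa> (lop (tens \<Delta>' \<Delta>') \<gamma>b t)" for t
    by (simp add: tensor_lift_deformed_mult twist_def lop_lop[OF bicomodD(1)[OF bicomod_self2]]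
        clinear_cocycle inverse comodD(4)[OF bicomodD(1)[OF bicomod_self2]])
  show ?thesis
    by (rule cocycle.intro[OF deformed_bialgebra], rule cocycle_axioms.intro)
      (simp_all add: clinear_cocycle inverse inverse_unit * cocycle_inverse)
qed

end

section \<open>Antipodes\<close>

lemma counit_lift: "comod \<Delta> \<epsilon> \<delta> \<Longrightarrow> clinear h \<Longrightarrow> (\<ointegral>c x\<leftarrow>\<delta> m. \<epsilon> c *\<^sub>C h x) = h m"
  using clinear_tensor_lift_pull[of h "\<lambda>c x. \<epsilon> c *\<^sub>C x" "\<delta> m"] comodD(4)[of \<Delta> \<epsilon> \<delta> m]
  by (simp add: lop_def clinear_scale)

lemma counit_lift_right:
  assumes "comod (flip \<circ> \<Delta>) \<epsilon> (flip \<circ> \<Delta>)" "clinear h"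
  shows "(\<ointegral>x y\<leftarrow>\<Delta> m. \<epsilon> y *\<^sub>C h x) = h m"
  using clinear_tensor_lift_pull[OF assms(2), of "\<lambda>x y. \<epsilon> y *\<^sub>C x" "\<Delta> m"] comodD(2,4)[OF assms(1)]
  by (simp add: lop_flip clinear_scale[OF assms(2)])

text \<open>Regroups four consecutive legs so that the two middle ones come from a single coproduct,
  where an antipode can contract them.\<close>

lemma coassoc4:
  assumes "comod \<Delta> \<epsilon> \<delta>"
    and "\<And>b c d. clinear (\<lambda>a. G a b c d)" "\<And>a c d. clinear (\<lambda>b. G a b c d)"
      "\<And>a b d. clinear (\<lambda>c. G a b c d)" "\<And>a b c. clinear (G a b c)"
  shows "(\<ointegral>x y\<leftarrow>\<delta> t. \<ointegral>a b\<leftarrow>\<Delta> x. \<ointegral>c d\<leftarrow>\<delta> y. G a b c d)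
    = (\<ointegral>a z\<leftarrow>\<delta> t. \<ointegral>w d\<leftarrow>\<delta> z. \<ointegral>b c\<leftarrow>\<Delta> w. G a b c d)"
proof -
  note [lin] = comodD(1,3)[OF assms(1), THEN clinear_compose]
  have bil: "cbilinear (G a b)" for a b
    by (intro cbilinearI assms(2-))
  have "(\<ointegral>x y\<leftarrow>\<delta> t. \<ointegral>a b\<leftarrow>\<Delta> x. \<ointegral>c d\<leftarrow>\<delta> y. G a b c d)
      = (\<ointegral>a z\<leftarrow>\<delta> t. \<ointegral>b y\<leftarrow>\<delta> z. \<ointegral>c d\<leftarrow>\<delta> y. G a b c d)"
    by (rule comod_coassoc[OF assms(1), symmetric]) (intro ctrilinearI lin assms(2-) bil)
  also have "\<dots> = (\<ointegral>a z\<leftarrow>\<delta> t. \<ointegral>w d\<leftarrow>\<delta> z. \<ointegral>b c\<leftarrow>\<Delta> w. G a b c d)"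
    by (subst comod_coassoc[OF assms(1)]) (intro ctrilinearI assms(2-), rule refl)
  finally show ?thesis .
qed

text \<open>\<open>f\<close> is a left and \<open>h\<close> a right inverse of \<open>g\<close> in
  the convolution algebra of maps from a coalgebra to an algebra. It identifies the antipode on
  products and its coproduct.\<close>

lemma convolution_inverse_unique:
  assumes C: "comod \<Delta> \<epsilon> \<Delta>" "comod (flip \<circ> \<Delta>) \<epsilon> (flip \<circ> \<Delta>)"
    and \<kappa>: "cbilinear \<kappa>" "\<And>x y z. \<kappa> (\<kappa> x y) z = \<kappa> x (\<kappa> y z)" "\<And>x. \<kappa> w x = x" "\<And>x. \<kappa> x w = x"
    and fgh: "clinear f" "clinear g" "clinear h"
    and inv: "\<And>t. (\<ointegral>x y\<leftarrow>\<Delta> t. \<kappa> (f x) (g y)) = \<epsilon> t *\<^sub>C w" "\<And>t. (\<ointegral>x y\<leftarrow>\<Delta> t. \<kappa> (g x) (h y)) = \<epsilon> t *\<^sub>C w"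
  shows "f t = h t"
proof -
  note [lin] = fgh[THEN clinear_compose] bilinear_lin(1,2)[OF \<kappa>(1)]
  have "f t = (\<ointegral>x y\<leftarrow>\<Delta> t. \<kappa> (f x) (\<ointegral>y1 y2\<leftarrow>\<Delta> y. \<kappa> (g y1) (h y2)))"
    by (simp add: inv \<kappa> bilinear_scale[OF \<kappa>(1)] counit_lift_right[OF C(2) fgh(1)])
  also have "\<dots> = (\<ointegral>x y\<leftarrow>\<Delta> t. \<ointegral>y1 y2\<leftarrow>\<Delta> y. \<kappa> (\<kappa> (f x) (g y1)) (h y2))"
    by (simp only: bilinear_tensor_lift[OF \<kappa>(1)] \<kappa>(2))
  also have "\<dots> = (\<ointegral>x y\<leftarrow>\<Delta> t. \<ointegral>x1 x2\<leftarrow>\<Delta> x. \<kappa> (\<kappa> (f x1) (g x2)) (h y))"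
    by (rule comod_coassoc[OF C(1)]) (intro ctrilinearI lin)
  also have "\<dots> = (\<ointegral>x y\<leftarrow>\<Delta> t. \<kappa> (\<ointegral>x1 x2\<leftarrow>\<Delta> x. \<kappa> (f x1) (g x2)) (h y))"
    by (simp only: bilinear_tensor_lift[OF \<kappa>(1)])
  also have "\<dots> = h t"
    by (simp add: inv \<kappa> bilinear_scale[OF \<kappa>(1)] counit_lift[OF C(1) fgh(3)])
  finally show ?thesis .
qed

lemma cbilinear_tensor_map2:
  assumes "cbilinear p" "cbilinear q"
  shows "cbilinear (tensor_map2 p q)"
proof -
  note [lin] = bilinear_lin(1,2)[OF assms(1)] bilinear_lin(1,2)[OF assms(2)]
  show ?thesis
    unfolding tensor_map2_def[abs_def] by (intro cbilinearI lin)
qed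

lemma tensor_map2_pure:
  assumes "cbilinear p" "cbilinear q"
  shows "tensor_map2 p q (a \<otimes> b) (c \<otimes> d) = p a c \<otimes> q b d"
proof -
  note [lin] = bilinear_lin(1,2)[OF assms(1)] bilinear_lin(1,2)[OF assms(2)]
  show ?thesis
    unfolding tensor_map2_def
    by (subst tensor_lift_pure, intro cbilinearI lin, subst tensor_lift_pure) (intro cbilinearI lin, rule refl)
qed

locale hopf = bialgebra +
  fixes S :: "'a \<Rightarrow> 'a"
  assumes clinear_antipode: "clinear S"
    and antipode_left: "(\<ointegral>a b\<leftarrow>\<Delta> c. \<kappa> (S a) b) = \<epsilon> c *\<^sub>C u"
    and antipode_right: "(\<ointegral>a b\<leftarrow>\<Delta> c. \<kappa> a (S b)) = \<epsilon> c *\<^sub>C u"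
begin

lemmas antipode_lin [lin] = clinear_compose[OF clinear_antipode]

lemma antipode_unit: "S u = u"
proof -
  have "(\<ointegral>a b\<leftarrow>\<Delta> u. \<kappa> (S a) b) = \<kappa> (S u) u"
    unfolding comult_unit by (rule tensor_lift_pure) (intro cbilinearI lin)
  then show ?thesis by (simp add: antipode_left counit_unit scaleC_one unit_right)
qed

lemma counit_antipode: "\<epsilon> (S a) = \<epsilon> a"
proof -
  have "\<epsilon> a = \<epsilon> (\<ointegral>a b\<leftarrow>\<Delta> a. \<kappa> (S a) b)"
    by (simp add: antipode_left clinear_scale[OF clinear_counit] counit_unit scaleC_complex_def)
  also have "\<dots> = (\<ointegral>a b\<leftarrow>\<Delta> a. \<epsilon> b *\<^sub>C \<epsilon> (S a))"
    by (simp add: clinear_tensor_lift_pull[OF clinear_counit] counit_mult scaleC_complex_def mult.commute)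
  also have "\<dots> = \<epsilon> (S a)"
    by (rule counit_lift_right[OF comod_self']) (intro lin clinear_counit)
  finally show ?thesis by simp
qed

text \<open>In the convolution algebra of maps from A \<otimes> A to A, the left-hand side is a left
  inverse of the product and the right-hand side a right inverse.\<close>

lemma antipode_mult: "S (\<kappa> a b) = \<kappa> (S b) (S a)"
proof -
  define h where "h t = (\<ointegral>a b\<leftarrow>t. \<kappa> (S b) (S a))" for t
  have h: "clinear h" "h (a \<otimes> b) = \<kappa> (S b) (S a)" for a b
    unfolding h_def by (intro cbilinearI lin, rule tensor_lift_pure) (intro cbilinearI lin)
  note [lin] = clinear_compose[OF h(1)]
  have 1: "(\<ointegral>x y\<leftarrow>\<Delta>2 t. \<kappa> (S (tensor_lift \<kappa> x)) (tensor_lift \<kappa> y)) = \<epsilon>2 t *\<^sub>C u" for t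
  proof -
    have "(\<ointegral>x y\<leftarrow>\<Delta>2 t. \<kappa> (S (tensor_lift \<kappa> x)) (tensor_lift \<kappa> y))
        = (\<ointegral>x y\<leftarrow>tensor_map (tensor_lift \<kappa>) (tensor_lift \<kappa>) (\<Delta>2 t). \<kappa> (S x) y)"
      by (rule tensor_lift_tensor_map[symmetric]) (intro cbilinearI lin mult_bilin clinear_tensor_lift)+
    also have "\<dots> = (\<ointegral>x y\<leftarrow>\<Delta> (tensor_lift \<kappa> t). \<kappa> (S x) y)"
      using comult_mult colin_iff[OF mult_bilin mult_bilin clinear_comult clinear_comult clinear_comult]
      by (simp add: comod_map_def)
    finally show ?thesis by (simp add: antipode_left counit_mult_lift)
  qed
  have 2: "(\<ointegral>x y\<leftarrow>\<Delta>2 t. \<kappa> (tensor_lift \<kappa> x) (h y)) = \<epsilon>2 t *\<^sub>C u" for t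
  proof (rule tensor_eqI[where f = "\<lambda>t. \<ointegral>x y\<leftarrow>\<Delta>2 t. \<kappa> (tensor_lift \<kappa> x) (h y)"])
    show "clinear (\<lambda>t. \<ointegral>x y\<leftarrow>\<Delta>2 t. \<kappa> (tensor_lift \<kappa> x) (h y))"
      by (intro lin cbilinearI mult_bilin clinear_tens clinear_comult)
    show "clinear (\<lambda>t. \<epsilon>2 t *\<^sub>C u)"
      by (intro lin clinear_func_tens clinear_counit)
    fix a b
    have "(\<ointegral>x y\<leftarrow>\<Delta>2 (a \<otimes> b). \<kappa> (tensor_lift \<kappa> x) (h y))
        = (\<ointegral>a1 a2\<leftarrow>\<Delta> a. \<ointegral>b1 b2\<leftarrow>\<Delta> b. \<kappa> (\<kappa> a1 b1) (\<kappa> (S b2) (S a2)))"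
      by (subst tensor_lift_tens[OF _ clinear_comult clinear_comult])
        (intro cbilinearI lin mult_bilin, simp add: tensor_lift_pure mult_bilin h)
    also have "\<dots> = (\<ointegral>a1 a2\<leftarrow>\<Delta> a. \<ointegral>b1 b2\<leftarrow>\<Delta> b. \<kappa> a1 (\<kappa> (\<kappa> b1 (S b2)) (S a2)))"
      by (simp add: mult_assoc)
    also have "\<dots> = (\<ointegral>a1 a2\<leftarrow>\<Delta> a. \<kappa> a1 (\<kappa> (\<ointegral>b1 b2\<leftarrow>\<Delta> b. \<kappa> b1 (S b2)) (S a2)))"
      by (simp only: bilinear_tensor_lift[OF mult_bilin])
    also have "\<dots> = \<epsilon> b *\<^sub>C (\<ointegral>a1 a2\<leftarrow>\<Delta> a. \<kappa> a1 (S a2))"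
      by (simp add: antipode_right unit_left bilinear_scale[OF mult_bilin] tensor_lift_scale_inner)
    also have "\<dots> = \<epsilon>2 (a \<otimes> b) *\<^sub>C u"
      by (simp add: antipode_right clinear_counit scaleC_scaleC mult.commute)
    finally show "(\<ointegral>x y\<leftarrow>\<Delta>2 (a \<otimes> b). \<kappa> (tensor_lift \<kappa> x) (h y)) = \<epsilon>2 (a \<otimes> b) *\<^sub>C u" .
  qed
  have "S (tensor_lift \<kappa> (a \<otimes> b)) = h (a \<otimes> b)"
    by (rule convolution_inverse_unique[OF bicomodD(1)[OF bicomod_self2] _ mult_bilin mult_assoc
          unit_left unit_right _ clinear_tensor_lift[OF mult_bilin] h(1) 1 2])
      (auto simp: flip_comult2 intro!: comod_tens comod_self' lin mult_bilin clinear_tensor_lift)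
  then show ?thesis by (simp add: h(2) tensor_lift_pure mult_bilin)
qed

text \<open>The argument of \<open>antipode_mult\<close> in the convolution algebra of maps from A
  to A \<otimes> A, where both sides invert \<open>\<Delta>\<close>.\<close>

lemma comult_antipode: "\<Delta> (S c) = (\<ointegral>x y\<leftarrow>\<Delta> c. S y \<otimes> S x)"
proof (rule convolution_inverse_unique[OF comod_self comod_self', where \<kappa> = "tensor_map2 \<kappa> \<kappa>" and w = "u \<otimes> u"
      and f = "\<lambda>c. \<Delta> (S c)" and h = "\<lambda>c. \<ointegral>x y\<leftarrow>\<Delta> c. S y \<otimes> S x" and g = \<Delta>])
  let ?K = "tensor_map2 \<kappa> \<kappa>"
  show K: "cbilinear ?K" by (intro cbilinear_tensor_map2 mult_bilin)
  note [lin] = bilinear_lin(1,2)[OF K]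
  note pure = tensor_map2_pure[OF mult_bilin mult_bilin]
  show "?K (?K r s) t = ?K r (?K s t)" for r s t
  proof (rule tensor_eqI[where f = "\<lambda>r. ?K (?K r s) t" and g = "\<lambda>r. ?K r (?K s t)"])
    fix a b
    show "?K (?K (a \<otimes> b) s) t = ?K (a \<otimes> b) (?K s t)"
    proof (rule tensor_eqI[where f = "\<lambda>s. ?K (?K (a \<otimes> b) s) t" and g = "\<lambda>s. ?K (a \<otimes> b) (?K s t)"])
      fix c d
      show "?K (?K (a \<otimes> b) (c \<otimes> d)) t = ?K (a \<otimes> b) (?K (c \<otimes> d) t)"
        by (rule tensor_eqI[where f = "\<lambda>t. ?K (?K (a \<otimes> b) (c \<otimes> d)) t" and g = "\<lambda>t. ?K (a \<otimes> b) (?K (c \<otimes> d) t)"])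
          (simp_all add: lin bilinear_lin(3)[OF K] pure mult_assoc)
    qed (intro lin)+
  qed (intro lin)+
  show "?K (u \<otimes> u) t = t" "?K t (u \<otimes> u) = t" for t
    by (rule tensor_eqI[where f = "\<lambda>t. ?K (u \<otimes> u) t" and g = "\<lambda>t. t"]
        tensor_eqI[where f = "\<lambda>t. ?K t (u \<otimes> u)" and g = "\<lambda>t. t"];
        (intro lin | simp add: pure unit_left unit_right bilinear_lin(3)[OF K]))+
  show "clinear (\<lambda>c. \<Delta> (S c))" "clinear \<Delta>" "clinear (\<lambda>c. \<ointegral>x y\<leftarrow>\<Delta> c. S y \<otimes> S x)"
    by (intro lin cbilinearI clinear_comult)+
  show "(\<ointegral>x y\<leftarrow>\<Delta> t. ?K (\<Delta> (S x)) (\<Delta> y)) = \<epsilon> t *\<^sub>C (u \<otimes> u)" for t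
    using comult_mult clinear_tensor_lift_pull[OF clinear_comult, of "\<lambda>x y. \<kappa> (S x) y" "\<Delta> t", symmetric]
    by (simp add: colin_def antipode_left clinear_scale[OF clinear_comult] comult_unit)
  show "(\<ointegral>x y\<leftarrow>\<Delta> t. ?K (\<Delta> x) (\<ointegral>x y\<leftarrow>\<Delta> y. S y \<otimes> S x)) = \<epsilon> t *\<^sub>C (u \<otimes> u)" for t
  proof -
    have "?K (\<Delta> x) (\<ointegral>c d\<leftarrow>\<Delta> y. S d \<otimes> S c) = (\<ointegral>a b\<leftarrow>\<Delta> x. \<ointegral>c d\<leftarrow>\<Delta> y. \<kappa> a (S d) \<otimes> \<kappa> b (S c))" for x y
      unfolding tensor_map2_def
      by (subst tensor_lift_bind, intro cbilinearI lin, subst tensor_lift_pure) (intro cbilinearI lin, rule refl)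
    then have "(\<ointegral>x y\<leftarrow>\<Delta> t. ?K (\<Delta> x) (\<ointegral>x y\<leftarrow>\<Delta> y. S y \<otimes> S x))
        = (\<ointegral>x y\<leftarrow>\<Delta> t. \<ointegral>a b\<leftarrow>\<Delta> x. \<ointegral>c d\<leftarrow>\<Delta> y. \<kappa> a (S d) \<otimes> \<kappa> b (S c))"
      by simp
    also have "\<dots> = (\<ointegral>a z\<leftarrow>\<Delta> t. \<ointegral>w d\<leftarrow>\<Delta> z. \<ointegral>b c\<leftarrow>\<Delta> w. \<kappa> a (S d) \<otimes> \<kappa> b (S c))"
      by (rule coassoc4[OF comod_self]) (intro lin)+
    also have "\<dots> = (\<ointegral>a z\<leftarrow>\<Delta> t. \<ointegral>w d\<leftarrow>\<Delta> z. \<epsilon> w *\<^sub>C (\<kappa> a (S d) \<otimes> u))"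
      by (simp only: tensor_lift_pure_right[symmetric] antipode_right scale_pure)
    also have "\<dots> = (\<ointegral>a z\<leftarrow>\<Delta> t. \<kappa> a (S z) \<otimes> u)"
      by (subst counit_lift[OF comod_self]) (intro lin, rule refl)
    also have "\<dots> = \<epsilon> t *\<^sub>C (u \<otimes> u)"
      by (simp only: tensor_lift_pure_left[symmetric] antipode_right scale_pure)
    finally show ?thesis .
  qed
qed

text \<open>In terms of operators: a left operator applied to a value of \<open>S\<close> is a right
  operator applied to its argument, and conversely.\<close>

lemma comod_map_antipode: "comod_map \<Delta>' \<Delta> S S" "comod_map \<Delta> \<Delta>' S S"
proof -
  have "tensor_map S S (flip (\<Delta> c)) = \<Delta> (S c)" for c
    unfolding comult_antipode tensor_map_def
    by (rule tensor_lift_flip) (intro cbilinearI lin)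
  then show 1: "comod_map \<Delta>' \<Delta> S S"
    by (simp add: comod_map_def clinear_antipode)
  have "flip (\<Delta> (S c)) = tensor_map S S (\<Delta> c)" for c
    unfolding comult_antipode flip_def tensor_map_def
    by (subst tensor_lift_bind, intro cbilinearI lin, subst tensor_lift_pure) (intro cbilinearI lin, rule refl)
  then show "comod_map \<Delta> \<Delta>' S S"
    by (simp add: comod_map_def clinear_antipode)
qed

end

section \<open>The antipode of the deformed algebra\<close>

locale hopf_cocycle = hopf \<kappa> u \<Delta> \<epsilon> S + cocycle \<kappa> u \<Delta> \<epsilon> \<gamma> \<gamma>b
  for \<kappa> :: "'a::complex_vector \<Rightarrow> 'a \<Rightarrow> 'a" and u \<Delta> \<epsilon> S \<gamma> \<gamma>b
begin

definition "U c = (\<ointegral>x y\<leftarrow>\<Delta> c. \<gamma> (x \<otimes> S y))"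
definition "V c = (\<ointegral>x y\<leftarrow>\<Delta> c. \<gamma>b (S x \<otimes> y))"

lemma clinear_UV: "clinear U" "clinear V"
  unfolding U_def[abs_def] V_def[abs_def] by (intro lin cbilinearI clinear_comult)+

lemmas UV_lin [lin] = clinear_UV[THEN clinear_compose]

abbreviation "SL \<equiv> tensor_map S id"
abbreviation "SR \<equiv> tensor_map id S"

lemma SL_pure: "SL (a \<otimes> b) = S a \<otimes> b" and SR_pure: "SR (a \<otimes> b) = a \<otimes> S b"
  by (simp_all add: tensor_map_pure clinear_antipode clinear_id)

lemma clinear_SLR: "clinear SL" "clinear SR"
  by (intro clinear_tensor_map clinear_antipode clinear_id)+

lemmas SLR_lin [lin] = clinear_SLR[THEN clinear_compose]

text \<open>\<open>S\<close> exchanges left and right in one slot only, so mixed coactions such as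
  \<open>tens \<Delta>' \<Delta>\<close> appear.\<close>

lemma comod_map_SL: "comod_map (tens \<Delta>' \<Delta>) \<Delta>2 SL SL" "comod_map (tens \<Delta> \<Delta>') (tens \<Delta>' \<Delta>') SL SL"
  and comod_map_SR: "comod_map (tens \<Delta> \<Delta>') \<Delta>2 SR SR" "comod_map (tens \<Delta>' \<Delta>) (tens \<Delta>' \<Delta>') SR SR"
  by (intro comod_map_tens comod_map_antipode comod_map_id clinear_comult clinear_comult')+

lemma counit_SLR: "\<epsilon>2 (SL t) = \<epsilon>2 t" "\<epsilon>2 (SR t) = \<epsilon>2 t"
  by (rule tensor_eqI[where g = \<epsilon>2 and f = "\<lambda>t. \<epsilon>2 (SL t)"]
      tensor_eqI[where g = \<epsilon>2 and f = "\<lambda>t. \<epsilon>2 (SR t)"];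
      simp add: clinear_compose clinear_SLR clinear_func_tens clinear_counit SL_pure SR_pure
        counit_antipode)+

lemma conv_SL: "conv (tens \<Delta>' \<Delta>) (\<lambda>t. \<gamma>b (SL t)) (\<lambda>t. \<gamma> (SL t)) = \<epsilon>2"
  unfolding conv_comod_map[OF comod_map_SL(1) clinear_cocycle(2,1)] inverse by (rule ext, rule counit_SLR)

lemma conv_SR: "conv (tens \<Delta> \<Delta>') (\<lambda>t. \<gamma>b (SR t)) (\<lambda>t. \<gamma> (SR t)) = \<epsilon>2"
  unfolding conv_comod_map[OF comod_map_SR(1) clinear_cocycle(2,1)] inverse by (rule ext, rule counit_SLR)

lemma counit2_comult: "\<epsilon>2 (\<Delta> a) = \<epsilon> a"
  using counit_lift[OF comod_self clinear_counit, of a]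
  by (simp add: func_tens_def scaleC_complex_def)

lemma counit_mult_lift_fun: "clinear h \<Longrightarrow> (\<ointegral>x y\<leftarrow>\<Delta> a. \<epsilon> x * h y) = h a"
  using counit_lift[OF comod_self, of h a] by (simp add: scaleC_complex_def)

text \<open>The cocycle identity at the arguments a_1, S(a_2), c. On the side that multiplies the
  first two arguments, the inner product a_2 S(a_3) contracts to the counit, and \<gamma>(a_1
  \<otimes> S(a_4)) is left, which becomes U(a).\<close>

lemma cocycle_antipode: "(\<ointegral>p q\<leftarrow>\<Delta> a. \<ointegral>a1 a2\<leftarrow>\<Delta> p. \<ointegral>c1 c2\<leftarrow>\<Delta> c. \<gamma> (S q \<otimes> c1) * \<gamma> (a1 \<otimes> \<kappa> (S a2) c2))
    = U a * \<epsilon> c"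
proof -
  have 1: "lop \<Delta>2 \<gamma> (S b \<otimes> c) = (\<ointegral>b1 b2\<leftarrow>\<Delta> b. \<ointegral>c1 c2\<leftarrow>\<Delta> c. \<gamma> (S b2 \<otimes> c1) *\<^sub>C (S b1 \<otimes> c2))" for b
    unfolding lop_tens_pure[OF clinear_cocycle(1) clinear_comult clinear_comult] comult_antipode
    by (subst tensor_lift_bind, intro cbilinearI lin, subst tensor_lift_pure) (intro cbilinearI lin, rule refl)
  have 2: "lop \<Delta>2 \<gamma> (a \<otimes> S b) = (\<ointegral>a1 a2\<leftarrow>\<Delta> a. \<ointegral>b1 b2\<leftarrow>\<Delta> b. \<gamma> (a1 \<otimes> S b2) *\<^sub>C (a2 \<otimes> S b1))" for a b
    unfolding lop_tens_pure[OF clinear_cocycle(1) clinear_comult clinear_comult] comult_antipode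
    by (subst tensor_lift_bind, intro cbilinearI lin, subst tensor_lift_pure) (intro cbilinearI lin, rule refl)
  have g: "clinear (\<lambda>t. \<gamma> (x \<otimes> tensor_lift \<kappa> t))" "clinear (\<lambda>t. \<gamma> (tensor_lift \<kappa> t \<otimes> x))" for x
    by (intro lin mult_bilin)+
  have "(\<ointegral>p q\<leftarrow>\<Delta> a. \<ointegral>a1 a2\<leftarrow>\<Delta> p. \<ointegral>c1 c2\<leftarrow>\<Delta> c. \<gamma> (S q \<otimes> c1) * \<gamma> (a1 \<otimes> \<kappa> (S a2) c2))
      = (\<ointegral>x y\<leftarrow>\<Delta> a. \<ointegral>a1 a2\<leftarrow>\<Delta> y. \<ointegral>c1 c2\<leftarrow>\<Delta> c. \<gamma> (S a2 \<otimes> c1) * \<gamma> (x \<otimes> \<kappa> (S a1) c2))"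
    by (rule comod_coassoc[OF comod_self, symmetric]) (intro ctrilinearI lin)
  also have "\<dots> = (\<ointegral>x y\<leftarrow>\<Delta> a. \<gamma> (x \<otimes> tensor_lift \<kappa> (lop \<Delta>2 \<gamma> (S y \<otimes> c))))"
    unfolding 1
    by (simp only: clinear_tensor_lift_pull[OF g(1)] clinear_scale[OF g(1)] scaleC_complex_def
        tensor_lift_pure[OF mult_bilin])
  also have "\<dots> = (\<ointegral>x y\<leftarrow>\<Delta> a. \<gamma> (tensor_lift \<kappa> (lop \<Delta>2 \<gamma> (x \<otimes> S y)) \<otimes> c))"
    by (simp only: cocycle)
  also have "\<dots> = (\<ointegral>x y\<leftarrow>\<Delta> a. \<ointegral>a b\<leftarrow>\<Delta> x. \<ointegral>d e\<leftarrow>\<Delta> y. \<gamma> (a \<otimes> S e) * \<gamma> (\<kappa> b (S d) \<otimes> c))"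
    unfolding 2
    by (simp only: clinear_tensor_lift_pull[OF g(2)] clinear_scale[OF g(2)] scaleC_complex_def
        tensor_lift_pure[OF mult_bilin])
  also have "\<dots> = (\<ointegral>x z\<leftarrow>\<Delta> a. \<ointegral>w e\<leftarrow>\<Delta> z. \<ointegral>b d\<leftarrow>\<Delta> w. \<gamma> (x \<otimes> S e) * \<gamma> (\<kappa> b (S d) \<otimes> c))"
    by (rule coassoc4[OF comod_self]) (intro lin)+
  also have "\<dots> = (\<ointegral>x z\<leftarrow>\<Delta> a. \<ointegral>w e\<leftarrow>\<Delta> z. \<gamma> (x \<otimes> S e) * \<gamma> ((\<ointegral>b d\<leftarrow>\<Delta> w. \<kappa> b (S d)) \<otimes> c))"
    by (simp only: tensor_lift_pure_left clinear_tensor_lift_pull[OF clinear_cocycle(1)] tensor_lift_mult_right)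
  also have "\<dots> = (\<ointegral>x z\<leftarrow>\<Delta> a. \<ointegral>w e\<leftarrow>\<Delta> z. \<epsilon> w * (\<gamma> (x \<otimes> S e) * \<epsilon> c))"
    by (simp add: antipode_right scale_pure clinear_scale[OF clinear_cocycle(1)] cocycle_unit
        scaleC_complex_def mult_ac)
  also have "\<dots> = (\<ointegral>x z\<leftarrow>\<Delta> a. \<gamma> (x \<otimes> S z) * \<epsilon> c)"
    by (subst counit_mult_lift_fun) (intro lin, rule refl)
  finally show ?thesis by (simp add: U_def tensor_lift_mult_left)
qed

text \<open>Cancelling the first factor \<open>\<gamma>\<close> in \<open>cocycle_antipode\<close> gives
  \<open>\<gamma>(a\<^sub>(\<^sub>1\<^sub>) \<otimes> S(a\<^sub>(\<^sub>2\<^sub>)) c) = U(a\<^sub>(\<^sub>1\<^sub>)) \<gamma>b(S(a\<^sub>(\<^sub>2\<^sub>)) \<otimes> c)\<close>; then take \<open>c = a\<^sub>(\<^sub>3\<^sub>)\<close>.\<close>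

lemma conv_UV: "conv \<Delta> U V = \<epsilon>"
proof (rule ext)
  fix a
  let ?D = "tens \<Delta>' \<Delta>"
  have D: "comod ?D \<epsilon>2 ?D" by (rule comod_tens[OF comod_self' comod_self])
  \<comment> \<open>\<open>H\<close> is the second cocycle factor of
    \<open>cocycle_antipode\<close>. Its convolution with \<gamma> composed with \<open>SL\<close>
    is therefore known, and the inverse of that factor solves the equation for
    \<open>H\<close>.\<close>
  define H where "H t = (\<ointegral>a c\<leftarrow>t. \<ointegral>a1 a2\<leftarrow>\<Delta> a. \<gamma> (a1 \<otimes> \<kappa> (S a2) c))" for t
  have H: "clinear H" "H (a \<otimes> c) = (\<ointegral>a1 a2\<leftarrow>\<Delta> a. \<gamma> (a1 \<otimes> \<kappa> (S a2) c))" for a c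
    unfolding H_def[abs_def] by (intro lin cbilinearI, rule tensor_lift_pure) (intro lin cbilinearI)
  note [lin] = clinear_compose[OF H(1)]
  have l: "clinear (\<lambda>t. \<gamma> (SL t))" "clinear (\<lambda>t. \<gamma>b (SL t))" "clinear (func_tens U \<epsilon>)" "clinear ?D"
    by (intro lin clinear_SLR clinear_func_tens clinear_UV clinear_counit clinear_tens clinear_comult clinear_comult')+
  have "conv ?D (\<lambda>t. \<gamma> (SL t)) H = func_tens U \<epsilon>"
  proof (rule ext, rule tensor_eqI)
    fix a c
    have "conv ?D (\<lambda>t. \<gamma> (SL t)) H (a \<otimes> c)
        = (\<ointegral>q p\<leftarrow>\<Delta>' a. \<ointegral>c1 c2\<leftarrow>\<Delta> c. \<gamma> (S q \<otimes> c1) * H (p \<otimes> c2))"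
      unfolding conv_def
      by (subst tensor_lift_tens[OF _ clinear_comult' clinear_comult])
        (intro lin cbilinearI clinear_SLR, simp add: SL_pure)
    also have "\<dots> = (\<ointegral>p q\<leftarrow>\<Delta> a. \<ointegral>c1 c2\<leftarrow>\<Delta> c. \<gamma> (S q \<otimes> c1) * H (p \<otimes> c2))"
      unfolding comp_def by (rule tensor_lift_flip) (intro lin cbilinearI)
    also have "\<dots> = (\<ointegral>p q\<leftarrow>\<Delta> a. \<ointegral>c1 c2\<leftarrow>\<Delta> c. \<ointegral>a1 a2\<leftarrow>\<Delta> p. \<gamma> (S q \<otimes> c1) * \<gamma> (a1 \<otimes> \<kappa> (S a2) c2))"
      by (simp only: H(2) tensor_lift_mult_right)
    also have "\<dots> = U a * \<epsilon> c"
      unfolding cocycle_antipode[symmetric] by (subst tensor_lift_swap) (rule refl)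
    finally show "conv ?D (\<lambda>t. \<gamma> (SL t)) H (a \<otimes> c) = func_tens U \<epsilon> (a \<otimes> c)"
      by (simp add: clinear_UV clinear_counit)
  qed (intro l clinear_conv H)+
  then have "H = conv ?D (\<lambda>t. \<gamma>b (SL t)) (func_tens U \<epsilon>)"
    using conv_assoc[OF D l(2,1) H(1)] by (simp add: conv_SL conv_counit_left[OF D H(1)])
  then have "H (\<Delta> a) = conv ?D (\<lambda>t. \<gamma>b (SL t)) (func_tens U \<epsilon>) (\<Delta> a)"
    by simp
  also have "conv ?D (\<lambda>t. \<gamma>b (SL t)) (func_tens U \<epsilon>) t = (\<ointegral>x c\<leftarrow>t. \<ointegral>p q\<leftarrow>\<Delta> x. U p * \<gamma>b (S q \<otimes> c))" for t
  proof (rule tensor_eqI[where g = "\<lambda>t. \<ointegral>x c\<leftarrow>t. \<ointegral>p q\<leftarrow>\<Delta> x. U p * \<gamma>b (S q \<otimes> c)"])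
    fix a c
    have bil: "cbilinear (\<lambda>x c. \<ointegral>p q\<leftarrow>\<Delta> x. U p * \<gamma>b (S q \<otimes> c))"
      by (intro lin cbilinearI)
    have "conv ?D (\<lambda>t. \<gamma>b (SL t)) (func_tens U \<epsilon>) (a \<otimes> c)
        = (\<ointegral>q p\<leftarrow>\<Delta>' a. \<ointegral>c1 c2\<leftarrow>\<Delta> c. \<gamma>b (S q \<otimes> c1) * (U p * \<epsilon> c2))"
      unfolding conv_def
      by (subst tensor_lift_tens[OF _ clinear_comult' clinear_comult])
        (intro lin cbilinearI clinear_SLR l(3), simp add: SL_pure clinear_UV clinear_counit)
    also have "\<dots> = (\<ointegral>q p\<leftarrow>\<Delta>' a. \<ointegral>c1 c2\<leftarrow>\<Delta> c. \<epsilon> c2 *\<^sub>C (U p * \<gamma>b (S q \<otimes> c1)))"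
      by (simp add: scaleC_complex_def mult_ac)
    also have "\<dots> = (\<ointegral>q p\<leftarrow>\<Delta>' a. U p * \<gamma>b (S q \<otimes> c))"
      by (subst counit_lift_right[OF comod_self']) (intro lin, rule refl)
    also have "\<dots> = (\<ointegral>p q\<leftarrow>\<Delta> a. U p * \<gamma>b (S q \<otimes> c))"
      unfolding comp_def by (rule tensor_lift_flip) (intro lin cbilinearI clinear_UV)
    finally show "conv ?D (\<lambda>t. \<gamma>b (SL t)) (func_tens U \<epsilon>) (a \<otimes> c) = (\<ointegral>x c\<leftarrow>a \<otimes> c. \<ointegral>p q\<leftarrow>\<Delta> x. U p * \<gamma>b (S q \<otimes> c))"
      by (simp only: tensor_lift_pure[OF bil])
  qed (intro l clinear_conv lin cbilinearI)+
  also have "(\<ointegral>x c\<leftarrow>\<Delta> a. \<ointegral>p q\<leftarrow>\<Delta> x. U p * \<gamma>b (S q \<otimes> c)) = (\<ointegral>p z\<leftarrow>\<Delta> a. \<ointegral>q c\<leftarrow>\<Delta> z. U p * \<gamma>b (S q \<otimes> c))"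
    by (rule comod_coassoc[OF comod_self, symmetric]) (intro ctrilinearI lin clinear_UV)
  also have "\<dots> = conv \<Delta> U V a"
    by (simp add: conv_def V_def tensor_lift_mult_right)
  finally have "conv \<Delta> U V a = H (\<Delta> a)" by simp
  also have "\<dots> = (\<ointegral>a1 z\<leftarrow>\<Delta> a. \<ointegral>a2 c\<leftarrow>\<Delta> z. \<gamma> (a1 \<otimes> \<kappa> (S a2) c))"
    unfolding H_def by (rule comod_coassoc[OF comod_self, symmetric]) (intro ctrilinearI lin)
  also have "\<dots> = (\<ointegral>a1 z\<leftarrow>\<Delta> a. \<gamma> (a1 \<otimes> (\<ointegral>a2 c\<leftarrow>\<Delta> z. \<kappa> (S a2) c)))"
    by (simp only: tensor_lift_pure_right clinear_tensor_lift_pull[OF clinear_cocycle(1)])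
  also have "\<dots> = \<epsilon> a"
    by (simp add: antipode_left scale_pure clinear_scale[OF clinear_cocycle(1)] cocycle_unit
        counit_lift_right[OF comod_self' clinear_counit])
  finally show "conv \<Delta> U V a = \<epsilon> a" .
qed

text \<open>Of the six legs x, c, p, q, d, y of the coproduct of \<open>b\<close>, the four inner
  ones contract by the hypothesis and the outer two remain. It serves both antipode
  identities.\<close>

lemma cancel_inner:
  assumes "clinear \<Phi>" "clinear \<Psi>"
    and "\<And>w. (\<ointegral>x y\<leftarrow>\<Delta> w. \<ointegral>a b\<leftarrow>\<Delta> x. \<ointegral>c d\<leftarrow>\<Delta> y. \<Phi> (a \<otimes> d) * \<Psi> (b \<otimes> c)) = \<epsilon> w"
  shows "(\<ointegral>x z\<leftarrow>\<Delta> b. \<ointegral>w y\<leftarrow>\<Delta> z. \<ointegral>c f\<leftarrow>\<Delta> w. \<ointegral>e d\<leftarrow>\<Delta> f.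
      ((\<ointegral>p q\<leftarrow>\<Delta> e. \<Psi> (p \<otimes> q)) * \<Phi> (c \<otimes> d)) *\<^sub>C (x \<otimes> y)) = \<Delta> b"
proof -
  note [lin] = assms(1,2)[THEN clinear_compose]
  have "(\<ointegral>c f\<leftarrow>\<Delta> w. \<ointegral>e d\<leftarrow>\<Delta> f. (\<ointegral>p q\<leftarrow>\<Delta> e. \<Psi> (p \<otimes> q)) * \<Phi> (c \<otimes> d)) = \<epsilon> w" for w
  proof -
    have "(\<ointegral>c f\<leftarrow>\<Delta> w. \<ointegral>e d\<leftarrow>\<Delta> f. (\<ointegral>p q\<leftarrow>\<Delta> e. \<Psi> (p \<otimes> q)) * \<Phi> (c \<otimes> d))
        = (\<ointegral>c f\<leftarrow>\<Delta> w. \<ointegral>e d\<leftarrow>\<Delta> f. \<ointegral>p q\<leftarrow>\<Delta> e. \<Phi> (c \<otimes> d) * \<Psi> (p \<otimes> q))"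
      by (simp only: tensor_lift_mult_left tensor_lift_mult_right mult.commute)
    also have "\<dots> = (\<ointegral>x y\<leftarrow>\<Delta> w. \<ointegral>a b\<leftarrow>\<Delta> x. \<ointegral>c d\<leftarrow>\<Delta> y. \<Phi> (a \<otimes> d) * \<Psi> (b \<otimes> c))"
      by (rule coassoc4[OF comod_self, symmetric]) (intro lin)+
    finally show ?thesis by (simp add: assms(3))
  qed
  then have "(\<ointegral>x z\<leftarrow>\<Delta> b. \<ointegral>w y\<leftarrow>\<Delta> z. \<ointegral>c f\<leftarrow>\<Delta> w. \<ointegral>e d\<leftarrow>\<Delta> f.
      ((\<ointegral>p q\<leftarrow>\<Delta> e. \<Psi> (p \<otimes> q)) * \<Phi> (c \<otimes> d)) *\<^sub>C (x \<otimes> y)) = (\<ointegral>x z\<leftarrow>\<Delta> b. \<ointegral>w y\<leftarrow>\<Delta> z. \<epsilon> w *\<^sub>C (x \<otimes> y))"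
    by (simp only: scaleC_tensor_lift[symmetric])
  also have "\<dots> = (\<ointegral>x z\<leftarrow>\<Delta> b. x \<otimes> z)"
    by (subst counit_lift[OF comod_self]) (intro lin, rule refl)
  finally show ?thesis by (simp add: tensor_lift_pure_self)
qed

lemma lop_tens_flip_left:
  assumes "clinear \<Phi>"
  shows "lop (tens \<Delta>' \<Delta>) \<Phi> (a \<otimes> b) = (\<ointegral>x c\<leftarrow>\<Delta> a. \<ointegral>d y\<leftarrow>\<Delta> b. \<Phi> (c \<otimes> d) *\<^sub>C (x \<otimes> y))"
proof -
  note [lin] = clinear_compose[OF assms(1)]
  show ?thesis
    unfolding lop_tens_pure[OF assms clinear_comult' clinear_comult] unfolding comp_def
    by (rule tensor_lift_flip) (intro lin cbilinearI)
qed

lemma lop_tens_flip_right: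
  assumes "clinear \<Phi>"
  shows "lop (tens \<Delta> \<Delta>') \<Phi> (a \<otimes> b) = (\<ointegral>c x\<leftarrow>\<Delta> a. \<ointegral>y d\<leftarrow>\<Delta> b. \<Phi> (c \<otimes> d) *\<^sub>C (x \<otimes> y))"
proof -
  note [lin] = clinear_compose[OF assms(1)]
  show ?thesis
    unfolding lop_tens_pure[OF assms clinear_comult clinear_comult'] unfolding comp_def
    by (subst tensor_lift_flip) (intro lin cbilinearI, rule refl)
qed

text \<open>\<open>conv_SR\<close> evaluated along a coproduct, in the four-leg form that
  \<open>cancel_inner\<close> takes.\<close>

lemma bracket_SR: "(\<ointegral>x y\<leftarrow>\<Delta> w. \<ointegral>a b\<leftarrow>\<Delta> x. \<ointegral>c d\<leftarrow>\<Delta> y. \<gamma>b (a \<otimes> S d) * \<gamma> (b \<otimes> S c)) = \<epsilon> w"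
proof -
  note l = clinear_compose[OF clinear_cocycle(1) clinear_SLR(2)] clinear_compose[OF clinear_cocycle(2) clinear_SLR(2)]
  have "(\<ointegral>x y\<leftarrow>\<Delta> w. \<ointegral>a b\<leftarrow>\<Delta> x. \<ointegral>c d\<leftarrow>\<Delta> y. \<gamma>b (a \<otimes> S d) * \<gamma> (b \<otimes> S c))
      = (\<ointegral>x y\<leftarrow>\<Delta> w. conv (tens \<Delta> \<Delta>') (\<lambda>t. \<gamma>b (SR t)) (\<lambda>t. \<gamma> (SR t)) (x \<otimes> y))"
    by (simp add: conv_lop[OF l(1)] lop_tens_flip_right[OF l(2)] SR_pure
        clinear_tensor_lift_pull[OF l(1)] clinear_scale[OF l(1)] scaleC_complex_def)
  also have "\<dots> = \<epsilon>2 (\<Delta> w)"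
    unfolding conv_SR clinear_tensor_lift_pull[OF clinear_func_tens[OF clinear_counit clinear_counit], symmetric]
      tensor_lift_pure_self ..
  finally show ?thesis by (simp add: counit2_comult)
qed

lemma bracket_SL: "(\<ointegral>x y\<leftarrow>\<Delta> w. \<ointegral>a b\<leftarrow>\<Delta> x. \<ointegral>c d\<leftarrow>\<Delta> y. \<gamma> (S a \<otimes> d) * \<gamma>b (S b \<otimes> c)) = \<epsilon> w"
proof -
  note l = clinear_compose[OF clinear_cocycle(1) clinear_SLR(1)] clinear_compose[OF clinear_cocycle(2) clinear_SLR(1)]
  have "(\<ointegral>x y\<leftarrow>\<Delta> w. \<ointegral>a b\<leftarrow>\<Delta> x. \<ointegral>c d\<leftarrow>\<Delta> y. \<gamma> (S a \<otimes> d) * \<gamma>b (S b \<otimes> c))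
      = (\<ointegral>x y\<leftarrow>\<Delta> w. conv (tens \<Delta>' \<Delta>) (\<lambda>t. \<gamma>b (SL t)) (\<lambda>t. \<gamma> (SL t)) (x \<otimes> y))"
    by (simp add: conv_lop[OF l(1)] lop_tens_flip_left[OF l(2)] SL_pure mult.commute
        clinear_tensor_lift_pull[OF l(1)] clinear_scale[OF l(1)] scaleC_complex_def)
  also have "\<dots> = \<epsilon>2 (\<Delta> w)"
    unfolding conv_SL clinear_tensor_lift_pull[OF clinear_func_tens[OF clinear_counit clinear_counit], symmetric]
      tensor_lift_pure_self ..
  finally show ?thesis by (simp add: counit2_comult)
qed

text \<open>In the deformed product of b_1 with the deformed antipode of b_2, the factor U of the
  antipode cancels the \<gamma>b of the product.\<close>

lemma cancel_SR:
  "(\<ointegral>b1 b2\<leftarrow>\<Delta> b. lop (tens \<Delta>' \<Delta>) (\<lambda>t. \<gamma>b (SR t)) (b1 \<otimes> lop \<Delta> U b2)) = \<Delta> b"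
proof -
  have l: "clinear (\<lambda>t. \<gamma>b (SR t))" "clinear (\<lambda>t. \<gamma> (SR t))" by (intro lin clinear_SLR)+
  note l' = clinear_lop[OF clinear_tens[OF clinear_comult' clinear_comult] l(1)]
  have "(\<ointegral>b1 b2\<leftarrow>\<Delta> b. lop (tens \<Delta>' \<Delta>) (\<lambda>t. \<gamma>b (SR t)) (b1 \<otimes> lop \<Delta> U b2))
      = (\<ointegral>b1 b2\<leftarrow>\<Delta> b. \<ointegral>e n\<leftarrow>\<Delta> b2. \<ointegral>x c\<leftarrow>\<Delta> b1. \<ointegral>d y\<leftarrow>\<Delta> n. (U e * \<gamma>b (c \<otimes> S d)) *\<^sub>C (x \<otimes> y))"
    unfolding lop_def[of \<Delta> U]
    by (simp add: tensor_lift_pure_right clinear_tensor_lift_pull[OF l'] clinear_scale[OF l'] scale_pure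
        lop_tens_flip_left[OF l(1)] SR_pure tensor_lift_scaleC scaleC_scaleC)
  also have "\<dots> = (\<ointegral>b1 b2\<leftarrow>\<Delta> b. \<ointegral>x c\<leftarrow>\<Delta> b1. \<ointegral>e n\<leftarrow>\<Delta> b2. \<ointegral>d y\<leftarrow>\<Delta> n. (U e * \<gamma>b (c \<otimes> S d)) *\<^sub>C (x \<otimes> y))"
    by (subst tensor_lift_swap) (rule refl)
  also have "\<dots> = (\<ointegral>x z\<leftarrow>\<Delta> b. \<ointegral>c b2\<leftarrow>\<Delta> z. \<ointegral>e n\<leftarrow>\<Delta> b2. \<ointegral>d y\<leftarrow>\<Delta> n. (U e * \<gamma>b (c \<otimes> S d)) *\<^sub>C (x \<otimes> y))"
    by (rule comod_coassoc[OF comod_self, symmetric]) (intro ctrilinearI lin cbilinearI)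
  also have "\<dots> = (\<ointegral>x z\<leftarrow>\<Delta> b. \<ointegral>c b2\<leftarrow>\<Delta> z. \<ointegral>f y\<leftarrow>\<Delta> b2. \<ointegral>e d\<leftarrow>\<Delta> f. (U e * \<gamma>b (c \<otimes> S d)) *\<^sub>C (x \<otimes> y))"
    by (subst comod_coassoc[OF comod_self]) (intro ctrilinearI lin, rule refl)
  also have "\<dots> = (\<ointegral>x z\<leftarrow>\<Delta> b. \<ointegral>w y\<leftarrow>\<Delta> z. \<ointegral>c f\<leftarrow>\<Delta> w. \<ointegral>e d\<leftarrow>\<Delta> f. (U e * \<gamma>b (c \<otimes> S d)) *\<^sub>C (x \<otimes> y))"
    by (subst comod_coassoc[OF comod_self]) (intro ctrilinearI lin cbilinearI, rule refl)
  also have "\<dots> = \<Delta> b"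
    using cancel_inner[OF l, of b] bracket_SR by (simp add: SR_pure U_def)
  finally show ?thesis .
qed

text \<open>For the antipode on the left, V cancels the \<gamma> of the deformed product.\<close>

lemma cancel_SL:
  "(\<ointegral>b1 b2\<leftarrow>\<Delta> b. lop (tens \<Delta>' \<Delta>) (\<lambda>t. \<gamma> (SL t)) (lop \<Delta>' V b1 \<otimes> b2)) = \<Delta> b"
proof -
  have l: "clinear (\<lambda>t. \<gamma> (SL t))" "clinear (\<lambda>t. \<gamma>b (SL t))" by (intro lin clinear_SLR)+
  note l' = clinear_lop[OF clinear_tens[OF clinear_comult' clinear_comult] l(1)]
  have "(\<ointegral>b1 b2\<leftarrow>\<Delta> b. lop (tens \<Delta>' \<Delta>) (\<lambda>t. \<gamma> (SL t)) (lop \<Delta>' V b1 \<otimes> b2))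
      = (\<ointegral>b1 b2\<leftarrow>\<Delta> b. \<ointegral>m e\<leftarrow>\<Delta> b1. \<ointegral>x c\<leftarrow>\<Delta> m. \<ointegral>d y\<leftarrow>\<Delta> b2. (V e * \<gamma> (S c \<otimes> d)) *\<^sub>C (x \<otimes> y))"
    unfolding lop_flip[OF clinear_UV(2)]
    by (simp add: tensor_lift_pure_left clinear_tensor_lift_pull[OF l'] clinear_scale[OF l'] scale_pure
        lop_tens_flip_left[OF l(1)] SL_pure tensor_lift_scaleC scaleC_scaleC)
  also have "\<dots> = (\<ointegral>b1 b2\<leftarrow>\<Delta> b. \<ointegral>x f\<leftarrow>\<Delta> b1. \<ointegral>c e\<leftarrow>\<Delta> f. \<ointegral>d y\<leftarrow>\<Delta> b2. (V e * \<gamma> (S c \<otimes> d)) *\<^sub>C (x \<otimes> y))"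
    by (subst comod_coassoc[OF comod_self]) (intro ctrilinearI lin, rule refl)
  also have "\<dots> = (\<ointegral>x z\<leftarrow>\<Delta> b. \<ointegral>f b2\<leftarrow>\<Delta> z. \<ointegral>c e\<leftarrow>\<Delta> f. \<ointegral>d y\<leftarrow>\<Delta> b2. (V e * \<gamma> (S c \<otimes> d)) *\<^sub>C (x \<otimes> y))"
    by (rule comod_coassoc[OF comod_self, symmetric]) (intro ctrilinearI lin cbilinearI)
  also have "\<dots> = (\<ointegral>x z\<leftarrow>\<Delta> b. \<ointegral>c b2\<leftarrow>\<Delta> z. \<ointegral>f y\<leftarrow>\<Delta> b2. \<ointegral>e d\<leftarrow>\<Delta> f. (V e * \<gamma> (S c \<otimes> d)) *\<^sub>C (x \<otimes> y))"
    by (subst coassoc4[OF comod_self]) ((intro lin)+, rule refl)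
  also have "\<dots> = (\<ointegral>x z\<leftarrow>\<Delta> b. \<ointegral>w y\<leftarrow>\<Delta> z. \<ointegral>c f\<leftarrow>\<Delta> w. \<ointegral>e d\<leftarrow>\<Delta> f. (V e * \<gamma> (S c \<otimes> d)) *\<^sub>C (x \<otimes> y))"
    by (subst comod_coassoc[OF comod_self]) (intro ctrilinearI lin cbilinearI, rule refl)
  also have "\<dots> = \<Delta> b"
    using cancel_inner[OF l, of b] bracket_SL by (simp add: SL_pure V_def)
  finally show ?thesis .
qed

definition "S\<gamma> a = S (lop \<Delta> U (lop \<Delta>' V a))"

lemma clinear_deformed_antipode: "clinear S\<gamma>"
  unfolding S\<gamma>_def[abs_def]
  by (intro lin clinear_compose[OF clinear_lop[OF clinear_comult clinear_UV(1)]]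
      clinear_lop[OF clinear_comult' clinear_UV(2)])

text \<open>Right operators commute with the left regular coaction. This moves V out of the antipode
  and in front of the Sweedler sum.\<close>

lemma tensor_lift_colin_right:
  assumes "cbilinear f" "clinear \<phi>"
  shows "(\<ointegral>a b\<leftarrow>\<Delta> c. f a (lop \<Delta>' \<phi> b)) = tensor_lift f (\<Delta> (lop \<Delta>' \<phi> c))"
proof -
  note [lin] = bilinear_lin(1,2)[OF assms(1)] clinear_compose[OF assms(2)]
  have "(\<ointegral>a b\<leftarrow>\<Delta> c. f a (lop \<Delta>' \<phi> b)) = (\<ointegral>a b\<leftarrow>\<Delta> c. \<ointegral>x y\<leftarrow>\<Delta> b. \<phi> y *\<^sub>C f a x)"
    by (simp only: lop_flip[OF assms(2)] bilinear_tensor_lift[OF assms(1)] bilinear_scale[OF assms(1)])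
  also have "\<dots> = (\<ointegral>b y\<leftarrow>\<Delta> c. \<ointegral>a x\<leftarrow>\<Delta> b. \<phi> y *\<^sub>C f a x)"
    by (rule comod_coassoc[OF comod_self]) (intro ctrilinearI lin)
  also have "\<dots> = tensor_lift f (\<Delta> (lop \<Delta>' \<phi> c))"
    by (simp only: lop_flip[OF assms(2)] tensor_lift_scale_inner
        clinear_tensor_lift_pull[OF clinear_compose[OF clinear_tensor_lift[OF assms(1)] clinear_comult]]
        clinear_scale[OF clinear_compose[OF clinear_tensor_lift[OF assms(1)] clinear_comult]])
  finally show ?thesis .
qed

lemma tensor_lift_colin_left:
  assumes "cbilinear f" "clinear \<phi>"
  shows "(\<ointegral>a b\<leftarrow>\<Delta> c. f (lop \<Delta> \<phi> a) b) = tensor_lift f (\<Delta> (lop \<Delta> \<phi> c))"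
proof -
  note [lin] = bilinear_lin(1,2)[OF assms(1)] clinear_compose[OF assms(2)]
  have "(\<ointegral>a b\<leftarrow>\<Delta> c. f (lop \<Delta> \<phi> a) b) = (\<ointegral>a b\<leftarrow>\<Delta> c. \<ointegral>x y\<leftarrow>\<Delta> a. \<phi> x *\<^sub>C f y b)"
    by (simp only: lop_def bilinear_tensor_lift[OF assms(1)] bilinear_scale[OF assms(1)])
  also have "\<dots> = (\<ointegral>x b\<leftarrow>\<Delta> c. \<ointegral>y b\<leftarrow>\<Delta> b. \<phi> x *\<^sub>C f y b)"
    by (rule comod_coassoc[OF comod_self, symmetric]) (intro ctrilinearI lin)
  also have "\<dots> = tensor_lift f (\<Delta> (lop \<Delta> \<phi> c))"
    by (simp only: lop_def tensor_lift_scale_inner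
        clinear_tensor_lift_pull[OF clinear_compose[OF clinear_tensor_lift[OF assms(1)] clinear_comult]]
        clinear_scale[OF clinear_compose[OF clinear_tensor_lift[OF assms(1)] clinear_comult]])
  finally show ?thesis .
qed

text \<open>What \<open>cancel_SR\<close> leaves of the deformed product: the inner legs contract by
  the antipode and the outer ones form U.\<close>

lemma cancel_outer_SR: "tensor_lift \<kappa> (SR (lop (tens \<Delta> \<Delta>') (\<lambda>t. \<gamma> (SR t)) (\<Delta> b))) = U b *\<^sub>C u"
proof -
  have l: "clinear (\<lambda>t. \<gamma> (SR t))" by (intro lin clinear_SLR)
  let ?h = "\<lambda>t. tensor_lift \<kappa> (SR (lop (tens \<Delta> \<Delta>') (\<lambda>t. \<gamma> (SR t)) t))"
  have k: "clinear (\<lambda>t. tensor_lift \<kappa> (SR t))" by (intro lin mult_bilin clinear_SLR)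
  have h: "clinear ?h"
    by (rule clinear_compose[OF k clinear_lop[OF clinear_tens[OF clinear_comult clinear_comult'] l]])
  have "?h (\<Delta> b) = (\<ointegral>x y\<leftarrow>\<Delta> b. ?h (x \<otimes> y))"
    using clinear_tensor_lift_pull[OF h, of "(\<otimes>)" "\<Delta> b"] by (simp add: tensor_lift_pure_self)
  also have "\<dots> = (\<ointegral>x y\<leftarrow>\<Delta> b. \<ointegral>p q\<leftarrow>\<Delta> x. \<ointegral>c d\<leftarrow>\<Delta> y. \<gamma> (p \<otimes> S d) *\<^sub>C \<kappa> q (S c))"
    by (simp only: lop_tens_flip_right[OF l] clinear_tensor_lift_pull[OF k] clinear_scale[OF k]
        SR_pure tensor_lift_pure[OF mult_bilin])
  also have "\<dots> = (\<ointegral>x z\<leftarrow>\<Delta> b. \<ointegral>w d\<leftarrow>\<Delta> z. \<ointegral>q c\<leftarrow>\<Delta> w. \<gamma> (x \<otimes> S d) *\<^sub>C \<kappa> q (S c))"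
    by (rule coassoc4[OF comod_self]) (intro lin)+
  also have "\<dots> = (\<ointegral>x z\<leftarrow>\<Delta> b. \<ointegral>w d\<leftarrow>\<Delta> z. \<epsilon> w *\<^sub>C \<gamma> (x \<otimes> S d) *\<^sub>C u)"
    by (simp add: tensor_lift_scale_inner antipode_right scaleC_scaleC mult.commute)
  also have "\<dots> = (\<ointegral>x z\<leftarrow>\<Delta> b. \<gamma> (x \<otimes> S z) *\<^sub>C u)"
    by (subst counit_lift[OF comod_self]) (intro lin, rule refl)
  finally show ?thesis by (simp only: scaleC_tensor_lift[symmetric] U_def)
qed

lemma cancel_outer_SL: "tensor_lift \<kappa> (SL (lop (tens \<Delta> \<Delta>') (\<lambda>t. \<gamma>b (SL t)) (\<Delta> b))) = V b *\<^sub>C u"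
proof -
  have l: "clinear (\<lambda>t. \<gamma>b (SL t))" by (intro lin clinear_SLR)
  let ?h = "\<lambda>t. tensor_lift \<kappa> (SL (lop (tens \<Delta> \<Delta>') (\<lambda>t. \<gamma>b (SL t)) t))"
  have k: "clinear (\<lambda>t. tensor_lift \<kappa> (SL t))" by (intro lin mult_bilin clinear_SLR)
  have h: "clinear ?h"
    by (rule clinear_compose[OF k clinear_lop[OF clinear_tens[OF clinear_comult clinear_comult'] l]])
  have "?h (\<Delta> b) = (\<ointegral>x y\<leftarrow>\<Delta> b. ?h (x \<otimes> y))"
    using clinear_tensor_lift_pull[OF h, of "(\<otimes>)" "\<Delta> b"] by (simp add: tensor_lift_pure_self)
  also have "\<dots> = (\<ointegral>x y\<leftarrow>\<Delta> b. \<ointegral>p q\<leftarrow>\<Delta> x. \<ointegral>c d\<leftarrow>\<Delta> y. \<gamma>b (S p \<otimes> d) *\<^sub>C \<kappa> (S q) c)"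
    by (simp only: lop_tens_flip_right[OF l] clinear_tensor_lift_pull[OF k] clinear_scale[OF k]
        SL_pure tensor_lift_pure[OF mult_bilin])
  also have "\<dots> = (\<ointegral>x z\<leftarrow>\<Delta> b. \<ointegral>w d\<leftarrow>\<Delta> z. \<ointegral>q c\<leftarrow>\<Delta> w. \<gamma>b (S x \<otimes> d) *\<^sub>C \<kappa> (S q) c)"
    by (rule coassoc4[OF comod_self]) (intro lin)+
  also have "\<dots> = (\<ointegral>x z\<leftarrow>\<Delta> b. \<ointegral>w d\<leftarrow>\<Delta> z. \<epsilon> w *\<^sub>C \<gamma>b (S x \<otimes> d) *\<^sub>C u)"
    by (simp add: tensor_lift_scale_inner antipode_left scaleC_scaleC mult.commute)
  also have "\<dots> = (\<ointegral>x z\<leftarrow>\<Delta> b. \<gamma>b (S x \<otimes> z) *\<^sub>C u)"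
    by (subst counit_lift[OF comod_self]) (intro lin, rule refl)
  finally show ?thesis by (simp only: scaleC_tensor_lift[symmetric] V_def)
qed

lemma deformed_mult_lift:
  "\<kappa>\<gamma> a b = tensor_lift \<kappa> (twist \<gamma> \<gamma>b \<Delta>2 (tens \<Delta>' \<Delta>') (a \<otimes> b))"
  by (simp add: \<kappa>\<gamma>_def dpair_def)

lemma deformed_antipode_right: "(\<ointegral>a b\<leftarrow>\<Delta> c. \<kappa>\<gamma> a (S\<gamma> b)) = \<epsilon> c *\<^sub>C u"
proof -
  have l: "clinear (\<lambda>t. \<gamma> (SR t))" "clinear (\<lambda>t. \<gamma>b (SR t))" by (intro lin clinear_SLR)+
  have *: "\<kappa>\<gamma> a (S (lop \<Delta> U b)) = tensor_lift \<kappa> (SR (lop (tens \<Delta> \<Delta>') (\<lambda>t. \<gamma> (SR t))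
      (lop (tens \<Delta>' \<Delta>) (\<lambda>t. \<gamma>b (SR t)) (a \<otimes> lop \<Delta> U b))))" for a b
    unfolding deformed_mult_lift twist_sym[OF bicomod_self2 clinear_cocycle] twist_def SR_pure[symmetric]
      lop_comod_map[OF comod_map_SR(2) clinear_cocycle(2)] lop_comod_map[OF comod_map_SR(1) clinear_cocycle(1)] ..
  have h: "clinear (\<lambda>t. tensor_lift \<kappa> (SR (lop (tens \<Delta> \<Delta>') (\<lambda>t. \<gamma> (SR t)) t)))"
    by (rule clinear_compose[OF clinear_compose[OF clinear_tensor_lift[OF mult_bilin] clinear_SLR(2)]
          clinear_lop[OF clinear_tens[OF clinear_comult clinear_comult'] l(1)]])
  have U: "(\<ointegral>a b\<leftarrow>\<Delta> c. \<kappa>\<gamma> a (S (lop \<Delta> U b))) = U c *\<^sub>C u" for c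
    unfolding * clinear_tensor_lift_pull[OF h, symmetric] cancel_SR cancel_outer_SR ..
  have "cbilinear (\<lambda>a b. \<kappa>\<gamma> a (S (lop \<Delta> U b)))"
    by (intro cbilinearI bilinear_lin(1,2)[OF cbilinear_deformed_mult] lin clinear_lop clinear_comult clinear_UV)
  from tensor_lift_colin_right[OF this clinear_UV(2)]
  have "(\<ointegral>a b\<leftarrow>\<Delta> c. \<kappa>\<gamma> a (S\<gamma> b)) = U (lop \<Delta>' V c) *\<^sub>C u"
    by (simp add: S\<gamma>_def U)
  then show ?thesis
    by (simp add: conv_lop'[OF clinear_UV, symmetric] conv_UV)
qed

lemma deformed_antipode_left: "(\<ointegral>a b\<leftarrow>\<Delta> c. \<kappa>\<gamma> (S\<gamma> a) b) = \<epsilon> c *\<^sub>C u"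
proof -
  have l: "clinear (\<lambda>t. \<gamma>b (SL t))" "clinear (\<lambda>t. \<gamma> (SL t))" by (intro lin clinear_SLR)+
  have *: "\<kappa>\<gamma> (S (lop \<Delta>' V a)) b = tensor_lift \<kappa> (SL (lop (tens \<Delta> \<Delta>') (\<lambda>t. \<gamma>b (SL t))
      (lop (tens \<Delta>' \<Delta>) (\<lambda>t. \<gamma> (SL t)) (lop \<Delta>' V a \<otimes> b))))" for a b
    unfolding deformed_mult_lift twist_def SL_pure[symmetric]
      lop_comod_map[OF comod_map_SL(2) clinear_cocycle(2)] lop_comod_map[OF comod_map_SL(1) clinear_cocycle(1)] ..
  have h: "clinear (\<lambda>t. tensor_lift \<kappa> (SL (lop (tens \<Delta> \<Delta>') (\<lambda>t. \<gamma>b (SL t)) t)))"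
    by (rule clinear_compose[OF clinear_compose[OF clinear_tensor_lift[OF mult_bilin] clinear_SLR(1)]
          clinear_lop[OF clinear_tens[OF clinear_comult clinear_comult'] l(1)]])
  have V: "(\<ointegral>a b\<leftarrow>\<Delta> c. \<kappa>\<gamma> (S (lop \<Delta>' V a)) b) = V c *\<^sub>C u" for c
    unfolding * clinear_tensor_lift_pull[OF h, symmetric] cancel_SL cancel_outer_SL ..
  have "cbilinear (\<lambda>a b. \<kappa>\<gamma> (S (lop \<Delta>' V a)) b)"
    by (intro cbilinearI bilinear_lin(1,2)[OF cbilinear_deformed_mult] lin clinear_lop clinear_comult' clinear_UV)
  \<comment> \<open>On this side V has to stay inside the sum, to cancel \<gamma>, while U moves
    out; hence the exchange of the two commuting operators.\<close>
  moreover have "S\<gamma> a = S (lop \<Delta>' V (lop \<Delta> U a))" for a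
    unfolding S\<gamma>_def by (simp only: cocommute_lop[OF bicomodD(3,6,7)[OF self] clinear_UV])
  ultimately have "(\<ointegral>a b\<leftarrow>\<Delta> c. \<kappa>\<gamma> (S\<gamma> a) b) = V (lop \<Delta> U c) *\<^sub>C u"
    using tensor_lift_colin_left[OF _ clinear_UV(1), of "\<lambda>a b. \<kappa>\<gamma> (S (lop \<Delta>' V a)) b" c] by (simp add: V)
  then show ?thesis
    by (simp add: conv_lop[OF clinear_UV(2), symmetric] conv_UV)
qed

theorem deformed_hopf: "hopf \<kappa>\<gamma> u \<Delta> \<epsilon> S\<gamma>"
  by (intro hopf.intro hopf_axioms.intro deformed_bialgebra clinear_deformed_antipode
      deformed_antipode_left deformed_antipode_right)

end

section \<open>Bicovariant bimodules and the braiding\<close>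

lemma colin_lift:
  assumes "colin \<kappa> \<delta> \<eta> \<theta> \<mu>" "cbilinear f"
  shows "tensor_lift f (\<theta> (\<mu> m n)) = (\<ointegral>a x\<leftarrow>\<delta> m. \<ointegral>b y\<leftarrow>\<eta> n. f (\<kappa> a b) (\<mu> x y))"
  using assms by (simp add: colin_def tensor_lift_tensor_map2)

lemma colin_swap:
  assumes "colin \<kappa> \<delta> \<eta> \<theta> \<mu>"
  shows "colin (\<lambda>a b. \<kappa> b a) \<eta> \<delta> \<theta> (\<lambda>x y. \<mu> y x)"
  using assms unfolding colin_def tensor_map2_def
  by (subst tensor_lift_swap) simp

locale bicovariant = bialgebra +
  fixes l :: "'a \<Rightarrow> 'm::complex_vector \<Rightarrow> 'm" and r :: "'m \<Rightarrow> 'a \<Rightarrow> 'm" and \<delta> \<delta>' :: "'m \<Rightarrow> 'a \<otimes> 'm"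
  assumes l_bilin: "cbilinear l" and r_bilin: "cbilinear r"
    and l_mult: "l (\<kappa> a b) m = l a (l b m)" and l_unit: "l u m = m"
    and r_mult: "r m (\<kappa> a b) = r (r m a) b" and r_unit: "r m u = m"
    and l_r: "r (l a m) b = l a (r m b)"
    and bico: "bicomod \<Delta> \<epsilon> \<delta> \<delta>'"
    and l_colin: "colin \<kappa> \<Delta> \<delta> \<delta> l" "colin \<kappa> (flip \<circ> \<Delta>) \<delta>' \<delta>' l"
    and r_colin: "colin \<kappa> \<delta> \<Delta> \<delta> r" "colin \<kappa> \<delta>' (flip \<circ> \<Delta>) \<delta>' r"
begin

lemmas clinear_coact = bicomodD(6,7)[OF bico]
lemmas comod_left = bicomodD(1)[OF bico]
lemmas comod_right = bicomodD(2)[OF bico]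
lemmas bimodule_lin [lin] = bilinear_lin(1,2)[OF l_bilin] bilinear_lin(1,2)[OF r_bilin]
  clinear_coact[THEN clinear_compose]

definition bal :: "('m \<otimes> 'm) set"
  where "bal = complex_vector.span {r m a \<otimes> n - m \<otimes> l a n | m a n. True}"

end

locale hopf_bicovariant = hopf \<kappa> u \<Delta> \<epsilon> S + bicovariant \<kappa> u \<Delta> \<epsilon> l r \<delta> \<delta>'
  for \<kappa> :: "'a::complex_vector \<Rightarrow> 'a \<Rightarrow> 'a" and u \<Delta> \<epsilon> S
    and l :: "'a \<Rightarrow> 'm::complex_vector \<Rightarrow> 'm" and r \<delta> \<delta>'
begin

text \<open>The classical projection onto the left-invariant elements.\<close>

definition "P m = (\<ointegral>c x\<leftarrow>\<delta> m. l (S c) x)"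

lemma clinear_P: "clinear P"
  unfolding P_def[abs_def] by (intro lin cbilinearI clinear_coact)

lemma P_left_inv: "\<delta> m = u \<otimes> m \<Longrightarrow> P m = m"
  unfolding P_def by (simp, subst tensor_lift_pure) (intro lin cbilinearI, simp add: antipode_unit l_unit)

text \<open>The antipode cancels the leg in front of it. In particular the left-invariant elements
  generate the bimodule from the left.\<close>

lemma P_recover: "(\<ointegral>c x\<leftarrow>\<delta> m. l c (P x)) = m"
proof -
  have "(\<ointegral>c x\<leftarrow>\<delta> m. l c (P x)) = (\<ointegral>c x\<leftarrow>\<delta> m. \<ointegral>d y\<leftarrow>\<delta> x. l c (l (S d) y))"
    by (simp only: P_def bilinear_tensor_lift[OF l_bilin])
  also have "\<dots> = (\<ointegral>c x\<leftarrow>\<delta> m. \<ointegral>a b\<leftarrow>\<Delta> c. l (\<kappa> a (S b)) x)"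
    unfolding l_mult by (rule comod_coassoc[OF comod_left]) (intro ctrilinearI lin)
  also have "\<dots> = (\<ointegral>c x\<leftarrow>\<delta> m. \<epsilon> c *\<^sub>C x)"
    by (simp only: bilinear_tensor_lift[OF l_bilin, symmetric] antipode_right bilinear_scale[OF l_bilin] l_unit)
  finally show ?thesis
    using comodD(4)[OF comod_left] by (simp add: lop_def)
qed

lemma P_inv: "\<delta> (P m) = u \<otimes> P m"
proof -
  have "\<delta> (l (S c) x) = (\<ointegral>a b\<leftarrow>\<Delta> c. \<ointegral>d y\<leftarrow>\<delta> x. \<kappa> (S b) d \<otimes> l (S a) y)" for c x
  proof -
    have "\<delta> (l (S c) x) = (\<ointegral>a b\<leftarrow>\<Delta> (S c). \<ointegral>d y\<leftarrow>\<delta> x. \<kappa> a d \<otimes> l b y)"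
      using l_colin(1) by (simp add: colin_def tensor_map2_def)
    then show ?thesis
      unfolding comult_antipode
      by (simp, subst tensor_lift_bind, intro lin cbilinearI, subst tensor_lift_pure)
        (intro lin cbilinearI, rule refl)
  qed
  then have "\<delta> (P m) = (\<ointegral>c x\<leftarrow>\<delta> m. \<ointegral>a b\<leftarrow>\<Delta> c. \<ointegral>d y\<leftarrow>\<delta> x. \<kappa> (S b) d \<otimes> l (S a) y)"
    by (simp only: P_def clinear_tensor_lift_pull[OF clinear_coact(1)])
  also have "\<dots> = (\<ointegral>a z\<leftarrow>\<delta> m. \<ointegral>w y\<leftarrow>\<delta> z. \<ointegral>b d\<leftarrow>\<Delta> w. \<kappa> (S b) d \<otimes> l (S a) y)"
    by (rule coassoc4[OF comod_left]) (intro lin)+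
  also have "\<dots> = (\<ointegral>a z\<leftarrow>\<delta> m. \<ointegral>w y\<leftarrow>\<delta> z. \<epsilon> w *\<^sub>C (u \<otimes> l (S a) y))"
    by (simp only: tensor_lift_pure_left[symmetric] antipode_left scale_pure)
  also have "\<dots> = (\<ointegral>a z\<leftarrow>\<delta> m. u \<otimes> l (S a) z)"
    by (subst counit_lift[OF comod_left]) (intro lin, rule refl)
  finally show ?thesis by (simp only: P_def tensor_lift_pure_right)
qed

lemma P_lact: "P (l a m) = \<epsilon> a *\<^sub>C P m"
proof -
  have "P (l a m) = (\<ointegral>a1 a2\<leftarrow>\<Delta> a. \<ointegral>c x\<leftarrow>\<delta> m. l (S (\<kappa> a1 c)) (l a2 x))"
    unfolding P_def by (rule colin_lift[OF l_colin(1)]) (intro lin cbilinearI)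
  also have "\<dots> = (\<ointegral>a1 a2\<leftarrow>\<Delta> a. \<ointegral>c x\<leftarrow>\<delta> m. l (S c) (l (\<kappa> (S a1) a2) x))"
    by (simp add: antipode_mult l_mult)
  also have "\<dots> = (\<ointegral>c x\<leftarrow>\<delta> m. \<ointegral>a1 a2\<leftarrow>\<Delta> a. l (S c) (l (\<kappa> (S a1) a2) x))"
    by (rule tensor_lift_swap)
  also have "\<dots> = \<epsilon> a *\<^sub>C P m"
    by (simp only: bilinear_tensor_lift[OF l_bilin, symmetric] antipode_left bilinear_scale[OF l_bilin] l_unit
        tensor_lift_scale_inner P_def)
  finally show ?thesis .
qed

text \<open>The projection turns the right action into the adjoint action by S(a_1) and a_2; these
  are the legs that have to be rebalanced in \<open>sig_balanced\<close>.\<close>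

lemma P_ract: "P (r m a) = (\<ointegral>a1 a2\<leftarrow>\<Delta> a. r (l (S a1) (P m)) a2)"
proof -
  have "P (r m a) = (\<ointegral>c x\<leftarrow>\<delta> m. \<ointegral>a1 a2\<leftarrow>\<Delta> a. l (S (\<kappa> c a1)) (r x a2))"
    unfolding P_def by (rule colin_lift[OF r_colin(1)]) (intro lin cbilinearI)
  also have "\<dots> = (\<ointegral>a1 a2\<leftarrow>\<Delta> a. \<ointegral>c x\<leftarrow>\<delta> m. r (l (S a1) (l (S c) x)) a2)"
    by (subst tensor_lift_swap) (simp add: antipode_mult l_mult l_r)
  finally show ?thesis
    by (simp only: P_def bilinear_tensor_lift[OF l_bilin] bilinear_tensor_lift[OF r_bilin])
qed

text \<open>Passing to the opposite co-opposite Hopf algebra exchanges left and right, so the facts about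
  \<open>P\<close> transfer to the projection \<open>Q\<close> onto the right-invariant elements.\<close>

lemma mirror:
  "hopf_bicovariant (\<lambda>a b. \<kappa> b a) u (flip \<circ> \<Delta>) \<epsilon> S (\<lambda>a m. r m a) (\<lambda>m a. l a m) \<delta>' \<delta>"
proof (intro hopf_bicovariant.intro hopf.intro hopf_axioms.intro bicovariant.intro bicovariant_axioms.intro)
  show "bialgebra (\<lambda>a b. \<kappa> b a) u (flip \<circ> \<Delta>) \<epsilon>"
  proof
    show "bicomod (flip \<circ> \<Delta>) \<epsilon> (flip \<circ> \<Delta>) (flip \<circ> (flip \<circ> \<Delta>))"
      using bicomod_sym[OF self] by simp
    show "colin (\<lambda>a b. \<kappa> b a) (flip \<circ> \<Delta>) (flip \<circ> \<Delta>) (flip \<circ> \<Delta>) (\<lambda>a b. \<kappa> b a)"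
      by (rule colin_swap[OF comult_mult_flip])
  qed (simp_all add: cbilinear_swap mult_bilin mult_assoc unit_left unit_right comult_unit counit_mult
      counit_unit mult.commute)
  then show "bialgebra (\<lambda>a b. \<kappa> b a) u (flip \<circ> \<Delta>) \<epsilon>" .
  show "(\<ointegral>a b\<leftarrow>(flip \<circ> \<Delta>) c. \<kappa> b (S a)) = \<epsilon> c *\<^sub>C u" "(\<ointegral>a b\<leftarrow>(flip \<circ> \<Delta>) c. \<kappa> (S b) a) = \<epsilon> c *\<^sub>C u" for c
    unfolding antipode_left[symmetric] unfolding comp_def
    by (subst tensor_lift_flip, intro lin cbilinearI, simp add: antipode_left antipode_right)+
qed (simp_all add: cbilinear_swap l_bilin r_bilin l_mult r_mult l_unit r_unit l_r clinear_antipode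
    bicomod_sym[OF bico] colin_swap l_colin r_colin)

definition "Q m = (\<ointegral>c x\<leftarrow>\<delta>' m. r x (S c))"

lemma Q_mirror: "Q = hopf_bicovariant.P S (\<lambda>a m. r m a) \<delta>'"
  by (simp add: fun_eq_iff hopf_bicovariant.P_def[OF mirror] Q_def)

lemmas clinear_Q = hopf_bicovariant.clinear_P[OF mirror, folded Q_mirror]
lemmas Q_right_inv = hopf_bicovariant.P_left_inv[OF mirror, folded Q_mirror]
lemmas Q_recover = hopf_bicovariant.P_recover[OF mirror, folded Q_mirror]
lemmas Q_inv = hopf_bicovariant.P_inv[OF mirror, folded Q_mirror]
lemmas Q_ract = hopf_bicovariant.P_lact[OF mirror, folded Q_mirror]

lemma Q_lact: "Q (l a m) = (\<ointegral>a1 a2\<leftarrow>\<Delta> a. l a1 (r (Q m) (S a2)))"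
proof -
  have "Q (l a m) = (\<ointegral>a1 a2\<leftarrow>flip (\<Delta> a). l a2 (r (Q m) (S a1)))"
    using hopf_bicovariant.P_ract[OF mirror, folded Q_mirror, of a m] by simp
  also have "\<dots> = (\<ointegral>a1 a2\<leftarrow>\<Delta> a. l a1 (r (Q m) (S a2)))"
    by (rule tensor_lift_flip) (intro lin cbilinearI)
  finally show ?thesis .
qed

lemmas PQ_lin [lin] = clinear_compose[OF clinear_P] clinear_compose[OF clinear_Q]

text \<open>Woronowicz' braiding \<open>m\<^sub>(\<^sub>-\<^sub>2\<^sub>) n\<^sub>(\<^sub>0\<^sub>) S(n\<^sub>(\<^sub>1\<^sub>)) \<otimes> S(m\<^sub>(\<^sub>-\<^sub>1\<^sub>)) m\<^sub>(\<^sub>0\<^sub>) n\<^sub>(\<^sub>2\<^sub>)\<close> on representatives.\<close>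

definition sig :: "'m \<otimes> 'm \<Rightarrow> 'm \<otimes> 'm"
  where "sig t = (\<ointegral>m n\<leftarrow>t. \<ointegral>c x\<leftarrow>\<delta> m. \<ointegral>d y\<leftarrow>\<delta>' n. l c (Q y) \<otimes> r (P x) d)"

lemma clinear_sig: "clinear sig"
  unfolding sig_def[abs_def] by (intro lin cbilinearI clinear_coact)

lemma sig_pure: "sig (m \<otimes> n) = (\<ointegral>c x\<leftarrow>\<delta> m. \<ointegral>d y\<leftarrow>\<delta>' n. l c (Q y) \<otimes> r (P x) d)"
  unfolding sig_def by (rule tensor_lift_pure) (intro lin cbilinearI)

lemma sig_lact: "sig (l a m \<otimes> n) = tensor_map (l a) id (sig (m \<otimes> n))"
proof -
  have la: "clinear (l a)" by (rule bilinear_lin(3)[OF l_bilin])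
  have "sig (l a m \<otimes> n) = (\<ointegral>a1 a2\<leftarrow>\<Delta> a. \<ointegral>c x\<leftarrow>\<delta> m. \<ointegral>d y\<leftarrow>\<delta>' n. l (\<kappa> a1 c) (Q y) \<otimes> r (P (l a2 x)) d)"
    unfolding sig_pure by (rule colin_lift[OF l_colin(1)]) (intro lin cbilinearI)
  also have "\<dots> = (\<ointegral>a1 a2\<leftarrow>\<Delta> a. \<epsilon> a2 *\<^sub>C (\<ointegral>c x\<leftarrow>\<delta> m. \<ointegral>d y\<leftarrow>\<delta>' n. l (\<kappa> a1 c) (Q y) \<otimes> r (P x) d))"
    by (simp add: P_lact bilinear_scale[OF r_bilin] scale_pure tensor_lift_scale_inner)
  also have "\<dots> = (\<ointegral>c x\<leftarrow>\<delta> m. \<ointegral>d y\<leftarrow>\<delta>' n. l (\<kappa> a c) (Q y) \<otimes> r (P x) d)"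
    by (rule counit_lift_right[OF comod_self']) (intro lin cbilinearI)
  also have "\<dots> = tensor_map (l a) id (sig (m \<otimes> n))"
    by (simp only: sig_pure clinear_tensor_lift_pull[OF clinear_tensor_map[OF la clinear_id]]
        tensor_map_pure[OF la clinear_id] l_mult id_apply)
  finally show ?thesis .
qed

lemma sig_ract: "sig (m \<otimes> r n a) = tensor_map id (\<lambda>n. r n a) (sig (m \<otimes> n))"
proof -
  have ra: "clinear (\<lambda>n. r n a)" by (intro lin)
  have "sig (m \<otimes> r n a) = (\<ointegral>c x\<leftarrow>\<delta> m. \<ointegral>d y\<leftarrow>\<delta>' n. \<ointegral>a1 a2\<leftarrow>\<Delta>' a. l c (Q (r y a2)) \<otimes> r (P x) (\<kappa> d a1))"
    unfolding sig_pure by (subst colin_lift[OF r_colin(2)]) (intro lin cbilinearI, rule refl)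
  also have "\<dots> = (\<ointegral>c x\<leftarrow>\<delta> m. \<ointegral>d y\<leftarrow>\<delta>' n. \<ointegral>a2 a1\<leftarrow>\<Delta> a. \<epsilon> a2 *\<^sub>C (l c (Q y) \<otimes> r (P x) (\<kappa> d a1)))"
    unfolding comp_def
    by (subst tensor_lift_flip, intro lin cbilinearI) (simp add: Q_ract bilinear_scale[OF l_bilin] scale_pure)
  also have "\<dots> = (\<ointegral>c x\<leftarrow>\<delta> m. \<ointegral>d y\<leftarrow>\<delta>' n. l c (Q y) \<otimes> r (P x) (\<kappa> d a))"
    by (subst counit_lift[OF comod_self]) (intro lin, rule refl)
  also have "\<dots> = tensor_map id (\<lambda>n. r n a) (sig (m \<otimes> n))"
    by (simp only: sig_pure clinear_tensor_lift_pull[OF clinear_tensor_map[OF clinear_id ra]]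
        tensor_map_pure[OF clinear_id ra] r_mult id_apply)
  finally show ?thesis .
qed

text \<open>Both terms expand into the same legs and differ only in the side of the tensor sign on
  which S(q_2) stands, so each summand of the difference is a negated balancing generator.\<close>

lemma sig_balanced: "sig (r m a \<otimes> n) - sig (m \<otimes> l a n) \<in> bal"
proof -
  have "sig (r m a \<otimes> n) = (\<ointegral>c x\<leftarrow>\<delta> m. \<ointegral>a1 a2\<leftarrow>\<Delta> a. \<ointegral>d y\<leftarrow>\<delta>' n. l (\<kappa> c a1) (Q y) \<otimes> r (P (r x a2)) d)"
    unfolding sig_pure by (rule colin_lift[OF r_colin(1)]) (intro lin cbilinearI)
  also have "\<dots> = (\<ointegral>c x\<leftarrow>\<delta> m. \<ointegral>a1 a2\<leftarrow>\<Delta> a. \<ointegral>d y\<leftarrow>\<delta>' n. \<ointegral>b1 b2\<leftarrow>\<Delta> a2.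
      l c (l a1 (Q y)) \<otimes> l (S b1) (r (P x) (\<kappa> b2 d)))"
    by (simp only: P_ract bilinear_tensor_lift[OF r_bilin] tensor_lift_pure_right l_mult r_mult l_r)
  also have "\<dots> = (\<ointegral>c x\<leftarrow>\<delta> m. \<ointegral>a1 a2\<leftarrow>\<Delta> a. \<ointegral>b1 b2\<leftarrow>\<Delta> a2. \<ointegral>d y\<leftarrow>\<delta>' n.
      l c (l a1 (Q y)) \<otimes> l (S b1) (r (P x) (\<kappa> b2 d)))"
    by (subst tensor_lift_swap) (rule refl)
  also have "\<dots> = (\<ointegral>c x\<leftarrow>\<delta> m. \<ointegral>q p\<leftarrow>\<Delta> a. \<ointegral>q1 q2\<leftarrow>\<Delta> q. \<ointegral>d y\<leftarrow>\<delta>' n.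
      l c (l q1 (Q y)) \<otimes> l (S q2) (r (P x) (\<kappa> p d)))" (is "_ = ?L")
    by (subst comod_coassoc[OF comod_self]) (intro ctrilinearI lin, rule refl)
  finally have L: "sig (r m a \<otimes> n) = ?L" .
  have "sig (m \<otimes> l a n) = (\<ointegral>c x\<leftarrow>\<delta> m. \<ointegral>p q\<leftarrow>\<Delta>' a. \<ointegral>d y\<leftarrow>\<delta>' n. l c (Q (l q y)) \<otimes> r (P x) (\<kappa> p d))"
    unfolding sig_pure by (subst colin_lift[OF l_colin(2)]) (intro lin cbilinearI, rule refl)
  also have "\<dots> = (\<ointegral>c x\<leftarrow>\<delta> m. \<ointegral>q p\<leftarrow>\<Delta> a. \<ointegral>d y\<leftarrow>\<delta>' n. l c (Q (l q y)) \<otimes> r (P x) (\<kappa> p d))"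
    unfolding comp_def
    by (subst tensor_lift_flip, intro lin cbilinearI) (rule refl)
  also have "\<dots> = (\<ointegral>c x\<leftarrow>\<delta> m. \<ointegral>q p\<leftarrow>\<Delta> a. \<ointegral>d y\<leftarrow>\<delta>' n. \<ointegral>q1 q2\<leftarrow>\<Delta> q.
      r (l c (l q1 (Q y))) (S q2) \<otimes> r (P x) (\<kappa> p d))"
    by (simp only: Q_lact bilinear_tensor_lift[OF l_bilin] tensor_lift_pure_left l_r)
  also have "\<dots> = (\<ointegral>c x\<leftarrow>\<delta> m. \<ointegral>q p\<leftarrow>\<Delta> a. \<ointegral>q1 q2\<leftarrow>\<Delta> q. \<ointegral>d y\<leftarrow>\<delta>' n.
      r (l c (l q1 (Q y))) (S q2) \<otimes> r (P x) (\<kappa> p d))" (is "_ = ?R")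
    by (subst tensor_lift_swap) (rule refl)
  finally have R: "sig (m \<otimes> l a n) = ?R" .
  have sub: "complex_vector.subspace bal"
    unfolding bal_def by (rule complex_vector.subspace_span)
  have "m \<otimes> l a n - r m a \<otimes> n \<in> bal" for m a n
    using complex_vector.subspace_neg[OF sub, of "r m a \<otimes> n - m \<otimes> l a n"]
    unfolding bal_def by (auto intro: complex_vector.span_base)
  then show ?thesis
    unfolding L R tensor_lift_diff[symmetric]
    by (intro tensor_lift_mem_subspace[OF sub])
qed

lemma sig_inv:
  assumes "\<delta> \<omega> = u \<otimes> \<omega>" "\<delta>' \<eta> = u \<otimes> \<eta>"
  shows "sig (\<omega> \<otimes> \<eta>) = \<eta> \<otimes> \<omega>"
  unfolding sig_pure assms
  by (subst tensor_lift_pure, intro lin cbilinearI, subst tensor_lift_pure, intro lin cbilinearI)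
    (simp add: l_unit r_unit P_left_inv Q_right_inv assms)

text \<open>\<open>P_recover\<close> and \<open>Q_recover\<close> write every pure tensor as a sum
  of tensors of this shape. The uniqueness of the braiding rests on it.\<close>

lemma invariant_tensors_span:
  assumes "complex_vector.subspace W"
    and "\<And>a b \<omega> \<eta>. \<delta> \<omega> = u \<otimes> \<omega> \<Longrightarrow> \<delta>' \<eta> = u \<otimes> \<eta> \<Longrightarrow> l a \<omega> \<otimes> r \<eta> b \<in> W"
  shows "t \<in> W"
proof -
  have eq: "m \<otimes> n = (\<ointegral>c x\<leftarrow>\<delta> m. \<ointegral>d y\<leftarrow>\<delta>' n. l c (P x) \<otimes> r (Q y) d)" for m n
    by (simp only: P_recover Q_recover tensor_lift_pure_left[symmetric] tensor_lift_pure_right[symmetric])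
  have "m \<otimes> n \<in> W" for m n
    by (subst eq) (intro tensor_lift_mem_subspace[OF assms(1)] assms(2) P_inv Q_inv)
  then have "(\<ointegral>m n\<leftarrow>t. m \<otimes> n) \<in> W"
    by (intro tensor_lift_mem_subspace[OF assms(1)])
  then show ?thesis by (simp add: tensor_lift_pure_self)
qed

end

section \<open>Invariant metrics as bilinear forms\<close>

text \<open>Operators of commuting coactions commute, so those of one side cannot destroy invariance
  for the other.\<close>

lemma lop_inv_stable:
  assumes "cocommute \<delta> \<delta>'" "clinear \<delta>" "clinear \<delta>'" "clinear \<psi>" "\<delta> m = w \<otimes> m"
  shows "\<delta> (lop \<delta>' \<psi> m) = w \<otimes> lop \<delta>' \<psi> m"
proof (rule tensor_separate)
  fix \<phi> :: "'b \<Rightarrow> complex" assume \<phi>: "clinear \<phi>"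
  note [lin] = clinear_compose[OF \<phi>]
  have "(\<ointegral>a x\<leftarrow>\<delta> (lop \<delta>' \<psi> m). \<phi> a *\<^sub>C x) = lop \<delta>' \<psi> (lop \<delta> \<phi> m)"
    using cocommute_lop[OF assms(1-3) \<phi> assms(4), of m] by (simp add: lop_def[of \<delta> \<phi>])
  also have "\<dots> = \<phi> w *\<^sub>C lop \<delta>' \<psi> m"
    by (simp only: lop_inv[OF \<phi>, of \<delta>, OF assms(5)] clinear_scale[OF clinear_lop[OF assms(3,4)]])
  also have "\<dots> = (\<ointegral>a x\<leftarrow>w \<otimes> lop \<delta>' \<psi> m. \<phi> a *\<^sub>C x)"
    by (rule tensor_lift_pure[symmetric]) (intro lin cbilinearI)
  finally show "(\<ointegral>a x\<leftarrow>\<delta> (lop \<delta>' \<psi> m). \<phi> a *\<^sub>C x) = (\<ointegral>a x\<leftarrow>w \<otimes> lop \<delta>' \<psi> m. \<phi> a *\<^sub>C x)" .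
qed

context bicovariant
begin

text \<open>The bilinear form behind a bi-invariant metric: the second clause makes it descend to
  classes, and the clause with \<omega> and \<eta> is braiding symmetry. That clause carries the
  coefficient \<open>a\<close> because a metric need not be left linear.\<close>

definition metric_form :: "('m \<Rightarrow> 'm \<Rightarrow> 'a) \<Rightarrow> bool"
  where "metric_form G \<longleftrightarrow> cbilinear G \<and>
    (\<forall>m a n. G (r m a) n = G m (l a n)) \<and>
    (\<forall>m n a. G m (r n a) = \<kappa> (G m n) a) \<and>
    colin \<kappa> \<delta> \<delta> \<Delta> G \<and> colin \<kappa> \<delta>' \<delta>' \<Delta>' G \<and>
    (\<forall>a \<omega> \<eta>. \<delta> \<omega> = u \<otimes> \<omega> \<longrightarrow> \<delta>' \<eta> = u \<otimes> \<eta> \<longrightarrow> G (l a \<omega>) \<eta> = G (l a \<eta>) \<omega>) \<and>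
    (\<forall>\<rho>. (\<forall>\<nu>. G \<rho> \<nu> = 0) \<longrightarrow> \<rho> = 0)"

lemma metric_formD:
  assumes "metric_form G"
  shows "cbilinear G" "G (r m a) n = G m (l a n)" "G m (r n a) = \<kappa> (G m n) a"
    "colin \<kappa> \<delta> \<delta> \<Delta> G" "colin \<kappa> \<delta>' \<delta>' \<Delta>' G"
    "\<delta> \<omega> = u \<otimes> \<omega> \<Longrightarrow> \<delta>' \<eta> = u \<otimes> \<eta> \<Longrightarrow> G (l a \<omega>) \<eta> = G (l a \<eta>) \<omega>"
    "(\<And>\<nu>. G \<rho> \<nu> = 0) \<Longrightarrow> \<rho> = 0"
  using assms by (auto simp: metric_form_def)

text \<open>Invariance of both arguments makes the value coinvariant in A, and the counit law shows
  that a coinvariant element is a multiple of \<open>u\<close>.\<close>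

lemma right_inv_scalar:
  assumes "colin \<kappa> \<delta>' \<delta>' \<Delta>' G" "cbilinear G" "\<delta>' m = u \<otimes> m" "\<delta>' n = u \<otimes> n"
  shows "G m n = \<epsilon> (G m n) *\<^sub>C u"
proof -
  have "flip (\<Delta> (G m n)) = u \<otimes> G m n"
    using assms by (simp add: colin_def tensor_map2_pure mult_bilin unit_left)
  then have "\<Delta> (G m n) = G m n \<otimes> u"
    by (metis flip_flip flip_pure)
  then have "lop \<Delta> \<epsilon> (G m n) = \<epsilon> (G m n) *\<^sub>C u"
    by (simp add: lop_def, subst tensor_lift_pure) (intro lin cbilinearI clinear_counit, rule refl)
  then show ?thesis by (simp add: comodD(4)[OF comod_self])
qed

end

context hopf_bicovariant
begin

text \<open>Colinearity controls only the product e f of the coefficients of \<open>\<rho>\<close>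
  and \<open>\<nu>\<close>. Inserting f S(d), which contracts to the counit, isolates e: the sum
  becomes a linear function of the coaction on \<open>G \<rho> y\<close>, which is zero.\<close>

lemma kernel_stable:
  assumes "cbilinear G" "colin \<kappa> \<delta>' \<delta>' \<Delta>' G" "clinear \<phi>" and zero: "\<And>\<nu>. G \<rho> \<nu> = 0"
  shows "G (lop \<delta>' \<phi> \<rho>) \<nu> = 0"
proof -
  note [lin] = clinear_compose[OF assms(3)] bilinear_lin(1,2)[OF assms(1)]
  have "G (lop \<delta>' \<phi> \<rho>) \<nu> = (\<ointegral>e p\<leftarrow>\<delta>' \<rho>. \<phi> e *\<^sub>C G p \<nu>)"
    by (simp only: lop_def bilinear_tensor_lift[OF assms(1)] bilinear_scale[OF assms(1)])
  also have "\<dots> = (\<ointegral>e p\<leftarrow>\<delta>' \<rho>. \<ointegral>c z\<leftarrow>\<delta>' \<nu>. \<epsilon> c *\<^sub>C \<phi> e *\<^sub>C G p z)"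
    by (subst counit_lift[OF comod_right]) (intro lin, rule refl)
  also have "\<dots> = (\<ointegral>e p\<leftarrow>\<delta>' \<rho>. \<ointegral>c z\<leftarrow>\<delta>' \<nu>. \<ointegral>f d\<leftarrow>\<Delta> c. \<phi> (\<kappa> e (\<kappa> f (S d))) *\<^sub>C G p z)"
  proof -
    have k: "clinear (\<lambda>x. \<phi> (\<kappa> e x))" for e by (intro lin)
    have "(\<ointegral>f d\<leftarrow>\<Delta> c. \<phi> (\<kappa> e (\<kappa> f (S d))) *\<^sub>C z) = \<epsilon> c *\<^sub>C \<phi> e *\<^sub>C z" for c e and z :: 'a
      unfolding scaleC_tensor_lift[symmetric] clinear_tensor_lift_pull[OF k, symmetric] antipode_right
        clinear_scale[OF k]
      by (simp add: unit_right scaleC_scaleC scaleC_complex_def)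
    then show ?thesis by simp
  qed
  also have "\<dots> = (\<ointegral>e p\<leftarrow>\<delta>' \<rho>. \<ointegral>c z\<leftarrow>\<delta>' \<nu>. \<ointegral>d f\<leftarrow>\<Delta>' c. \<phi> (\<kappa> e (\<kappa> f (S d))) *\<^sub>C G p z)"
    unfolding comp_def by (subst tensor_lift_flip) (intro lin cbilinearI, rule refl)
  also have "\<dots> = (\<ointegral>e p\<leftarrow>\<delta>' \<rho>. \<ointegral>d y\<leftarrow>\<delta>' \<nu>. \<ointegral>f z\<leftarrow>\<delta>' y. \<phi> (\<kappa> e (\<kappa> f (S d))) *\<^sub>C G p z)"
    by (subst comod_coassoc[OF comod_right]) (intro lin ctrilinearI, rule refl)
  also have "\<dots> = (\<ointegral>d y\<leftarrow>\<delta>' \<nu>. \<ointegral>e p\<leftarrow>\<delta>' \<rho>. \<ointegral>f z\<leftarrow>\<delta>' y. \<phi> (\<kappa> (\<kappa> e f) (S d)) *\<^sub>C G p z)"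
    by (subst tensor_lift_swap) (simp add: mult_assoc)
  also have "\<dots> = (\<ointegral>d y\<leftarrow>\<delta>' \<nu>. \<ointegral>c z\<leftarrow>\<Delta>' (G \<rho> y). \<phi> (\<kappa> c (S d)) *\<^sub>C z)"
    by (subst colin_lift[OF assms(2)]) (intro lin cbilinearI, rule refl)
  also have "\<dots> = 0"
  proof -
    have "clinear (\<lambda>t. \<ointegral>c z\<leftarrow>\<Delta>' t. \<phi> (\<kappa> c (S d)) *\<^sub>C z)" for d
      by (intro clinear_tensor_lift_arg[OF _ clinear_comult'] lin cbilinearI)
    from clinear_zero[OF this] show ?thesis by (simp add: zero del: comp_apply)
  qed
  finally show ?thesis .
qed

text \<open>The kernel of a right-colinear form is a right subcomodule, hence generated by its
  right-invariant elements.\<close>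

lemma nondegenerateI:
  assumes "cbilinear G" "colin \<kappa> \<delta>' \<delta>' \<Delta>' G" "\<And>m a n. G (r m a) n = G m (l a n)"
    and inv: "\<And>\<eta>. \<delta>' \<eta> = u \<otimes> \<eta> \<Longrightarrow> (\<And>\<nu>. G \<eta> \<nu> = 0) \<Longrightarrow> \<eta> = 0"
    and \<rho>: "\<And>\<nu>. G \<rho> \<nu> = 0"
  shows "\<rho> = 0"
proof -
  define K where "K = {\<rho>. \<forall>\<nu>. G \<rho> \<nu> = 0}"
  note [lin] = bilinear_lin(1,2)[OF assms(1)]
  have K: "(\<ointegral>c x\<leftarrow>\<delta>' \<rho>. \<phi> c *\<^sub>C x) \<in> K" if "clinear \<phi>" "\<rho> \<in> K" for \<phi> \<rho>
    using kernel_stable[OF assms(1,2) that(1), of \<rho>] that(2) unfolding K_def lop_def by blast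
  \<comment> \<open>By \<open>kernel_stable\<close> every slice of the coaction of
    \<open>\<rho>\<close> lies in \<open>K\<close>; balancing moves the right action in
    \<open>Q\<close> to the second argument, so \<open>Q \<rho>\<close> is a right-invariant element
    of the kernel.\<close>
  have Q0: "Q \<rho> = 0" if "\<rho> \<in> K" for \<rho>
  proof (rule inv[OF Q_inv])
    fix \<nu>
    have "G (Q \<rho>) \<nu> = (\<ointegral>c x\<leftarrow>\<delta>' \<rho>. G x (l (S c) \<nu>))"
      by (simp only: Q_def bilinear_tensor_lift[OF assms(1)] assms(3))
    also have "\<dots> = 0"
      by (rule tensor_lift_vanish[OF _ K[OF _ that]]) (intro lin cbilinearI, assumption, simp add: K_def)
    finally show "G (Q \<rho>) \<nu> = 0" .
  qed
  have "(\<ointegral>c x\<leftarrow>\<delta>' \<rho>. r (Q x) c) = 0"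
  proof (rule tensor_lift_vanish[OF _ K])
    show "cbilinear (\<lambda>c x. r (Q x) c)" by (intro lin cbilinearI)
    show "\<rho> \<in> K" using \<rho> by (simp add: K_def)
    show "r (Q x) c = 0" if "x \<in> K" for c x
      by (simp add: Q0[OF that] clinear_zero[OF cbilinearD2[OF r_bilin]])
  qed
  then show ?thesis by (simp add: Q_recover)
qed

end

section \<open>Deformation of bimodules and metric forms\<close>

locale bicovariant_cocycle =
  cocycle \<kappa> u \<Delta> \<epsilon> \<gamma> \<gamma>b + bicovariant \<kappa> u \<Delta> \<epsilon> l r \<delta> \<delta>'
  for \<kappa> :: "'a::complex_vector \<Rightarrow> 'a \<Rightarrow> 'a" and u \<Delta> \<epsilon> \<gamma> \<gamma>b
    and l :: "'a \<Rightarrow> 'm::complex_vector \<Rightarrow> 'm" and r \<delta> \<delta>'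
begin

definition "l\<gamma> = dpair \<gamma> \<gamma>b \<Delta> \<Delta>' \<delta> \<delta>' l"
definition "r\<gamma> = dpair \<gamma> \<gamma>b \<delta> \<delta>' \<Delta> \<Delta>' r"

lemmas clin = clinear_cocycle clinear_comult clinear_comult' clinear_coact

lemma deformed_bicovariant: "bicovariant \<kappa>\<gamma> u \<Delta> \<epsilon> l\<gamma> r\<gamma> \<delta> \<delta>'"
proof (intro bicovariant.intro bicovariant_axioms.intro)
  show "bialgebra \<kappa>\<gamma> u \<Delta> \<epsilon>" by (rule deformed_bialgebra)
  show "bicomod \<Delta> \<epsilon> \<delta> \<delta>'" by (rule bico)
  show "cbilinear l\<gamma>" "cbilinear r\<gamma>"
    unfolding l\<gamma>_def r\<gamma>_def by (intro cbilinear_dpair l_bilin r_bilin clin)+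
  show "l\<gamma> u m = m" "r\<gamma> m u = m" for m
    unfolding l\<gamma>_def r\<gamma>_def
    by (simp_all add: dpair_unit[OF bico] l_bilin r_bilin l_unit r_unit)
  show "l\<gamma> (\<kappa>\<gamma> a b) m = l\<gamma> a (l\<gamma> b m)" for a b m
    unfolding l\<gamma>_def \<kappa>\<gamma>_def
    by (rule dpair_assoc[OF self self bico _ _ _ _ mult_bilin comult_mult comult_mult_flip
          l_bilin l_colin l_bilin l_bilin l_mult]) (intro clin)+
  show "r\<gamma> m (\<kappa>\<gamma> a b) = r\<gamma> (r\<gamma> m a) b" for m a b
    unfolding r\<gamma>_def \<kappa>\<gamma>_def
    by (rule dpair_assoc[OF bico self self _ _ _ _ r_bilin r_colin mult_bilin comult_mult comult_mult_flip
          r_bilin r_bilin r_mult[symmetric], symmetric]) (intro clin)+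
  show "r\<gamma> (l\<gamma> a m) b = l\<gamma> a (r\<gamma> m b)" for a m b
    unfolding l\<gamma>_def r\<gamma>_def
    by (rule dpair_assoc[OF self bico self _ _ _ _ l_bilin l_colin r_bilin r_colin
          r_bilin l_bilin l_r]) (intro clin)+
  show "colin \<kappa>\<gamma> \<Delta> \<delta> \<delta> l\<gamma>" "colin \<kappa>\<gamma> \<Delta>' \<delta>' \<delta>' l\<gamma>"
    unfolding l\<gamma>_def \<kappa>\<gamma>_def
    by (rule dpair_colin_left[OF self bico _ l_bilin l_colin(1)]
        dpair_colin_right[OF self bico _ l_bilin l_colin(2)], rule clin)+
  show "colin \<kappa>\<gamma> \<delta> \<Delta> \<delta> r\<gamma>" "colin \<kappa>\<gamma> \<delta>' \<Delta>' \<delta>' r\<gamma>"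
    unfolding r\<gamma>_def \<kappa>\<gamma>_def
    by (rule dpair_colin_left[OF bico self _ r_bilin r_colin(1)]
        dpair_colin_right[OF bico self _ r_bilin r_colin(2)], rule clin)+
qed

abbreviation "G\<gamma> \<equiv> dpair \<gamma> \<gamma>b \<delta> \<delta>' \<delta> \<delta>'"

text \<open>\<open>\<sigma>\<close> is not the braiding but the diagonal coaction on the tensor square.\<close>

definition "\<sigma> = (\<lambda>t. tensor_map (tensor_lift \<kappa>) (tensor_lift (\<otimes>)) (tens \<delta> \<delta> t))"
definition "\<sigma>' = (\<lambda>t. tensor_map (tensor_lift \<kappa>) (tensor_lift (\<otimes>)) (tens \<delta>' \<delta>' t))"

lemma clinear_\<sigma>: "clinear \<sigma>" "clinear \<sigma>'"
  unfolding \<sigma>_def \<sigma>'_def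
  by (rule clinear_compose[OF clinear_tensor_map]; intro clinear_tensor_lift mult_bilin
      cbilinear_tensor_pure clinear_tens clin)+

lemma comod_map_\<sigma>:
  "comod_map (tens \<delta> \<delta>) \<sigma> (tensor_lift \<kappa>) id" "comod_map (tens \<delta>' \<delta>') \<sigma>' (tensor_lift \<kappa>) id"
  by (simp_all add: comod_map_def \<sigma>_def \<sigma>'_def clinear_tensor_lift mult_bilin clinear_ident
      tensor_lift_pure_self[abs_def] id_def)

lemma lop_\<sigma>: "clinear \<phi> \<Longrightarrow> lop \<sigma> \<phi> t = lop (tens \<delta> \<delta>) (\<lambda>t. \<phi> (tensor_lift \<kappa> t)) t"
  and lop_\<sigma>': "clinear \<phi> \<Longrightarrow> lop \<sigma>' \<phi> t = lop (tens \<delta>' \<delta>') (\<lambda>t. \<phi> (tensor_lift \<kappa> t)) t"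
  using lop_comod_map[OF comod_map_\<sigma>(1)] lop_comod_map[OF comod_map_\<sigma>(2)] by simp_all

lemma colin_\<sigma>: "colin \<kappa> \<delta> \<delta> \<sigma> (\<otimes>)" "colin \<kappa> \<delta>' \<delta>' \<sigma>' (\<otimes>)"
  by (simp_all add: colin_def \<sigma>_def \<sigma>'_def tensor_map_tens mult_bilin cbilinear_tensor_pure clin)

text \<open>Separates the operators on \<open>t\<close> from the legs of \<open>a\<close>, so that a
  comparison of two tensors \<open>t\<close> can be made for each pair of functionals acting on
  them.\<close>

lemma dpair_expand:
  assumes "cbilinear \<mu>" "clinear \<theta>" "clinear \<theta>'"
  shows "dpair \<gamma> \<gamma>b \<Delta> \<Delta>' \<theta> \<theta>' \<mu> a t
    = (\<ointegral>a1 x\<leftarrow>\<Delta> a. \<ointegral>a2 y\<leftarrow>\<Delta>' x. \<mu> y (lop \<theta>' (\<lambda>c. \<gamma>b (a2 \<otimes> c)) (lop \<theta> (\<lambda>c. \<gamma> (a1 \<otimes> c)) t)))"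
proof -
  have *: "lop (tens d e) \<phi> (a \<otimes> t) = (\<ointegral>a1 x\<leftarrow>d a. x \<otimes> lop e (\<lambda>c. \<phi> (a1 \<otimes> c)) t)"
    if "clinear \<phi>" "clinear d" "clinear e" for \<phi> d and e :: "'b \<Rightarrow> 'a \<otimes> 'b" and a :: 'a and t
    unfolding lop_tens_pure[OF that] unfolding lop_def by (simp add: pull scale_pure)
  have lin': "clinear (\<lambda>t. tensor_lift \<mu> (lop (tens \<Delta>' \<theta>') \<gamma>b t))"
    by (rule clinear_compose[OF clinear_tensor_lift[OF assms(1)] clinear_lop])
      (intro clinear_tens assms clin)+
  show ?thesis
    unfolding dpair_def twist_def *[OF clinear_cocycle(1) clinear_comult assms(2)]
      clinear_tensor_lift_pull[OF lin'] *[OF clinear_cocycle(2) clinear_comult' assms(3)]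
      clinear_tensor_lift_pull[OF clinear_tensor_lift[OF assms(1)]] tensor_lift_pure[OF assms(1)] ..
qed

text \<open>With the form written as \<open>\<mu> a (x \<otimes> y)\<close>, the deformed expression
  is an instance of associativity whose inner map is \<otimes> itself. The twist fixes both orders
  of the invariant pair, and the remaining diagonal operators keep the pair invariant, so the
  hypothesis on \<open>G\<close> applies.\<close>

lemma deformed_symmetric:
  assumes G: "cbilinear G" "\<And>a \<omega> \<eta>. \<delta> \<omega> = u \<otimes> \<omega> \<Longrightarrow> \<delta>' \<eta> = u \<otimes> \<eta> \<Longrightarrow> G (l a \<omega>) \<eta> = G (l a \<eta>) \<omega>"
    and inv: "\<delta> \<omega> = u \<otimes> \<omega>" "\<delta>' \<eta> = u \<otimes> \<eta>"
  shows "G\<gamma> G (l\<gamma> a \<omega>) \<eta> = G\<gamma> G (l\<gamma> a \<eta>) \<omega>"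
proof -
  define \<mu> where "\<mu> a t = tensor_lift G (tensor_map (l a) id t)" for a t
  have \<mu>_eq: "\<mu> a t = (\<ointegral>x y\<leftarrow>t. G (l a x) y)" for a t
    unfolding \<mu>_def by (rule tensor_lift_tensor_map[OF G(1) bilinear_lin(3)[OF l_bilin] clinear_id, simplified])
  note [lin] = bilinear_lin(1,2)[OF G(1)]
  have \<mu>: "cbilinear \<mu>" "\<mu> a (x \<otimes> y) = G (l a x) y" for a x y
    unfolding \<mu>_eq[abs_def] by (intro lin cbilinearI, rule tensor_lift_pure) (intro lin cbilinearI)
  have nested: "G\<gamma> G (l\<gamma> a x) y = dpair \<gamma> \<gamma>b \<Delta> \<Delta>' \<sigma> \<sigma>' \<mu> a (G\<gamma> (\<otimes>) x y)" for x y
    unfolding l\<gamma>_def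
    by (rule dpair_assoc[OF self bico bico _ _ _ _ l_bilin l_colin cbilinear_tensor_pure colin_\<sigma> G(1) \<mu>(1)])
      (simp_all add: clin clinear_\<sigma> \<mu>)
  have fixed: "G\<gamma> (\<otimes>) \<omega> \<eta> = \<omega> \<otimes> \<eta>" "G\<gamma> (\<otimes>) \<eta> \<omega> = \<eta> \<otimes> \<omega>"
    unfolding dpair_def tensor_lift_pure_self
    by (rule twist_left_right_inv[OF bico bico inv] twist_right_left_inv[OF bico bico inv(2,1)])+
  have "\<mu> y (lop \<sigma>' \<psi> (lop \<sigma> \<phi> (\<omega> \<otimes> \<eta>))) = \<mu> y (lop \<sigma>' \<psi> (lop \<sigma> \<phi> (\<eta> \<otimes> \<omega>)))"
    if "clinear \<phi>" "clinear \<psi>" for \<phi> \<psi> y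
  proof -
    have l: "clinear (\<lambda>t. \<phi> (tensor_lift \<kappa> t))" "clinear (\<lambda>t. \<psi> (tensor_lift \<kappa> t))"
      by (rule clinear_compose[OF _ clinear_tensor_lift[OF mult_bilin]], fact)+
    have k: "(\<lambda>c. \<phi> (tensor_lift \<kappa> (c \<otimes> u))) = \<phi>" "(\<lambda>c. \<phi> (tensor_lift \<kappa> (u \<otimes> c))) = \<phi>" for \<phi> :: "'a \<Rightarrow> complex"
      by (simp_all add: tensor_lift_pure[OF mult_bilin] unit_left unit_right)
    have \<eta>: "\<delta>' (lop \<delta> \<phi> \<eta>) = u \<otimes> lop \<delta> \<phi> \<eta>"
      by (rule lop_inv_stable[OF cocommute_sym[OF bicomodD(3)[OF bico]] clinear_coact(2,1) that(1) inv(2)])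
    have \<omega>: "\<delta> (lop \<delta>' \<psi> \<omega>) = u \<otimes> lop \<delta>' \<psi> \<omega>"
      by (rule lop_inv_stable[OF bicomodD(3)[OF bico] clinear_coact that(2) inv(1)])
    \<comment> \<open>Invariance leaves each diagonal operator only one factor to act on: the left
      one acts on \<open>\<eta>\<close>, the right one on \<open>\<omega>\<close>.\<close>
    have "lop \<sigma>' \<psi> (lop \<sigma> \<phi> (\<omega> \<otimes> \<eta>)) = lop \<delta>' \<psi> \<omega> \<otimes> lop \<delta> \<phi> \<eta>"
      by (simp only: lop_\<sigma>[OF that(1)] lop_\<sigma>'[OF that(2)]
          lop_tens_left_inv[where \<delta> = \<delta>, OF l(1) clinear_coact(1) clinear_coact(1) inv(1)]
          lop_tens_right_inv[where \<eta> = \<delta>', OF l(2) clinear_coact(2) clinear_coact(2) \<eta>] k)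
    moreover have "lop \<sigma>' \<psi> (lop \<sigma> \<phi> (\<eta> \<otimes> \<omega>)) = lop \<delta> \<phi> \<eta> \<otimes> lop \<delta>' \<psi> \<omega>"
      by (simp only: lop_\<sigma>[OF that(1)] lop_\<sigma>'[OF that(2)]
          lop_tens_right_inv[where \<eta> = \<delta>, OF l(1) clinear_coact(1) clinear_coact(1) inv(1)]
          lop_tens_left_inv[where \<delta> = \<delta>', OF l(2) clinear_coact(2) clinear_coact(2) \<eta>] k)
    ultimately show ?thesis
      using G(2)[OF \<omega> \<eta>] by (simp add: \<mu>(2))
  qed
  then show ?thesis
    unfolding nested fixed dpair_expand[OF \<mu>(1) clinear_\<sigma>]
    by (simp add: cocycle_lin lin)
qed

end

locale hopf_bicovariant_cocycle =
  hopf_cocycle \<kappa> u \<Delta> \<epsilon> S \<gamma> \<gamma>b + hopf_bicovariant \<kappa> u \<Delta> \<epsilon> S l r \<delta> \<delta>'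
  for \<kappa> :: "'a::complex_vector \<Rightarrow> 'a \<Rightarrow> 'a" and u \<Delta> \<epsilon> S \<gamma> \<gamma>b
    and l :: "'a \<Rightarrow> 'm::complex_vector \<Rightarrow> 'm" and r \<delta> \<delta>'
begin

sublocale bicovariant_cocycle \<kappa> u \<Delta> \<epsilon> \<gamma> \<gamma>b l r \<delta> \<delta>' ..

lemma deformed_hopf_bicovariant: "hopf_bicovariant \<kappa>\<gamma> u \<Delta> \<epsilon> S\<gamma> l\<gamma> r\<gamma> \<delta> \<delta>'"
  by (intro hopf_bicovariant.intro deformed_hopf deformed_bicovariant)

text \<open>Left invariance moves the cocycle from the pair \<open>(m, n)\<close> onto \<open>m\<close>, where it acts through
  the functional \<open>U\<close>.\<close>

lemma cocycle_through_metric: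
  assumes "cbilinear G" "colin \<kappa> \<delta> \<delta> \<Delta> G"
  shows "(\<ointegral>c x\<leftarrow>\<delta> m. \<ointegral>d y\<leftarrow>\<delta> n. \<gamma> (c \<otimes> d) * \<epsilon> (G x y))
    = (\<ointegral>c x\<leftarrow>\<delta> m. \<ointegral>a b\<leftarrow>\<Delta> c. \<gamma> (a \<otimes> \<kappa> (S b) (G x n)))"
proof -
  note [lin] = bilinear_lin(1,2)[OF assms(1)]
  \<comment> \<open>Left invariance reconstructs a value of the form from its counit, namely as
    x_(-1) n_(-1) \<epsilon>(G(x_0, n_0)).\<close>
  have G: "G x n = (\<ointegral>e p\<leftarrow>\<delta> x. \<ointegral>d y\<leftarrow>\<delta> n. \<epsilon> (G p y) *\<^sub>C \<kappa> e d)" for x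
  proof -
    have "G x n = (\<ointegral>a b\<leftarrow>\<Delta> (G x n). \<epsilon> b *\<^sub>C a)"
      by (rule counit_lift_right[OF comod_self' clinear_ident, symmetric])
    also have "\<dots> = (\<ointegral>e p\<leftarrow>\<delta> x. \<ointegral>d y\<leftarrow>\<delta> n. \<epsilon> (G p y) *\<^sub>C \<kappa> e d)"
      by (rule colin_lift[OF assms(2)]) (intro lin cbilinearI clinear_counit)
    finally show ?thesis .
  qed
  have k: "clinear (\<lambda>z. \<gamma> (a \<otimes> \<kappa> (S b) z))" "clinear (\<lambda>z. \<gamma> (a \<otimes> \<kappa> z d))" for a b d
    by (intro lin)+
  have "(\<ointegral>c x\<leftarrow>\<delta> m. \<ointegral>a b\<leftarrow>\<Delta> c. \<gamma> (a \<otimes> \<kappa> (S b) (G x n)))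
      = (\<ointegral>c x\<leftarrow>\<delta> m. \<ointegral>a b\<leftarrow>\<Delta> c. \<ointegral>e p\<leftarrow>\<delta> x. \<ointegral>d y\<leftarrow>\<delta> n. \<epsilon> (G p y) * \<gamma> (a \<otimes> \<kappa> (\<kappa> (S b) e) d))"
    unfolding G clinear_tensor_lift_pull[OF k(1)] clinear_scale[OF k(1)]
    by (simp add: scaleC_complex_def mult_assoc)
  \<comment> \<open>After regrouping, S(b) e contracts to the counit and only \<gamma>(a \<otimes>
    d) is left.\<close>
  also have "\<dots> = (\<ointegral>a z\<leftarrow>\<delta> m. \<ointegral>w p\<leftarrow>\<delta> z. \<ointegral>b e\<leftarrow>\<Delta> w. \<ointegral>d y\<leftarrow>\<delta> n. \<epsilon> (G p y) * \<gamma> (a \<otimes> \<kappa> (\<kappa> (S b) e) d))"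
    by (rule coassoc4[OF comod_left]) (intro lin)+
  also have "\<dots> = (\<ointegral>a z\<leftarrow>\<delta> m. \<ointegral>w p\<leftarrow>\<delta> z. \<ointegral>d y\<leftarrow>\<delta> n. \<ointegral>b e\<leftarrow>\<Delta> w. \<epsilon> (G p y) * \<gamma> (a \<otimes> \<kappa> (\<kappa> (S b) e) d))"
    by (subst tensor_lift_swap) (rule refl)
  also have "\<dots> = (\<ointegral>a z\<leftarrow>\<delta> m. \<ointegral>w p\<leftarrow>\<delta> z. \<epsilon> w *\<^sub>C (\<ointegral>d y\<leftarrow>\<delta> n. \<gamma> (a \<otimes> d) * \<epsilon> (G p y)))"
  proof -
    have "(\<ointegral>b e\<leftarrow>\<Delta> w. \<epsilon> z * \<gamma> (a \<otimes> \<kappa> (\<kappa> (S b) e) d)) = \<epsilon> w *\<^sub>C (\<gamma> (a \<otimes> d) * \<epsilon> z)" for w a d z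
      unfolding tensor_lift_mult_right[symmetric] clinear_tensor_lift_pull[OF k(2), symmetric]
        antipode_left clinear_scale[OF k(2)]
      by (simp add: unit_left scaleC_complex_def)
    then show ?thesis by (simp add: tensor_lift_scale_inner)
  qed
  also have "\<dots> = (\<ointegral>a z\<leftarrow>\<delta> m. \<ointegral>d y\<leftarrow>\<delta> n. \<gamma> (a \<otimes> d) * \<epsilon> (G z y))"
    by (subst counit_lift[OF comod_left]) (intro lin, rule refl)
  finally show ?thesis by simp
qed

lemma deformed_metric_right_inv:
  assumes G: "cbilinear G" "colin \<kappa> \<delta> \<delta> \<Delta> G" "colin \<kappa> \<delta>' \<delta>' \<Delta>' G"
    and inv: "\<delta>' \<eta> = u \<otimes> \<eta>" "\<delta>' \<theta> = u \<otimes> \<theta>"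
  shows "\<epsilon> (G\<gamma> G \<eta> \<theta>) = \<epsilon> (G (lop \<delta> U \<eta>) \<theta>)"
proof -
  note [lin] = bilinear_lin(1,2)[OF G(1)]
  have eG: "clinear (\<lambda>t. \<epsilon> (tensor_lift G t))" by (intro lin G)
  \<comment> \<open>Right invariance of \<open>\<eta>\<close> reduces the \<gamma>b part of the
    twist to the counit.\<close>
  have "twist \<gamma> \<gamma>b (tens \<delta> \<delta>) (tens \<delta>' \<delta>') (\<eta> \<otimes> \<theta>) = lop (tens \<delta> \<delta>) \<gamma> (\<eta> \<otimes> \<theta>)"
    unfolding twist_sym[OF bicomod_tens[OF bico bico] clinear_cocycle]
    by (simp add: twist_def lop_tens_left_inv[where \<delta> = \<delta>', OF clinear_cocycle(2) clinear_coact(2) clinear_coact(2) inv(1)]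
        inverse_unit comodD(4)[OF comod_right])
  then have "\<epsilon> (G\<gamma> G \<eta> \<theta>) = (\<ointegral>c x\<leftarrow>\<delta> \<eta>. \<ointegral>d y\<leftarrow>\<delta> \<theta>. \<gamma> (c \<otimes> d) * \<epsilon> (G x y))"
    by (simp only: dpair_def lop_tens_pure[OF clinear_cocycle(1) clinear_coact(1) clinear_coact(1)]
        clinear_tensor_lift_pull[OF eG] clinear_scale[OF eG] scaleC_complex_def tensor_lift_pure[OF G(1)])
  also have "\<dots> = (\<ointegral>c x\<leftarrow>\<delta> \<eta>. \<ointegral>a b\<leftarrow>\<Delta> c. \<gamma> (a \<otimes> \<kappa> (S b) (G x \<theta>)))"
    by (rule cocycle_through_metric[OF G(1,2)])
  also have "\<dots> = (\<ointegral>c x\<leftarrow>\<delta> \<eta>. \<ointegral>a b\<leftarrow>\<Delta> c. \<gamma> (a \<otimes> \<kappa> (S b) (\<epsilon> (G x \<theta>) *\<^sub>C u)))"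
  proof -
    \<comment> \<open>Each slice of the left coaction of \<open>\<eta>\<close> is right-invariant,
      so \<open>right_inv_scalar\<close> applies to it; \<open>tensor_lift_vanish\<close> turns this
      into an equality of the two sums.\<close>
    have "(\<ointegral>c x\<leftarrow>\<delta> \<eta>. (\<ointegral>a b\<leftarrow>\<Delta> c. \<gamma> (a \<otimes> \<kappa> (S b) (G x \<theta>)))
        - (\<ointegral>a b\<leftarrow>\<Delta> c. \<gamma> (a \<otimes> \<kappa> (S b) (\<epsilon> (G x \<theta>) *\<^sub>C u)))) = 0"
    proof (rule tensor_lift_vanish)
      show "(\<ointegral>c x\<leftarrow>\<delta> \<eta>. \<phi> c *\<^sub>C x) \<in> {x. \<delta>' x = u \<otimes> x}" if "clinear \<phi>" for \<phi>
        using lop_inv_stable[OF cocommute_sym[OF bicomodD(3)[OF bico]] clinear_coact(2,1) that inv(1)]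
        by (simp add: lop_def)
      show "(\<ointegral>a b\<leftarrow>\<Delta> c. \<gamma> (a \<otimes> \<kappa> (S b) (G x \<theta>)))
        - (\<ointegral>a b\<leftarrow>\<Delta> c. \<gamma> (a \<otimes> \<kappa> (S b) (\<epsilon> (G x \<theta>) *\<^sub>C u))) = 0" if "x \<in> {x. \<delta>' x = u \<otimes> x}" for c x
        using right_inv_scalar[OF G(3,1) _ inv(2), of x] that by simp
    qed (intro lin cbilinearI)
    then show ?thesis by (simp add: tensor_lift_diff)
  qed
  also have "\<dots> = (\<ointegral>c x\<leftarrow>\<delta> \<eta>. U c *\<^sub>C \<epsilon> (G x \<theta>))"
    by (simp add: bilinear_scale[OF mult_bilin] unit_right scale_pure clinear_scale[OF clinear_cocycle(1)]
        scaleC_complex_def tensor_lift_mult_right[symmetric] U_def mult.commute)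
  also have "\<dots> = \<epsilon> (G (lop \<delta> U \<eta>) \<theta>)"
    by (simp only: lop_def bilinear_tensor_lift[OF G(1)] bilinear_scale[OF G(1)]
        clinear_tensor_lift_pull[OF clinear_counit] clinear_scale[OF clinear_counit])
  finally show ?thesis .
qed

theorem deformed_metric_form:
  assumes "metric_form G"
  shows "bicovariant.metric_form \<kappa>\<gamma> u \<Delta> l\<gamma> r\<gamma> \<delta> \<delta>' (G\<gamma> G)"
proof -
  note G = metric_formD[OF assms]
  interpret d: hopf_bicovariant \<kappa>\<gamma> u \<Delta> \<epsilon> S\<gamma> l\<gamma> r\<gamma> \<delta> \<delta>' by (rule deformed_hopf_bicovariant)
  have bilin: "cbilinear (G\<gamma> G)"
    by (intro cbilinear_dpair G(1) clin)
  have bal: "G\<gamma> G (r\<gamma> m a) n = G\<gamma> G m (l\<gamma> a n)" for m a n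
    unfolding l\<gamma>_def r\<gamma>_def
    by (rule dpair_assoc[OF bico self bico _ _ _ _ r_bilin r_colin l_bilin l_colin G(1) G(1) G(2)]) (intro clin)+
  have right: "G\<gamma> G m (r\<gamma> n a) = \<kappa>\<gamma> (G\<gamma> G m n) a" for m n a
    unfolding r\<gamma>_def \<kappa>\<gamma>_def
    by (rule dpair_assoc[OF bico bico self _ _ _ _ G(1,4,5) r_bilin r_colin mult_bilin G(1) G(3)[symmetric], symmetric])
      (intro clin)+
  have colin: "colin \<kappa>\<gamma> \<delta> \<delta> \<Delta> (G\<gamma> G)" "colin \<kappa>\<gamma> \<delta>' \<delta>' \<Delta>' (G\<gamma> G)"
    unfolding \<kappa>\<gamma>_def
    by (rule dpair_colin_left[OF bico bico _ G(1,4)] dpair_colin_right[OF bico bico _ G(1,5)], rule clin)+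
  have "\<eta> = 0" if \<eta>: "\<delta>' \<eta> = u \<otimes> \<eta>" and zero: "\<And>\<nu>. G\<gamma> G \<eta> \<nu> = 0" for \<eta>
  proof -
    let ?\<zeta> = "lop \<delta> U \<eta>"
    have \<zeta>: "\<delta>' ?\<zeta> = u \<otimes> ?\<zeta>"
      by (rule lop_inv_stable[OF cocommute_sym[OF bicomodD(3)[OF bico]] clinear_coact(2,1) clinear_UV(1) \<eta>])
    \<comment> \<open>Both arguments are right-invariant, so the value is the scalar given by its
      counit, and that counit is a counit of the deformed form at \<open>\<eta>\<close>.\<close>
    have inv0: "G ?\<zeta> \<theta> = 0" if "\<delta>' \<theta> = u \<otimes> \<theta>" for \<theta>
      using deformed_metric_right_inv[OF G(1,4,5) \<eta> that] zero right_inv_scalar[OF G(5,1) \<zeta> that]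
      by (simp add: clinear_zero[OF clinear_counit])
    \<comment> \<open>Right linearity extends the vanishing from right-invariant arguments to all,
      since these generate from the right.\<close>
    have "G ?\<zeta> \<nu> = (\<ointegral>c x\<leftarrow>\<delta>' \<nu>. G ?\<zeta> (r (Q x) c))" for \<nu>
      by (simp only: bilinear_tensor_lift[OF G(1), symmetric] Q_recover)
    also have "(\<ointegral>c x\<leftarrow>\<delta>' \<nu>. G ?\<zeta> (r (Q x) c)) = 0" for \<nu>
      by (simp add: G(3) inv0[OF Q_inv] clinear_zero[OF cbilinearD2[OF mult_bilin]])
    finally have "?\<zeta> = 0" by (rule G(7))
    have "\<eta> = lop \<delta> V ?\<zeta>"
      by (simp add: lop_lop[OF comod_left clinear_UV(2,1)] conv_UV comodD(4)[OF comod_left])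
    then show ?thesis
      by (simp add: \<open>?\<zeta> = 0\<close> clinear_zero[OF clinear_lop[OF clinear_coact(1) clinear_UV(2)]])
  qed
  then have "\<rho> = 0" if "\<And>\<nu>. G\<gamma> G \<rho> \<nu> = 0" for \<rho>
    by (rule d.nondegenerateI[OF bilin colin(2) bal _ that])
  then show ?thesis
    unfolding d.metric_form_def
    using bilin bal right colin deformed_symmetric[OF G(1,6)] by blast
qed

end

section \<open>Translation to the bundled structures\<close>

lemma tensor_assoc_map:
  assumes "clinear d"
  shows "tensor_assoc (tensor_map d id t) = (\<ointegral>a x\<leftarrow>t. \<ointegral>b c\<leftarrow>d a. b \<otimes> (c \<otimes> x))"
proof -
  have "tensor_assoc (s \<otimes> x) = (\<ointegral>b c\<leftarrow>s. b \<otimes> (c \<otimes> x))" for s :: "'b \<otimes> 'c" and x :: 'd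
    unfolding tensor_assoc_def by (rule tensor_lift_pure) (intro lin cbilinearI)
  then show ?thesis
    unfolding tensor_map_def clinear_tensor_lift_pull[OF clinear_tensor_assoc] by simp
qed

lemma tensor_map_id_expand: "tensor_map id d t = (\<ointegral>a x\<leftarrow>t. \<ointegral>b y\<leftarrow>d x. a \<otimes> (b \<otimes> y))"
  unfolding tensor_map_def by (simp add: tensor_lift_pure_right[symmetric] tensor_lift_pure_self)

lemma comod_iff:
  assumes "clinear \<Delta>" "clinear \<epsilon>" "clinear \<delta>"
  shows "comod \<Delta> \<epsilon> \<delta> \<longleftrightarrow>
    (\<forall>m. tensor_assoc (tensor_map \<Delta> id (\<delta> m)) = tensor_map id \<delta> (\<delta> m)) \<and>
    (\<forall>m. (\<ointegral>a x\<leftarrow>\<delta> m. \<epsilon> a *\<^sub>C x) = m)"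
  unfolding comod_def tensor_assoc_map[OF assms(1)] tensor_map_id_expand lop_def using assms by auto

lemma comod_flip_iff:
  assumes "clinear \<Delta>" "clinear \<epsilon>" "clinear \<rho>"
  shows "comod (flip \<circ> \<Delta>) \<epsilon> (flip \<circ> \<rho>) \<longleftrightarrow>
    (\<forall>m. tensor_assoc (tensor_map \<rho> id (\<rho> m)) = tensor_map id \<Delta> (\<rho> m)) \<and>
    (\<forall>m. (\<ointegral>x a\<leftarrow>\<rho> m. \<epsilon> a *\<^sub>C x) = m)"
proof -
  note [lin] = assms[THEN clinear_compose]
  have l: "clinear (flip \<circ> \<Delta>)" "clinear (flip \<circ> \<rho>)"
    unfolding comp_def by (intro lin)+
  \<comment> \<open>Reversing the legs turns right coassociativity into the left-handed law for the
    flipped coaction; \<open>rev'\<close> is the inverse, defined separately because the legs have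
    different types.\<close>
  define rev where "rev t = (\<ointegral>a s\<leftarrow>t. \<ointegral>b c\<leftarrow>s. c \<otimes> (b \<otimes> a))"
    for t :: "'b \<otimes> ('a \<otimes> 'a)"
  define rev' where "rev' t = (\<ointegral>a s\<leftarrow>t. \<ointegral>b c\<leftarrow>s. c \<otimes> (b \<otimes> a))"
    for t :: "'a \<otimes> ('a \<otimes> 'b)"
  have rev: "clinear rev" "rev (a \<otimes> (b \<otimes> c)) = c \<otimes> (b \<otimes> a)" for a b c
    unfolding rev_def[abs_def] by (intro lin cbilinearI, subst tensor_lift_pure, intro lin cbilinearI,
      rule tensor_lift_pure, intro lin cbilinearI)
  have rev': "clinear rev'" "rev' (a \<otimes> (b \<otimes> c)) = c \<otimes> (b \<otimes> a)" for a b c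
    unfolding rev'_def[abs_def] by (intro lin cbilinearI, subst tensor_lift_pure, intro lin cbilinearI,
      rule tensor_lift_pure, intro lin cbilinearI)
  let ?L = "\<lambda>m. \<ointegral>x c\<leftarrow>\<rho> m. \<ointegral>y d\<leftarrow>\<rho> x. y \<otimes> (d \<otimes> c)"
  let ?R = "\<lambda>m. \<ointegral>x c\<leftarrow>\<rho> m. \<ointegral>e d\<leftarrow>\<Delta> c. x \<otimes> (e \<otimes> d)"
  let ?L' = "\<lambda>m. \<ointegral>x c\<leftarrow>\<rho> m. \<ointegral>y d\<leftarrow>\<rho> x. c \<otimes> (d \<otimes> y)"
  let ?R' = "\<lambda>m. \<ointegral>x c\<leftarrow>\<rho> m. \<ointegral>e d\<leftarrow>\<Delta> c. d \<otimes> (e \<otimes> x)"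
  have "rev (?L m) = ?L' m" "rev (?R m) = ?R' m" "rev' (?L' m) = ?L m" "rev' (?R' m) = ?R m" for m
    by (simp_all add: clinear_tensor_lift_pull[OF rev(1)] clinear_tensor_lift_pull[OF rev'(1)] rev(2) rev'(2))
  then have "?L' m = ?R' m \<longleftrightarrow> ?L m = ?R m" for m
    by metis
  moreover have "(\<ointegral>c x\<leftarrow>flip (\<rho> m). \<ointegral>d y\<leftarrow>flip (\<rho> x). c \<otimes> (d \<otimes> y)) = ?L' m" for m
    by (subst tensor_lift_flip, intro lin cbilinearI, subst tensor_lift_flip) (intro lin cbilinearI, rule refl)
  moreover have "(\<ointegral>c x\<leftarrow>flip (\<rho> m). \<ointegral>d e\<leftarrow>flip (\<Delta> c). d \<otimes> (e \<otimes> x)) = ?R' m" for m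
    by (subst tensor_lift_flip, intro lin cbilinearI, subst tensor_lift_flip) (intro lin cbilinearI, rule refl)
  ultimately show ?thesis
    unfolding comod_def tensor_assoc_map[OF assms(3)] tensor_map_id_expand
    using l assms by (simp add: lop_flip)
qed

text \<open>The two laws differ by flipping the last two legs, which is invertible.\<close>

lemma cocommute_iff:
  assumes "clinear \<delta>" "clinear \<rho>"
  shows "cocommute \<delta> (flip \<circ> \<rho>) \<longleftrightarrow> (\<forall>m. tensor_map id \<rho> (\<delta> m) = tensor_assoc (tensor_map \<delta> id (\<rho> m)))"
proof -
  note [lin] = assms[THEN clinear_compose]
  have tf: "clinear (tensor_map id flip)" "tensor_map id flip (a \<otimes> (b \<otimes> c)) = a \<otimes> (c \<otimes> b)" for a b c
    by (simp_all add: clinear_tensor_map clinear_id clinear_flip tensor_map_pure)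
  let ?L = "\<lambda>m. \<ointegral>c x\<leftarrow>\<delta> m. \<ointegral>y d\<leftarrow>\<rho> x. c \<otimes> (y \<otimes> d)"
  let ?R = "\<lambda>m. \<ointegral>y d\<leftarrow>\<rho> m. \<ointegral>c x\<leftarrow>\<delta> y. c \<otimes> (x \<otimes> d)"
  let ?L' = "\<lambda>m. \<ointegral>c x\<leftarrow>\<delta> m. \<ointegral>y d\<leftarrow>\<rho> x. c \<otimes> (d \<otimes> y)"
  let ?R' = "\<lambda>m. \<ointegral>y d\<leftarrow>\<rho> m. \<ointegral>c x\<leftarrow>\<delta> y. c \<otimes> (d \<otimes> x)"
  have "tensor_map id flip (?L m) = ?L' m" "tensor_map id flip (?R m) = ?R' m"
    "tensor_map id flip (?L' m) = ?L m" "tensor_map id flip (?R' m) = ?R m" for m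
    by (simp_all add: clinear_tensor_lift_pull[OF tf(1)] tf(2))
  then have "?L' m = ?R' m \<longleftrightarrow> ?L m = ?R m" for m
    by metis
  moreover have "(\<ointegral>c x\<leftarrow>\<delta> m. \<ointegral>d y\<leftarrow>flip (\<rho> x). c \<otimes> (d \<otimes> y)) = ?L' m" for m
    by (subst tensor_lift_flip) (intro lin cbilinearI, rule refl)
  moreover have "(\<ointegral>d y\<leftarrow>flip (\<rho> m). \<ointegral>c x\<leftarrow>\<delta> y. c \<otimes> (d \<otimes> x)) = ?R' m" for m
    by (subst tensor_lift_flip) (intro lin cbilinearI, rule refl)
  ultimately show ?thesis
    unfolding cocommute_def tensor_assoc_map[OF assms(1)] tensor_map_id_expand by simp
qed

lemma colin_flip_iff:
  assumes "cbilinear \<kappa>" "cbilinear \<mu>"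
  shows "colin \<kappa> (flip \<circ> \<delta>) (flip \<circ> \<eta>) (flip \<circ> \<theta>) \<mu> \<longleftrightarrow> (\<forall>m n. \<theta> (\<mu> m n) = tensor_map2 \<mu> \<kappa> (\<delta> m) (\<eta> n))"
  unfolding colin_def comp_def flip_tensor_map2[OF assms(2,1), symmetric] by (metis flip_flip)

lemma hopf_algebra_iff:
  "hopf_algebra A \<longleftrightarrow> (\<exists>S. hopf (hmult A) (hone A) (comult A) (counit A) S)"
proof
  assume "hopf_algebra A"
  then interpret hopf_algebra A .
  from antipode_exists obtain S where S: "clinear S"
    "\<And>a. (\<ointegral>a1 a2\<leftarrow>comult A a. hmult A (S a1) a2) = counit A a *\<^sub>C hone A"
    "\<And>a. (\<ointegral>a1 a2\<leftarrow>comult A a. hmult A a1 (S a2)) = counit A a *\<^sub>C hone A"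
    by blast
  have "comod (comult A) (counit A) (comult A)"
    using coassoc counit_left by (simp add: comod_iff comult_linear counit_linear)
  then have "bicomod (comult A) (counit A) (comult A) (flip \<circ> comult A)"
    by (rule bicomod_self) (rule counit_right)
  then have "bialgebra (hmult A) (hone A) (comult A) (counit A)"
    by (intro bialgebra.intro)
      (simp_all add: mult_bilinear mult_assoc mult_one_left mult_one_right comult_one counit_mult
        counit_one colin_def comult_mult)
  then show "\<exists>S. hopf (hmult A) (hone A) (comult A) (counit A) S"
    using S by (auto intro!: exI[of _ S] hopf.intro hopf_axioms.intro)
next
  assume "\<exists>S. hopf (hmult A) (hone A) (comult A) (counit A) S"
  then obtain S where "hopf (hmult A) (hone A) (comult A) (counit A) S" ..
  then interpret h: hopf "hmult A" "hone A" "comult A" "counit A" S .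
  note comod = comod_iff[OF h.clinear_comult h.clinear_counit h.clinear_comult]
  show "hopf_algebra A"
  proof (rule hopf_algebra.intro)
    show "\<exists>S. clinear S \<and>
        (\<forall>a. (\<ointegral>a1 a2\<leftarrow>comult A a. hmult A (S a1) a2) = counit A a *\<^sub>C hone A) \<and>
        (\<forall>a. (\<ointegral>a1 a2\<leftarrow>comult A a. hmult A a1 (S a2)) = counit A a *\<^sub>C hone A)"
      using h.clinear_antipode h.antipode_left h.antipode_right by blast
    show "(\<ointegral>a1 a2\<leftarrow>comult A a. counit A a2 *\<^sub>C a1) = a" for a
      by (rule counit_lift_right[OF h.comod_self' clinear_ident])
    show "comult A (hmult A a b) = tensor_map2 (hmult A) (hmult A) (comult A a) (comult A b)" for a b
      using h.comult_mult by (simp add: colin_def)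
  qed (use h.comod_self comod in \<open>simp_all add: h.mult_bilin h.mult_assoc h.unit_left h.unit_right
      h.clinear_comult h.clinear_counit h.comult_unit h.counit_mult h.counit_unit\<close>)
qed

abbreviation bicovariant_data ::
    "'a::complex_vector hopf_data \<Rightarrow> ('a, 'm::complex_vector) bimod_data \<Rightarrow> bool"
  where "bicovariant_data A M \<equiv>
    bicovariant (hmult A) (hone A) (comult A) (counit A) (lact M) (ract M) (lcoact M) (flip \<circ> rcoact M)"

lemma bicovariant_bimodule_iff:
  "bicovariant_bimodule A M \<longleftrightarrow> hopf_algebra A \<and> bicovariant_data A M"
proof
  assume "bicovariant_bimodule A M"
  then interpret bicovariant_bimodule A M .
  have "hopf_algebra A" ..
  then obtain S where "hopf (hmult A) (hone A) (comult A) (counit A) S"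
    by (auto simp: hopf_algebra_iff)
  then interpret h: hopf "hmult A" "hone A" "comult A" "counit A" S .
  have 1: "comod (comult A) (counit A) (lcoact M)"
    using lcoact_coassoc lcoact_counit by (simp add: comod_iff comult_linear counit_linear lcoact_linear)
  have 2: "comod (flip \<circ> comult A) (counit A) (flip \<circ> rcoact M)"
    using rcoact_coassoc rcoact_counit by (simp add: comod_flip_iff comult_linear counit_linear rcoact_linear)
  have 3: "cocommute (lcoact M) (flip \<circ> rcoact M)"
    using coact_commute by (simp add: cocommute_iff lcoact_linear rcoact_linear)
  have "bicovariant_data A M"
  proof
    show "colin (hmult A) (flip \<circ> comult A) (flip \<circ> rcoact M) (flip \<circ> rcoact M) (lact M)"
      by (simp add: colin_flip_iff mult_bilinear lact_bilinear rcoact_lact)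
    show "colin (hmult A) (flip \<circ> rcoact M) (flip \<circ> comult A) (flip \<circ> rcoact M) (ract M)"
      by (simp add: colin_flip_iff mult_bilinear ract_bilinear rcoact_ract)
  qed (simp_all add: lact_bilinear ract_bilinear lact_mult lact_one ract_mult ract_one lact_ract bicomod_def
      1 2 3 comult_linear colin_def lcoact_lact lcoact_ract)
  with \<open>hopf_algebra A\<close> show "hopf_algebra A \<and> bicovariant_data A M" ..
next
  assume "hopf_algebra A \<and> bicovariant_data A M"
  then interpret hopf_algebra A + b: bicovariant "hmult A" "hone A" "comult A" "counit A" "lact M" "ract M"
      "lcoact M" "flip \<circ> rcoact M"
    by simp_all
  have rc: "clinear (rcoact M)"
    using clinear_compose[OF clinear_flip b.clinear_coact(2)] by simp
  note lin = comult_linear counit_linear b.clinear_coact(1) rc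
  note b1 = b.comod_left[unfolded comod_iff[OF lin(1-3)]]
  note b2 = b.comod_right[unfolded comod_flip_iff[OF lin(1,2,4)]]
  note b3 = bicomodD(3)[OF b.bico, unfolded cocommute_iff[OF lin(3,4)]]
  show "bicovariant_bimodule A M"
  proof (intro bicovariant_bimodule.intro bicovariant_bimodule_axioms.intro)
    show "rcoact M (lact M a m) = tensor_map2 (lact M) (hmult A) (comult A a) (rcoact M m)" for a m
      using b.l_colin(2) by (simp add: colin_flip_iff mult_bilinear b.l_bilin)
    show "rcoact M (ract M m a) = tensor_map2 (ract M) (hmult A) (rcoact M m) (comult A a)" for a m
      using b.r_colin(2) by (simp add: colin_flip_iff mult_bilinear b.r_bilin)
    show "lcoact M (lact M a m) = tensor_map2 (hmult A) (lact M) (comult A a) (lcoact M m)" for a m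
      using b.l_colin(1) by (simp add: colin_def)
    show "lcoact M (ract M m a) = tensor_map2 (hmult A) (ract M) (lcoact M m) (comult A a)" for a m
      using b.r_colin(1) by (simp add: colin_def)
  qed (use lin b1 b2 b3 in \<open>simp_all add: hopf_algebra_axioms b.l_bilin b.r_bilin b.l_mult b.l_unit b.r_mult b.r_unit b.l_r\<close>)
qed

section \<open>Cocycles and Sweedler sums of the bundled definitions\<close>

lemma convolution_conv:
  assumes "hopf_algebra A" "clinear \<phi>" "clinear \<psi>"
  shows "convolution A \<phi> \<psi> a b = conv (tens (comult A) (comult A)) \<phi> \<psi> (a \<otimes> b)"
proof -
  interpret hopf_algebra A by fact
  note [lin] = assms(2,3)[THEN clinear_compose]
  show ?thesis
    unfolding convolution_def conv_def
    by (rule tensor_lift_tens[symmetric]) (intro lin cbilinearI comult_linear assms)+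
qed

lemma is_conv_inverse_iff:
  assumes "hopf_algebra A" "clinear \<gamma>"
  shows "is_conv_inverse A \<gamma> \<delta> \<longleftrightarrow> clinear \<delta> \<and>
    conv (tens (comult A) (comult A)) \<gamma> \<delta> = func_tens (counit A) (counit A) \<and>
    conv (tens (comult A) (comult A)) \<delta> \<gamma> = func_tens (counit A) (counit A)"
proof -
  interpret hopf_algebra A by fact
  let ?D = "tens (comult A) (comult A)" and ?e = "func_tens (counit A) (counit A)"
  have "(\<forall>a b. convolution A \<phi> \<psi> a b = counit A a * counit A b) \<longleftrightarrow> conv ?D \<phi> \<psi> = ?e"
    if "clinear \<phi>" "clinear \<psi>" for \<phi> \<psi>
  proof
    assume *: "\<forall>a b. convolution A \<phi> \<psi> a b = counit A a * counit A b"
    have "conv ?D \<phi> \<psi> t = ?e t" for t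
    proof (rule tensor_eqI[where f = "conv ?D \<phi> \<psi>" and g = ?e])
      show "conv ?D \<phi> \<psi> (a \<otimes> b) = ?e (a \<otimes> b)" for a b
        using * by (simp add: convolution_conv[OF assms(1) that] counit_linear)
    qed (intro that clinear_conv clinear_tens comult_linear clinear_func_tens counit_linear)+
    then show "conv ?D \<phi> \<psi> = ?e" by (rule ext)
  qed (simp add: convolution_conv[OF assms(1) that] counit_linear)
  then show ?thesis
    using assms(2) unfolding is_conv_inverse_def by auto
qed

lemma two_cocycle_imp:
  assumes "hopf_algebra A" "two_cocycle A \<gamma>"
  shows "cocycle (hmult A) (hone A) (comult A) (counit A) \<gamma> (conv_inverse A \<gamma>)"
proof -
  from assms(1) obtain S where "hopf (hmult A) (hone A) (comult A) (counit A) S"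
    by (auto simp: hopf_algebra_iff)
  then interpret h: hopf "hmult A" "hone A" "comult A" "counit A" S .
  have \<gamma>: "clinear \<gamma>" using assms(2) by (simp add: two_cocycle_def)
  note iff = is_conv_inverse_iff[OF assms(1) \<gamma>]
  obtain \<delta> where \<delta>: "is_conv_inverse A \<gamma> \<delta>"
    using assms(2) by (auto simp: two_cocycle_def)
  \<comment> \<open>Uniqueness gives the definite description \<open>conv_inverse\<close> its
    defining property.\<close>
  have "\<delta>' = \<delta>" if "is_conv_inverse A \<gamma> \<delta>'" for \<delta>'
    using that \<delta> unfolding iff
    by (elim conjE) (rule conv_inverse_unique[OF bicomodD(1)[OF h.bicomod_self2]
          bicomodD(2)[OF h.bicomod_self2, unfolded h.flip_comult2[symmetric]] \<gamma>])
  with \<delta> have "is_conv_inverse A \<gamma> (conv_inverse A \<gamma>)"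
    unfolding conv_inverse_def by (rule theI)
  then have inv: "clinear (conv_inverse A \<gamma>)" "conv h.\<Delta>2 \<gamma> (conv_inverse A \<gamma>) = h.\<epsilon>2"
    "conv h.\<Delta>2 (conv_inverse A \<gamma>) \<gamma> = h.\<epsilon>2"
    unfolding iff by simp_all
  note [lin] = clinear_compose[OF \<gamma>]
  have 1: "clinear (\<lambda>t. \<gamma> (tensor_lift (hmult A) t \<otimes> c))" "clinear (\<lambda>t. \<gamma> (c \<otimes> tensor_lift (hmult A) t))" for c
    by (intro lin h.mult_bilin)+
  have "\<gamma> (tensor_lift (hmult A) (lop h.\<Delta>2 \<gamma> (a \<otimes> b)) \<otimes> c)
      = \<gamma> (a \<otimes> tensor_lift (hmult A) (lop h.\<Delta>2 \<gamma> (b \<otimes> c)))" for a b c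
    using assms(2)
    by (simp add: two_cocycle_def lop_tens_pure[OF \<gamma> h.clinear_comult h.clinear_comult]
        clinear_tensor_lift_pull[OF 1(1)] clinear_tensor_lift_pull[OF 1(2)] clinear_scale[OF 1(1)]
        clinear_scale[OF 1(2)] tensor_lift_pure[OF h.mult_bilin] scaleC_complex_def)
  then show ?thesis
    using assms(2) inv \<gamma>
    by (intro cocycle.intro cocycle_axioms.intro h.bialgebra_axioms) (auto simp: two_cocycle_def)
qed

text \<open>Identifies the nested sums of the bundled definitions with the operator form; the two
  differ by exchanging the sum over the right legs of \<open>m\<close> with the sum over the left
  legs of \<open>n\<close>.\<close>

lemma sweedler_dpair:
  assumes "clinear \<gamma>" "clinear \<gamma>b" "clinear \<delta>" "clinear \<rho>" "clinear \<eta>" "clinear \<theta>" "cbilinear \<mu>"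
  shows "(\<ointegral>ml x\<leftarrow>\<delta> m. \<ointegral>m0 mr\<leftarrow>\<rho> x. \<ointegral>nl y\<leftarrow>\<eta> n. \<ointegral>n0 nr\<leftarrow>\<theta> y. (\<gamma> (ml \<otimes> nl) * \<gamma>b (mr \<otimes> nr)) *\<^sub>C \<mu> m0 n0)
    = dpair \<gamma> \<gamma>b \<delta> (flip \<circ> \<rho>) \<eta> (flip \<circ> \<theta>) \<mu> m n"
proof -
  note [lin] = assms(1-6)[THEN clinear_compose] bilinear_lin(1,2)[OF assms(7)]
  have l: "clinear (flip \<circ> \<rho>)" "clinear (flip \<circ> \<theta>)"
    unfolding comp_def by (intro lin)+
  note \<mu> = clinear_tensor_lift[OF assms(7)]
  have g: "clinear (\<lambda>t. tensor_lift \<mu> (lop (tens (flip \<circ> \<rho>) (flip \<circ> \<theta>)) \<gamma>b t))"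
    by (rule clinear_compose[OF \<mu> clinear_lop[OF clinear_tens[OF l] assms(2)]])
  have "tensor_lift \<mu> (lop (tens (flip \<circ> \<rho>) (flip \<circ> \<theta>)) \<gamma>b (x \<otimes> y))
      = (\<ointegral>m0 mr\<leftarrow>\<rho> x. \<ointegral>n0 nr\<leftarrow>\<theta> y. \<gamma>b (mr \<otimes> nr) *\<^sub>C \<mu> m0 n0)" for x y
    unfolding lop_tens_pure[OF assms(2) l] clinear_tensor_lift_pull[OF \<mu>] clinear_scale[OF \<mu>]
      tensor_lift_pure[OF assms(7)]
    unfolding comp_def
    by (subst tensor_lift_flip, intro lin cbilinearI, subst tensor_lift_flip) (intro lin cbilinearI, rule refl)
  then have "dpair \<gamma> \<gamma>b \<delta> (flip \<circ> \<rho>) \<eta> (flip \<circ> \<theta>) \<mu> m n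
      = (\<ointegral>ml x\<leftarrow>\<delta> m. \<ointegral>nl y\<leftarrow>\<eta> n. \<ointegral>m0 mr\<leftarrow>\<rho> x. \<ointegral>n0 nr\<leftarrow>\<theta> y. (\<gamma> (ml \<otimes> nl) * \<gamma>b (mr \<otimes> nr)) *\<^sub>C \<mu> m0 n0)"
    unfolding dpair_def twist_def lop_tens_pure[OF assms(1,3,5)] clinear_tensor_lift_pull[OF g] clinear_scale[OF g]
    by (simp add: tensor_lift_scaleC scaleC_scaleC)
  also have "\<dots> = (\<ointegral>ml x\<leftarrow>\<delta> m. \<ointegral>m0 mr\<leftarrow>\<rho> x. \<ointegral>nl y\<leftarrow>\<eta> n. \<ointegral>n0 nr\<leftarrow>\<theta> y. (\<gamma> (ml \<otimes> nl) * \<gamma>b (mr \<otimes> nr)) *\<^sub>C \<mu> m0 n0)"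
    by (subst tensor_lift_swap) (rule refl)
  finally show ?thesis by simp
qed

section \<open>Classes and representatives in the balanced tensor product\<close>

lemma subspace_balanced: "complex_vector.subspace (balanced M N)"
  unfolding balanced_def by (rule complex_vector.subspace_span)

lemma aclass_eq_iff: "aclass M N s = aclass M N t \<longleftrightarrow> s - t \<in> balanced M N"
proof
  assume "aclass M N s = aclass M N t"
  moreover have "s \<in> aclass M N s"
    by (simp add: aclass_def complex_vector.subspace_0[OF subspace_balanced])
  ultimately show "s - t \<in> balanced M N" by (simp add: aclass_def)
next
  assume st: "s - t \<in> balanced M N"
  have "x - s \<in> balanced M N \<longleftrightarrow> x - t \<in> balanced M N" for x
    using complex_vector.subspace_add[OF subspace_balanced st, of "x - s"]
      complex_vector.subspace_diff[OF subspace_balanced _ st, of "x - t"] by auto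
  then show "aclass M N s = aclass M N t" by (auto simp: aclass_def)
qed

lemma arep_aclass: "arep (aclass M N t) - t \<in> balanced M N"
proof -
  have "t \<in> aclass M N t"
    by (simp add: aclass_def complex_vector.subspace_0[OF subspace_balanced])
  then have "arep (aclass M N t) \<in> aclass M N t"
    unfolding arep_def by (rule someI)
  then show ?thesis by (simp add: aclass_def)
qed

lemma aclass_arep:
  assumes "X \<in> atensor M N"
  shows "aclass M N (arep X) = X"
proof -
  obtain t where "X = aclass M N t" using assms unfolding atensor_def by blast
  then show ?thesis by (simp add: aclass_eq_iff arep_aclass)
qed

text \<open>A linear map sending the balancing generators into the balanced subspace preserves that
  subspace. This is how operations defined through \<open>arep\<close> are computed on arbitrary
  representatives.\<close>

lemma aclass_map_eq:
  assumes "clinear f" "\<And>m a n. f (ract M m a \<otimes> n) - f (m \<otimes> lact N a n) \<in> balanced M N"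
    and "s - t \<in> balanced M N"
  shows "aclass M N (f s) = aclass M N (f t)"
proof -
  have "f x \<in> balanced M N" if "x \<in> balanced M N" for x
    using that unfolding balanced_def[of M N]
  proof (rule complex_vector.span_induct)
    show "complex_vector.subspace {x. f x \<in> complex_vector.span {ract M m a \<otimes> n - m \<otimes> lact N a n |m a n. True}}"
      using subspace_balanced[of M N] unfolding balanced_def
      by (auto simp: complex_vector.subspace_def clinear_add[OF assms(1)] clinear_scale[OF assms(1)] clinear_zero[OF assms(1)])
    show "f x \<in> complex_vector.span {ract M m a \<otimes> n - m \<otimes> lact N a n |m a n. True}"
      if "x \<in> {ract M m a \<otimes> n - m \<otimes> lact N a n |m a n. True}" for x
      using that assms(2) unfolding balanced_def by (auto simp: clinear_diff[OF assms(1)])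
  qed
  from this[OF assms(3)] show ?thesis
    by (simp add: aclass_eq_iff clinear_diff[OF assms(1)])
qed

lemma aadd_aclass: "aadd M N (aclass M N s) (aclass M N t) = aclass M N (s + t)"
  unfolding aadd_def aclass_eq_iff add_diff_add
  by (intro complex_vector.subspace_add[OF subspace_balanced] arep_aclass)

lemma ascale_aclass: "ascale M N c (aclass M N t) = aclass M N (c *\<^sub>C t)"
  unfolding ascale_def aclass_eq_iff complex_vector.scale_right_diff_distrib[symmetric]
  by (intro complex_vector.subspace_scale[OF subspace_balanced] arep_aclass)

lemma generator_balanced: "ract M m a \<otimes> n - m \<otimes> lact N a n \<in> balanced M N"
  unfolding balanced_def by (rule complex_vector.span_base) blast

text \<open>A coalgebra is cofree as a comodule over itself: a colinear map into it is determined by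
  its composite with the counit. Invariance is the formula recovering \<open>G\<close> from that
  composite, and \<open>B\<close> below is this formula tested against a functional.\<close>

lemma colin_iff_invariant:
  assumes C: "comod \<Delta> \<epsilon> \<Delta>" "comod (flip \<circ> \<Delta>) \<epsilon> (flip \<circ> \<Delta>)" and M: "comod \<Delta> \<epsilon> \<delta>"
    and \<kappa>: "cbilinear \<kappa>" "colin \<kappa> \<Delta> \<Delta> \<Delta> \<kappa>" and G: "cbilinear G"
  shows "colin \<kappa> \<delta> \<delta> \<Delta> G \<longleftrightarrow> (\<forall>m n. (\<ointegral>c x\<leftarrow>\<delta> m. \<ointegral>d y\<leftarrow>\<delta> n. \<epsilon> (G x y) *\<^sub>C \<kappa> c d) = G m n)"
proof -
  note D = comodD(1,2)[OF C(1)] comodD(3)[OF M]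
  note [lin] = D[THEN clinear_compose] bilinear_lin(1,2)[OF G] bilinear_lin(1,2)[OF \<kappa>(1)]
  show ?thesis
  proof
    assume colin: "colin \<kappa> \<delta> \<delta> \<Delta> G"
    show "\<forall>m n. (\<ointegral>c x\<leftarrow>\<delta> m. \<ointegral>d y\<leftarrow>\<delta> n. \<epsilon> (G x y) *\<^sub>C \<kappa> c d) = G m n"
    proof (intro allI)
      fix m n
      have "(\<ointegral>a b\<leftarrow>\<Delta> (G m n). \<epsilon> b *\<^sub>C a) = (\<ointegral>c x\<leftarrow>\<delta> m. \<ointegral>d y\<leftarrow>\<delta> n. \<epsilon> (G x y) *\<^sub>C \<kappa> c d)"
        by (rule colin_lift[OF colin]) (intro lin cbilinearI D)
      then show "(\<ointegral>c x\<leftarrow>\<delta> m. \<ointegral>d y\<leftarrow>\<delta> n. \<epsilon> (G x y) *\<^sub>C \<kappa> c d) = G m n"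
        using counit_lift_right[OF C(2) clinear_ident, of "G m n"] by simp
    qed
  next
    assume inv: "\<forall>m n. (\<ointegral>c x\<leftarrow>\<delta> m. \<ointegral>d y\<leftarrow>\<delta> n. \<epsilon> (G x y) *\<^sub>C \<kappa> c d) = G m n"
    let ?G = "tensor_lift G" and ?k = "tensor_lift \<kappa>" and ?d = "tens \<delta> \<delta>"
    have lG: "clinear ?G" and lk: "clinear ?k"
      by (intro clinear_tensor_lift G \<kappa>)+
    have B: "\<phi> (?G t) = \<epsilon> (?G (lop ?d (\<lambda>s. \<phi> (?k s)) t))" if "clinear \<phi>" for \<phi> t
    proof (rule tensor_eqI[where f = "\<lambda>t. \<phi> (?G t)" and g = "\<lambda>t. \<epsilon> (?G (lop ?d (\<lambda>s. \<phi> (?k s)) t))"])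
      have \<phi>k: "clinear (\<lambda>s. \<phi> (?k s))" by (rule clinear_compose[OF that lk])
      show "clinear (\<lambda>t. \<phi> (?G t))" by (rule clinear_compose[OF that lG])
      have eG: "clinear (\<lambda>t. \<epsilon> (?G t))" by (rule clinear_compose[OF D(2) lG])
      show "clinear (\<lambda>t. \<epsilon> (?G (lop ?d (\<lambda>s. \<phi> (?k s)) t)))"
        by (rule clinear_compose[OF eG clinear_lop[OF clinear_tens[OF D(3) D(3)] \<phi>k]])
      fix m n
      have "\<phi> (G m n) = \<phi> (\<ointegral>c x\<leftarrow>\<delta> m. \<ointegral>d y\<leftarrow>\<delta> n. \<epsilon> (G x y) *\<^sub>C \<kappa> c d)"
        using inv by simp
      also have "\<dots> = (\<ointegral>c x\<leftarrow>\<delta> m. \<ointegral>d y\<leftarrow>\<delta> n. \<phi> (\<kappa> c d) *\<^sub>C \<epsilon> (G x y))"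
        by (simp add: clinear_tensor_lift_pull[OF that] clinear_scale[OF that] scaleC_complex_def mult.commute)
      also have "\<dots> = \<epsilon> (?G (lop ?d (\<lambda>s. \<phi> (?k s)) (m \<otimes> n)))"
        unfolding lop_tens_pure[OF \<phi>k D(3) D(3)] clinear_tensor_lift_pull[OF eG] clinear_scale[OF eG]
          tensor_lift_pure[OF G] tensor_lift_pure[OF \<kappa>(1)] ..
      finally show "\<phi> (?G (m \<otimes> n)) = \<epsilon> (?G (lop ?d (\<lambda>s. \<phi> (?k s)) (m \<otimes> n)))"
        by (simp add: tensor_lift_pure[OF G])
    qed
    have map: "comod_map (tens \<Delta> \<Delta>) \<Delta> ?k ?k"
      using \<kappa> colin_iff[OF \<kappa>(1) \<kappa>(1) D(1) D(1) D(1)] by simp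
    show "colin \<kappa> \<delta> \<delta> \<Delta> G"
      unfolding colin_iff[OF \<kappa>(1) G D(3) D(3) D(1)]
    proof (rule comod_mapI[OF lk lG], rule functional_separate)
      fix \<phi> \<psi> :: "'a \<Rightarrow> complex" and t
      assume \<phi>: "clinear \<phi>" and \<psi>: "clinear \<psi>"
      note l = clinear_compose[OF \<phi> lk] clinear_compose[OF \<psi> lk]
      \<comment> \<open>\<open>B\<close> is used once for the convolution of \<open>\<phi>\<close>
        and \<open>\<psi>\<close> and once backwards for \<open>\<psi>\<close>; in between, pullback
        along the product respects convolution.\<close>
      have "\<psi> (lop \<Delta> \<phi> (?G t)) = conv \<Delta> \<phi> \<psi> (?G t)"
        by (simp add: conv_lop[OF \<psi>])
      also have "\<dots> = \<epsilon> (?G (lop ?d (conv (tens \<Delta> \<Delta>) (\<lambda>s. \<phi> (?k s)) (\<lambda>s. \<psi> (?k s))) t))"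
        unfolding B[OF clinear_conv[OF D(1) \<phi> \<psi>]] conv_comod_map[OF map \<phi> \<psi>] ..
      also have "\<dots> = \<epsilon> (?G (lop ?d (\<lambda>s. \<psi> (?k s)) (lop ?d (\<lambda>s. \<phi> (?k s)) t)))"
        by (simp only: lop_lop[OF comod_tens[OF M M] l(2,1)])
      also have "\<dots> = \<psi> (?G (lop ?d (\<lambda>c. \<phi> (?k c)) t))"
        by (simp only: B[OF \<psi>])
      finally show "\<psi> (lop \<Delta> \<phi> (?G t)) = \<psi> (?G (lop ?d (\<lambda>c. \<phi> (?k c)) t))" .
    qed
  qed
qed

section \<open>The braiding and metrics on classes\<close>

locale hopf_bimodule =
  hopf_bicovariant "hmult A" "hone A" "comult A" "counit A" S "lact E" "ract E" "lcoact E" "flip \<circ> rcoact E"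
  for A :: "'a::complex_vector hopf_data" and S and E :: "('a, 'e::complex_vector) bimod_data"
begin

lemma balanced_bal: "balanced E E = bal"
  by (simp add: balanced_def bal_def)

abbreviation "cls \<equiv> aclass E E"

lemma clinear_act: "clinear (lact E a)" "clinear (\<lambda>n. ract E n a)"
  by (rule bilinear_lin(3)[OF l_bilin], rule cbilinearD2[OF r_bilin])

lemma clinear_rcoact: "clinear (rcoact E)"
  using clinear_compose[OF clinear_flip clinear_coact(2)] by simp

lemma aract_cls: "aract E E (cls t) a = cls (tensor_map id (\<lambda>n. ract E n a) t)"
  unfolding aract_def
proof (rule aclass_map_eq[OF _ _ arep_aclass])
  show "clinear (tensor_map id (\<lambda>n. ract E n a) :: 'e \<otimes> 'e \<Rightarrow> _)"
    by (intro clinear_tensor_map clinear_id clinear_act)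
  show "tensor_map id (\<lambda>n. ract E n a) (ract E m b \<otimes> n) - tensor_map id (\<lambda>n. ract E n a) (m \<otimes> lact E b n)
      \<in> balanced E E" for m b n
    by (simp add: tensor_map_pure clinear_id clinear_act l_r generator_balanced)
qed

lemma alact_cls: "alact E E a (cls t) = cls (tensor_map (lact E a) id t)"
  unfolding alact_def
proof (rule aclass_map_eq[OF _ _ arep_aclass])
  show "clinear (tensor_map (lact E a) id :: 'e \<otimes> 'e \<Rightarrow> _)"
    by (intro clinear_tensor_map clinear_id clinear_act)
  show "tensor_map (lact E a) id (ract E m b \<otimes> n) - tensor_map (lact E a) id (m \<otimes> lact E b n)
      \<in> balanced E E" for m b n
    by (simp add: tensor_map_pure clinear_id clinear_act l_r[symmetric] generator_balanced)
qed

lemma left_inv_iff: "\<omega> \<in> left_inv A E \<longleftrightarrow> lcoact E \<omega> = hone A \<otimes> \<omega>"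
  by (simp add: left_inv_def)

lemma right_inv_iff: "\<eta> \<in> right_inv A E \<longleftrightarrow> (flip \<circ> rcoact E) \<eta> = hone A \<otimes> \<eta>"
proof -
  have "flip (rcoact E \<eta>) = hone A \<otimes> \<eta> \<Longrightarrow> rcoact E \<eta> = \<eta> \<otimes> hone A"
    by (drule arg_cong[where f = flip]) simp
  then show ?thesis by (auto simp: right_inv_def)
qed

lemma sig_tensor_map:
  "sig (tensor_map (lact E a) id t) = tensor_map (lact E a) id (sig t)"
  "sig (tensor_map id (\<lambda>n. ract E n a) t) = tensor_map id (\<lambda>n. ract E n a) (sig t)"
proof -
  have la: "clinear (tensor_map (lact E a) id :: 'e \<otimes> 'e \<Rightarrow> _)"
    and ra: "clinear (tensor_map id (\<lambda>n. ract E n a) :: 'e \<otimes> 'e \<Rightarrow> _)"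
    by (intro clinear_tensor_map clinear_id clinear_act)+
  note l = clinear_compose[OF clinear_sig la] clinear_compose[OF la clinear_sig]
    clinear_compose[OF clinear_sig ra] clinear_compose[OF ra clinear_sig]
  show "sig (tensor_map (lact E a) id t) = tensor_map (lact E a) id (sig t)"
    by (rule tensor_eqI[OF l(1,2)]) (simp add: clinear_act clinear_id tensor_map_pure sig_lact)
  show "sig (tensor_map id (\<lambda>n. ract E n a) t) = tensor_map id (\<lambda>n. ract E n a) (sig t)"
    by (rule tensor_eqI[OF l(3,4)]) (simp add: clinear_act clinear_id tensor_map_pure sig_ract)
qed

lemma cls_sig_arep: "cls (sig (arep (cls t))) = cls (sig t)"
  by (rule aclass_map_eq[OF clinear_sig _ arep_aclass]) (simp add: balanced_bal sig_balanced)

text \<open>Existence comes from \<open>sig\<close>, which descends to classes. Uniqueness holds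
  because tensors of invariant elements generate the bimodule, so the definite description in
  \<open>braiding\<close> can be evaluated.\<close>

theorem braiding_cls: "braiding A E (cls t) = cls (sig t)"
proof -
  define good where "good \<sigma> \<longleftrightarrow> \<sigma> \<in> extensional (atensor E E) \<and> bimodule_endo E E \<sigma> \<and>
    (\<forall>\<omega>\<in>left_inv A E. \<forall>\<eta>\<in>right_inv A E. \<sigma> (cls (\<omega> \<otimes> \<eta>)) = cls (\<eta> \<otimes> \<omega>))" for \<sigma>
  define \<sigma>0 where "\<sigma>0 = restrict (\<lambda>X. cls (sig (arep X))) (atensor E E)"
  have cls_mem: "cls t \<in> atensor E E" for t
    by (simp add: atensor_def)
  have \<sigma>0: "\<sigma>0 (cls t) = cls (sig t)" for t
    by (simp add: \<sigma>0_def cls_mem cls_sig_arep)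
  have "good \<sigma>0"
    unfolding good_def
  proof (intro conjI ballI)
    show "\<sigma>0 \<in> extensional (atensor E E)" by (simp add: \<sigma>0_def)
    show "bimodule_endo E E \<sigma>0"
      unfolding bimodule_endo_def
      by (auto simp: atensor_def \<sigma>0 aadd_aclass ascale_aclass alact_cls aract_cls
          clinear_add[OF clinear_sig] clinear_scale[OF clinear_sig] sig_tensor_map)
    show "\<sigma>0 (cls (\<omega> \<otimes> \<eta>)) = cls (\<eta> \<otimes> \<omega>)" if "\<omega> \<in> left_inv A E" "\<eta> \<in> right_inv A E" for \<omega> \<eta>
      using that by (simp add: \<sigma>0 sig_inv left_inv_iff right_inv_iff del: comp_apply)
  qed
  moreover have "\<sigma> = \<sigma>0" if "good \<sigma>" for \<sigma>
  proof -
    have endo: "bimodule_endo E E \<sigma>" and ext: "\<sigma> \<in> extensional (atensor E E)"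
      and swap: "\<And>\<omega> \<eta>. \<omega> \<in> left_inv A E \<Longrightarrow> \<eta> \<in> right_inv A E \<Longrightarrow> \<sigma> (cls (\<omega> \<otimes> \<eta>)) = cls (\<eta> \<otimes> \<omega>)"
      using that by (auto simp: good_def)
    have add: "\<sigma> (cls (s + t)) = aadd E E (\<sigma> (cls s)) (\<sigma> (cls t))"
      and scale: "\<sigma> (cls (c *\<^sub>C t)) = ascale E E c (\<sigma> (cls t))"
      and left: "\<sigma> (cls (tensor_map (lact E a) id t)) = alact E E a (\<sigma> (cls t))"
      and right: "\<sigma> (cls (tensor_map id (\<lambda>n. ract E n a) t)) = aract E E (\<sigma> (cls t)) a" for s t c a
      using endo cls_mem unfolding bimodule_endo_def
      by (simp_all flip: aadd_aclass ascale_aclass alact_cls aract_cls)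
    have "t \<in> {t. \<sigma> (cls t) = cls (sig t)}" for t
    proof (rule invariant_tensors_span)
      \<comment> \<open>Linearity is available only through the operations on classes, so the value
        at zero is obtained by scaling with 0.\<close>
      have "\<sigma> (cls 0) = cls (sig 0)"
        using scale[of 0 0] endo cls_mem[of 0] unfolding bimodule_endo_def atensor_def
        by (auto simp: clinear_zero[OF clinear_sig] ascale_aclass dest!: funcset_mem)
      then show "complex_vector.subspace {t. \<sigma> (cls t) = cls (sig t)}"
        by (simp add: complex_vector.subspace_def add scale aadd_aclass ascale_aclass
            clinear_add[OF clinear_sig] clinear_scale[OF clinear_sig])
      fix a b \<omega> \<eta>
      assume inv: "lcoact E \<omega> = hone A \<otimes> \<omega>" "(flip \<circ> rcoact E) \<eta> = hone A \<otimes> \<eta>"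
      have eq: "lact E a x \<otimes> ract E y b = tensor_map (lact E a) id (tensor_map id (\<lambda>n. ract E n b) (x \<otimes> y))" for x y
        by (simp add: tensor_map_pure clinear_act clinear_id)
      have "\<sigma> (cls (\<omega> \<otimes> \<eta>)) = cls (sig (\<omega> \<otimes> \<eta>))"
        using inv by (simp add: swap left_inv_iff right_inv_iff sig_inv del: comp_apply)
      then show "lact E a \<omega> \<otimes> ract E \<eta> b \<in> {t. \<sigma> (cls t) = cls (sig t)}"
        unfolding eq mem_Collect_eq left right sig_tensor_map by (simp add: alact_cls aract_cls)
    qed
    then have "\<sigma> (cls t) = \<sigma>0 (cls t)" for t
      by (simp add: \<sigma>0)
    then have "\<sigma> X = \<sigma>0 X" if "X \<in> atensor E E" for X
      using that by (auto simp: atensor_def)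
    then show "\<sigma> = \<sigma>0"
      by (intro extensionalityI[OF ext]) (simp_all add: \<sigma>0_def)
  qed
  ultimately have "braiding A E = \<sigma>0"
    unfolding braiding_def good_def[symmetric] by (rule the_equality)
  then show ?thesis by (simp add: \<sigma>0)
qed

text \<open>The clause \<open>g (cls t) = tensor_lift G t\<close> expresses linearity: without it,
  values on pure tensors would not control a function on classes.\<close>

lemma right_linear_iff:
  fixes g :: "('e \<otimes> 'e) set \<Rightarrow> 'a"
  defines "G \<equiv> \<lambda>m n. g (cls (m \<otimes> n))"
  shows "right_linear A E E g \<longleftrightarrow> cbilinear G \<and> (\<forall>t. g (cls t) = tensor_lift G t) \<and>
    (\<forall>m n a. G m (ract E n a) = hmult A (G m n) a)"
proof
  assume "right_linear A E E g"
  then have *: "g (cls (s + t)) = g (cls s) + g (cls t)" "g (cls (c *\<^sub>C t)) = c *\<^sub>C g (cls t)"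
    "g (cls (tensor_map id (\<lambda>n. ract E n a) t)) = hmult A (g (cls t)) a" for s t c a
    unfolding right_linear_def atensor_def
    by (simp_all flip: aadd_aclass ascale_aclass aract_cls)
  have lin: "clinear (\<lambda>t. g (cls t))"
    by (rule clinearI) (rule *)+
  have G: "cbilinear G"
    unfolding G_def by (rule cbilinear_compose[OF lin cbilinear_tensor_pure])
  moreover have "g (cls t) = tensor_lift G t" for t
    by (rule tensor_eqI[OF lin clinear_tensor_lift[OF G]]) (simp only: tensor_lift_pure[OF G], simp add: G_def)
  moreover have "G m (ract E n a) = hmult A (G m n) a" for m n a
    using *(3)[of a "m \<otimes> n"] by (simp add: G_def tensor_map_pure clinear_id clinear_act)
  ultimately show "cbilinear G \<and> (\<forall>t. g (cls t) = tensor_lift G t) \<and>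
    (\<forall>m n a. G m (ract E n a) = hmult A (G m n) a)" by blast
next
  assume "cbilinear G \<and> (\<forall>t. g (cls t) = tensor_lift G t) \<and>
    (\<forall>m n a. G m (ract E n a) = hmult A (G m n) a)"
  then have G: "cbilinear G" "\<And>t. g (cls t) = tensor_lift G t"
    "\<And>m n a. G m (ract E n a) = hmult A (G m n) a"
    by auto
  note l = clinear_tensor_lift[OF G(1)]
  have "tensor_lift G (tensor_map id (\<lambda>n. ract E n a) t) = hmult A (tensor_lift G t) a" for a t
    unfolding tensor_lift_tensor_map[OF G(1) clinear_id clinear_act(2)] bilinear_tensor_lift(1)[OF mult_bilin]
    by (simp add: G(3))
  then show "right_linear A E E g"
    unfolding right_linear_def atensor_def
    by (auto simp: aadd_aclass ascale_aclass aract_cls G(2) clinear_add[OF l] clinear_scale[OF l])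
qed

text \<open>For the converse, \<open>m \<otimes> n\<close> is decomposed by \<open>P\<close> and
  \<open>Q\<close>; \<open>sig\<close> exchanges exactly the two invariant elements, and right
  linearity absorbs the coefficient on the right.\<close>

lemma braiding_symmetric_iff:
  assumes G: "cbilinear G" "\<And>m n a. G m (ract E n a) = hmult A (G m n) a"
  shows "(\<forall>t. tensor_lift G (sig t) = tensor_lift G t) \<longleftrightarrow>
    (\<forall>a \<omega> \<eta>. lcoact E \<omega> = hone A \<otimes> \<omega> \<longrightarrow> (flip \<circ> rcoact E) \<eta> = hone A \<otimes> \<eta>
      \<longrightarrow> G (lact E a \<omega>) \<eta> = G (lact E a \<eta>) \<omega>)"
proof (intro iffI allI impI)
  fix a \<omega> \<eta>
  assume *: "\<forall>t. tensor_lift G (sig t) = tensor_lift G t"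
    and inv: "lcoact E \<omega> = hone A \<otimes> \<omega>" "(flip \<circ> rcoact E) \<eta> = hone A \<otimes> \<eta>"
  have "sig (lact E a \<omega> \<otimes> \<eta>) = lact E a \<eta> \<otimes> \<omega>"
    by (simp add: sig_lact sig_inv[OF inv] tensor_map_pure clinear_act clinear_id)
  then show "G (lact E a \<omega>) \<eta> = G (lact E a \<eta>) \<omega>"
    using *[rule_format, of "lact E a \<omega> \<otimes> \<eta>"] by (simp add: tensor_lift_pure[OF G(1)])
next
  fix t
  assume *: "\<forall>a \<omega> \<eta>. lcoact E \<omega> = hone A \<otimes> \<omega> \<longrightarrow> (flip \<circ> rcoact E) \<eta> = hone A \<otimes> \<eta>
      \<longrightarrow> G (lact E a \<omega>) \<eta> = G (lact E a \<eta>) \<omega>"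
  note l = clinear_tensor_lift[OF G(1)]
  show "tensor_lift G (sig t) = tensor_lift G t"
  proof (rule tensor_eqI[OF clinear_compose[OF l clinear_sig] l])
    fix m n
    have "tensor_lift G (sig (m \<otimes> n))
        = (\<ointegral>c x\<leftarrow>lcoact E m. \<ointegral>d y\<leftarrow>(flip \<circ> rcoact E) n. G (lact E c (Q y)) (ract E (P x) d))"
      by (simp only: sig_pure clinear_tensor_lift_pull[OF l] tensor_lift_pure[OF G(1)])
    also have "\<dots> = (\<ointegral>c x\<leftarrow>lcoact E m. \<ointegral>d y\<leftarrow>(flip \<circ> rcoact E) n. G (lact E c (P x)) (ract E (Q y) d))"
      unfolding G(2) *[rule_format, OF P_inv Q_inv] ..
    also have "\<dots> = G m n"
      by (simp only: bilinear_tensor_lift[OF G(1), symmetric] P_recover Q_recover)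
    finally show "tensor_lift G (sig (m \<otimes> n)) = tensor_lift G (m \<otimes> n)"
      by (simp only: tensor_lift_pure[OF G(1)])
  qed
qed

lemma left_invariant_iff:
  assumes G: "cbilinear G" "\<And>t. g (cls t) = tensor_lift G t"
  shows "left_invariant A E g \<longleftrightarrow> colin (hmult A) (lcoact E) (lcoact E) (comult A) G"
proof -
  note [lin] = bilinear_lin(1,2)[OF G(1)]
  have "lcoact_tensor A E E (m \<otimes> n) = tensor_map2 (hmult A) (\<otimes>) (lcoact E m) (lcoact E n)" for m n
    unfolding lcoact_tensor_def tensor_map2_def by (rule tensor_lift_pure) (intro lin cbilinearI)
  moreover have "(\<ointegral>a t\<leftarrow>tensor_map2 (hmult A) (\<otimes>) (lcoact E m) (lcoact E n). counit A (tensor_lift G t) *\<^sub>C a)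
      = (\<ointegral>c x\<leftarrow>lcoact E m. \<ointegral>d y\<leftarrow>lcoact E n. counit A (tensor_lift G (x \<otimes> y)) *\<^sub>C hmult A c d)" for m n
    by (rule tensor_lift_tensor_map2) (intro lin cbilinearI G)
  ultimately show ?thesis
    unfolding left_invariant_def
      colin_iff_invariant[OF comod_self comod_self' comod_left mult_bilin comult_mult G(1)]
    by (simp add: G(2) tensor_lift_pure[OF G(1)])
qed

lemma right_invariant_iff:
  assumes G: "cbilinear G" "\<And>t. g (cls t) = tensor_lift G t"
  shows "right_invariant A E g \<longleftrightarrow>
    colin (hmult A) (flip \<circ> rcoact E) (flip \<circ> rcoact E) (flip \<circ> comult A) G"
proof -
  note [lin] = bilinear_lin(1,2)[OF G(1)] clinear_compose[OF clinear_rcoact]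
  have "rcoact_tensor A E E (m \<otimes> n) = tensor_map2 (\<otimes>) (hmult A) (rcoact E m) (rcoact E n)" for m n
    unfolding rcoact_tensor_def tensor_map2_def by (rule tensor_lift_pure) (intro lin cbilinearI)
  moreover have "(\<ointegral>t a\<leftarrow>tensor_map2 (\<otimes>) (hmult A) (rcoact E m) (rcoact E n). counit A (tensor_lift G t) *\<^sub>C a)
      = (\<ointegral>x c\<leftarrow>rcoact E m. \<ointegral>y d\<leftarrow>rcoact E n. counit A (tensor_lift G (x \<otimes> y)) *\<^sub>C hmult A c d)" for m n
    by (rule tensor_lift_tensor_map2) (intro lin cbilinearI G)
  moreover have "(\<ointegral>c x\<leftarrow>flip (rcoact E m). \<ointegral>d y\<leftarrow>flip (rcoact E n). counit A (G x y) *\<^sub>C hmult A c d)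
      = (\<ointegral>x c\<leftarrow>rcoact E m. \<ointegral>y d\<leftarrow>rcoact E n. counit A (G x y) *\<^sub>C hmult A c d)" for m n
    by (subst tensor_lift_flip, intro lin cbilinearI, subst tensor_lift_flip) (intro lin cbilinearI, rule refl)
  moreover have "comod (flip \<circ> (flip \<circ> comult A)) (counit A) (flip \<circ> (flip \<circ> comult A))"
    using comod_self by simp
  note colin_iff_invariant[OF comod_self' this comod_right mult_bilin comult_mult_flip G(1)]
  ultimately show ?thesis
    unfolding right_invariant_def by (simp add: G(2) tensor_lift_pure[OF G(1)])
qed

theorem bi_invariant_metric_iff:
  fixes g :: "('e \<otimes> 'e) set \<Rightarrow> 'a"
  defines "G \<equiv> \<lambda>m n. g (cls (m \<otimes> n))"
  shows "bi_invariant_metric A E g \<longleftrightarrow> metric_form G \<and> (\<forall>t. g (cls t) = tensor_lift G t)"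
proof (cases "right_linear A E E g")
  case True
  then have "cbilinear G \<and> (\<forall>t. g (cls t) = tensor_lift G t) \<and>
    (\<forall>m n a. G m (ract E n a) = hmult A (G m n) a)"
    unfolding G_def by (rule right_linear_iff[THEN iffD1])
  then have G: "cbilinear G" "\<And>t. g (cls t) = tensor_lift G t" "\<And>m n a. G m (ract E n a) = hmult A (G m n) a"
    by blast+
  have "G (ract E m a) n = G m (lact E a n)" for m a n
    unfolding G_def using generator_balanced[of E m a n E] by (simp add: aclass_eq_iff[symmetric])
  moreover have "(\<forall>X\<in>atensor E E. g (braiding A E X) = g X) \<longleftrightarrow> (\<forall>t. tensor_lift G (sig t) = tensor_lift G t)"
    by (auto simp: atensor_def braiding_cls G(2))
  ultimately show ?thesis
    unfolding bi_invariant_metric_def pseudo_riemannian_metric_def metric_form_def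
      braiding_symmetric_iff[OF G(1,3), symmetric] left_invariant_iff[OF G(1,2)] right_invariant_iff[OF G(1,2)]
    using True G(1,3) by (simp add: G(2) tensor_lift_pure[OF G(1)] conj_ac)
next
  \<comment> \<open>Both sides fail, since the right-hand side contains the conditions that
    \<open>right_linear_iff\<close> identifies with right linearity.\<close>
  case False
  then show ?thesis
    unfolding bi_invariant_metric_def pseudo_riemannian_metric_def metric_form_def
    using right_linear_iff[of g] unfolding G_def by blast
qed

lemma tensor_lift_arep:
  assumes "cbilinear G" "\<And>m a n. G (ract E m a) n = G m (lact E a n)"
  shows "tensor_lift G (arep (aclass E E t)) = tensor_lift G t"
proof -
  note l = clinear_tensor_lift[OF assms(1)]
  have "tensor_lift G x = 0" if "x \<in> balanced E E" for x
    using that unfolding balanced_def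
  proof (rule complex_vector.span_induct)
    show "complex_vector.subspace {x. tensor_lift G x = 0}"
      by (auto simp: complex_vector.subspace_def clinear_add[OF l] clinear_scale[OF l] clinear_zero[OF l])
    show "tensor_lift G x = 0" if "x \<in> {ract E m a \<otimes> n - m \<otimes> lact E a n |m a n. True}" for x
      using that by (auto simp: clinear_diff[OF l] tensor_lift_pure[OF assms(1)] assms(2))
  qed
  from this[OF arep_aclass] show ?thesis by (simp add: clinear_diff[OF l])
qed

end

section \<open>Deformation of the bundled structures\<close>

locale deformation = hopf_bimodule A S E
  for A :: "'a::complex_vector hopf_data" and S and E :: "('a, 'e::complex_vector) bimod_data" +
  fixes \<gamma> :: "'a \<otimes> 'a \<Rightarrow> complex"
  assumes two_cocycle: "two_cocycle A \<gamma>"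
begin

abbreviation "\<gamma>b \<equiv> conv_inverse A \<gamma>"
abbreviation "A\<gamma> \<equiv> deform_hopf A \<gamma>"
abbreviation "E\<gamma> \<equiv> deform_bimod A \<gamma> E"

lemma hopf_algebra: "hopf_algebra A"
  using hopf_axioms by (auto simp: hopf_algebra_iff)

sublocale twisted: hopf_bicovariant_cocycle "hmult A" "hone A" "comult A" "counit A" S \<gamma> \<gamma>b
  "lact E" "ract E" "lcoact E" "flip \<circ> rcoact E"
  by (intro hopf_bicovariant_cocycle.intro hopf_cocycle.intro hopf_axioms
      hopf_bicovariant_axioms two_cocycle_imp hopf_algebra two_cocycle)

lemma deform_hopf_sel:
  "hmult A\<gamma> = twisted.\<kappa>\<gamma>" "hone A\<gamma> = hone A" "comult A\<gamma> = comult A" "counit A\<gamma> = counit A"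
  unfolding deform_hopf_def twisted.\<kappa>\<gamma>_def sweedler3_def
  by (simp_all add: fun_eq_iff sweedler_dpair twisted.clinear_cocycle clinear_comult mult_bilin)

lemma deform_bimod_sel:
  "lact E\<gamma> = twisted.l\<gamma>" "ract E\<gamma> = twisted.r\<gamma>" "lcoact E\<gamma> = lcoact E" "rcoact E\<gamma> = rcoact E"
  unfolding deform_bimod_def twisted.l\<gamma>_def twisted.r\<gamma>_def sweedler3_def sweedler_bi_def
  by (simp_all add: fun_eq_iff sweedler_dpair twisted.clinear_cocycle clinear_comult clinear_coact
      clinear_rcoact l_bilin r_bilin)

lemma deformed_hopf_bimodule: "hopf_bimodule A\<gamma> twisted.S\<gamma> E\<gamma>"
  unfolding hopf_bimodule_def deform_hopf_sel deform_bimod_sel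
  by (rule twisted.deformed_hopf_bicovariant)

lemma deformed_bimodule: "bicovariant_bimodule A\<gamma> E\<gamma>"
  unfolding bicovariant_bimodule_iff hopf_algebra_iff deform_hopf_sel deform_bimod_sel
  using twisted.deformed_hopf twisted.deformed_bicovariant by blast

text \<open>On representatives \<xi> is the twist of \<otimes>, so composing it with a form twists
  the form.\<close>

lemma tensor_lift_xi_rep:
  assumes "cbilinear G"
  shows "tensor_lift G (xi_rep A \<gamma> E E t) = tensor_lift (twisted.G\<gamma> G) t"
proof -
  have "xi_rep A \<gamma> E E = tensor_lift (twisted.G\<gamma> (\<otimes>))"
    unfolding xi_rep_def sweedler_bi_def
    by (simp add: sweedler_dpair twisted.clinear_cocycle clinear_coact clinear_rcoact cbilinear_tensor_pure)
  then show ?thesis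
    by (simp add: tensor_lift_dpair[OF _ twisted.clinear_cocycle clinear_coact clinear_coact]
        cbilinear_tensor_pure assms tensor_lift_pure_self)
qed

sublocale deformed: hopf_bimodule A\<gamma> twisted.S\<gamma> E\<gamma>
  by (rule deformed_hopf_bimodule)

lemma metric_form_deformed:
  assumes "metric_form G"
  shows "deformed.metric_form (twisted.G\<gamma> G)"
  using twisted.deformed_metric_form[OF assms] by (simp add: deform_hopf_sel deform_bimod_sel)

theorem deform_metric_bi_invariant:
  assumes "bi_invariant_metric A E g"
  shows "bi_invariant_metric A\<gamma> E\<gamma> (deform_metric A \<gamma> E g)"
proof -
  let ?G = "\<lambda>m n. g (cls (m \<otimes> n))"
  have G: "metric_form ?G" "\<And>t. g (cls t) = tensor_lift ?G t"
    using assms unfolding bi_invariant_metric_iff by blast+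
  note G\<gamma> = metric_form_deformed[OF G(1)]
  note bilin = deformed.metric_formD(1)[OF G\<gamma>]
  have *: "deform_metric A \<gamma> E g (deformed.cls t) = tensor_lift (twisted.G\<gamma> ?G) t" for t
  proof -
    have "deform_metric A \<gamma> E g (deformed.cls t) = tensor_lift ?G (xi_rep A \<gamma> E E (arep (deformed.cls t)))"
      unfolding deform_metric_def xi_def comp_def by (rule G(2))
    \<comment> \<open>The representative is determined only modulo the deformed balancing relation,
      which the twisted form respects.\<close>
    also have "\<dots> = tensor_lift (twisted.G\<gamma> ?G) t"
      unfolding tensor_lift_xi_rep[OF metric_formD(1)[OF G(1)]]
      by (rule deformed.tensor_lift_arep[OF bilin deformed.metric_formD(2)[OF G\<gamma>]])
    finally show ?thesis .
  qed
  then have "(\<lambda>m n. deform_metric A \<gamma> E g (deformed.cls (m \<otimes> n))) = twisted.G\<gamma> ?G"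
    by (simp add: fun_eq_iff tensor_lift_pure[OF bilin])
  then show ?thesis
    unfolding deformed.bi_invariant_metric_iff using G\<gamma> * by simp
qed

theorem deform_metric_surj:
  assumes "bi_invariant_metric A\<gamma> E\<gamma> h"
  obtains g where "bi_invariant_metric A E g"
    "\<And>X. X \<in> atensor E\<gamma> E\<gamma> \<Longrightarrow> h X = deform_metric A \<gamma> E g X"
proof -
  let ?H = "\<lambda>m n. h (deformed.cls (m \<otimes> n))"
  have H: "deformed.metric_form ?H" "\<And>t. h (deformed.cls t) = tensor_lift ?H t"
    using assms unfolding deformed.bi_invariant_metric_iff by blast+
  note H\<gamma> = H(1)[unfolded deform_hopf_sel deform_bimod_sel]
  interpret inverse_twist: hopf_bicovariant_cocycle "twisted.\<kappa>\<gamma>" "hone A" "comult A" "counit A" "twisted.S\<gamma>" \<gamma>b \<gamma>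
    "twisted.l\<gamma>" "twisted.r\<gamma>" "lcoact E" "flip \<circ> rcoact E"
    by (intro hopf_bicovariant_cocycle.intro hopf_cocycle.intro twisted.deformed_hopf
        twisted.deformed_cocycle twisted.deformed_hopf_bicovariant)
  \<comment> \<open>Twisting by \<gamma>b cancels the first twist, so the form obtained below lives
    on the original structures.\<close>
  have undo: "inverse_twist.\<kappa>\<gamma> = hmult A" "inverse_twist.l\<gamma> = lact E" "inverse_twist.r\<gamma> = ract E"
    unfolding inverse_twist.\<kappa>\<gamma>_def inverse_twist.l\<gamma>_def inverse_twist.r\<gamma>_def
    unfolding twisted.\<kappa>\<gamma>_def twisted.l\<gamma>_def twisted.r\<gamma>_def
    by (intro twisted.dpair_dpair self bico mult_bilin l_bilin r_bilin)+
  let ?G = "inverse_twist.G\<gamma> ?H"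
  have G: "metric_form ?G"
    using inverse_twist.deformed_metric_form[OF H\<gamma>] by (simp add: undo)
  \<comment> \<open>On classes the choice made by \<open>arep\<close> is irrelevant because the form
    is balanced for the original actions; elsewhere the value of \<open>g\<close> is
    arbitrary.\<close>
  define g where "g X = tensor_lift ?G (arep X)" for X
  have g: "g (cls t) = tensor_lift ?G t" for t
    unfolding g_def by (rule tensor_lift_arep) (rule metric_formD[OF G])+
  then have "(\<lambda>m n. g (cls (m \<otimes> n))) = ?G"
    by (simp add: fun_eq_iff tensor_lift_pure[OF metric_formD(1)[OF G]])
  then have "bi_invariant_metric A E g"
    unfolding bi_invariant_metric_iff using G g by simp
  moreover have "h X = deform_metric A \<gamma> E g X" if "X \<in> atensor E\<gamma> E\<gamma>" for X
  proof -
    have "deform_metric A \<gamma> E g X = g (cls (xi_rep A \<gamma> E E (arep X)))"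
      by (simp add: deform_metric_def xi_def)
    also have "\<dots> = tensor_lift (twisted.G\<gamma> ?G) (arep X)"
      unfolding g by (rule tensor_lift_xi_rep[OF metric_formD(1)[OF G]])
    also have "twisted.G\<gamma> ?G = ?H"
      by (rule inverse_twist.dpair_dpair[OF bico bico deformed.metric_formD(1)[OF H(1)]])
    also have "tensor_lift ?H (arep X) = h X"
      unfolding H(2)[symmetric] aclass_arep[OF that] ..
    finally show ?thesis by simp
  qed
  ultimately show ?thesis by (rule that)
qed

end

theorem theorem4p15:
  fixes A :: "'a::complex_vector hopf_data"
    and E :: "('a, 'e::complex_vector) bimod_data"
    and \<gamma> :: "'a \<otimes> 'a \<Rightarrow> complex"
  assumes "hopf_algebra A"
    and "bicovariant_bimodule A E"
    and "finite_bimodule A E"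
    and "two_cocycle A \<gamma>"
  shows "(\<forall>g. bi_invariant_metric A E g \<longrightarrow>
            right_linear (deform_hopf A \<gamma>) (deform_bimod A \<gamma> E) (deform_bimod A \<gamma> E)
              (deform_metric A \<gamma> E g))
       \<and> (\<forall>g. bi_invariant_metric A E g \<longrightarrow>
            bicovariant_bimodule (deform_hopf A \<gamma>) (deform_bimod A \<gamma> E) \<and>
            bi_invariant_metric (deform_hopf A \<gamma>) (deform_bimod A \<gamma> E) (deform_metric A \<gamma> E g))
       \<and> (\<forall>h. bi_invariant_metric (deform_hopf A \<gamma>) (deform_bimod A \<gamma> E) h \<longrightarrow>
            (\<exists>g. bi_invariant_metric A E g \<and>
              (\<forall>X\<in>atensor (deform_bimod A \<gamma> E) (deform_bimod A \<gamma> E).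
                h X = deform_metric A \<gamma> E g X)))"
proof -
  obtain S where "hopf (hmult A) (hone A) (comult A) (counit A) S"
    using assms(1) by (auto simp: hopf_algebra_iff)
  moreover have "bicovariant_data A E"
    using assms(2) by (simp add: bicovariant_bimodule_iff)
  ultimately interpret deformation A S E \<gamma>
    by (intro deformation.intro hopf_bimodule.intro hopf_bicovariant.intro
        deformation_axioms.intro assms(4))
  show ?thesis
  proof (intro conjI allI impI)
    fix g assume g: "bi_invariant_metric A E g"
    show "bicovariant_bimodule (deform_hopf A \<gamma>) (deform_bimod A \<gamma> E)"
      by (rule deformed_bimodule)
    show *: "bi_invariant_metric (deform_hopf A \<gamma>) (deform_bimod A \<gamma> E) (deform_metric A \<gamma> E g)"
      by (rule deform_metric_bi_invariant[OF g])
    then show "right_linear (deform_hopf A \<gamma>) (deform_bimod A \<gamma> E) (deform_bimod A \<gamma> E) (deform_metric A \<gamma> E g)"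
      by (simp add: bi_invariant_metric_def pseudo_riemannian_metric_def)
  next
    fix h assume "bi_invariant_metric (deform_hopf A \<gamma>) (deform_bimod A \<gamma> E) h"
    then obtain g where "bi_invariant_metric A E g"
      "\<And>X. X \<in> atensor (deform_bimod A \<gamma> E) (deform_bimod A \<gamma> E) \<Longrightarrow> h X = deform_metric A \<gamma> E g X"
      by (rule deform_metric_surj) (rule that)
    then show "\<exists>g. bi_invariant_metric A E g \<and>
        (\<forall>X\<in>atensor (deform_bimod A \<gamma> E) (deform_bimod A \<gamma> E). h X = deform_metric A \<gamma> E g X)"
      by blast
  qed
qed

end
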